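(* Let $0\le\mu<d$ be integers and let $\Delta$ be a rectilinear partition, with disjoint truncated $l$-edges, of a domain $\Psi\subset\mathbb{R}^2$. Let $t$ be the number of truncated $l$-edges and $c$ the number of cross-cuts of $\Delta$, and let $A_1,\dots,A_V$ be the interior vertices of $\Delta$. Suppose that for each $i=1,\dots,V$ the number $N_i$ of distinct edge directions at $A_i$ satisfies $N_i\ge\mu+3$. Then $$\dim S_d^{\mu}(\Delta)=\binom{d+2}{2}+(c-t)\binom{d-\mu+1}{2}+\sum_{i=1}^{V}k_d^{\mu}(N_i),$$ where $k_d^{\mu}(N)=\sum_{j=1}^{d-\mu}\bigl(N(d-\mu-j+1)-(d-j+2)\bigr)_+$ and $u_+=\max\{0,u\}$.
   Context: A rectilinear partition $\Delta$ of a domain $\Psi\subset\mathbb{R}^2$ is a partition of $\Psi$ into polygonal cells formed by a finite set of straight line segments (for example triangulations, quadrangulations, quasi-cross-cut partitions; cells need not be triangles). Cells, edges and vertices are defined in the usual way: an edge is a segment between two adjacent vertices. A vertex is interior if it lies in the interior of $\Psi$; an edge is interior if it is not contained in $\partial\Psi$. An interior $l$-edge is a maximal straight segment (one that cannot be extended further) composed of collinear interior edges. It is a cross-cut if both endpoints lie on $\partial\Psi$, a ray if exactly one endpoint lies on $\partial\Psi$, and a truncated $l$-edge if neither endpoint lies on $\partial\Psi$. $\Delta$ is a partition with disjoint truncated $l$-edges if its truncated $l$-edges are pairwise disjoint (no two have a common point). The number $N_i$ of distinct edge directions at an interior vertex $A_i$ is the number of distinct lines containing the edges incident to $A_i$ (two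 opposite collinear edges count once). $\mathbb{P}_d$ is the space of real bivariate polynomials of total degree at most $d$, and $S_d^\mu(\Delta)=\{f\in C^\mu(\Psi): f|_\psi\in\mathbb{P}_d\text{ for every cell }\psi\}$.
   Formalization: The domain is assumed simply connected (the formula fails for a square annulus cut by two collinear cross-cuts), and an l-edge is taken to end where it meets the boundary, for example at a reflex corner. *)

theory Defs
  imports "HOL-Analysis.Analysis" "HOL-Library.Function_Algebras"
begin

type_synonym plane = "real^2"

section \<open>Rectilinear partitions\<close>

text \<open>
  A partition is given by a domain \<open>D\<close> (the open set \<open>\<Psi>\<close>), its set \<open>V\<close> of vertices and its
  set \<open>E\<close> of edges, each edge being a closed segment regarded as a point set. The cells are
  the open pieces into which the edges cut the domain.
\<close>

definition cells :: "plane set \<Rightarrow> plane set set \<Rightarrow> plane set set" where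
  "cells D E = components (D - \<Union>E)"

text \<open>
  Polygons need not be convex. The condition \<open>interior (closure P) = P\<close> excludes slits and
  punctures, so that no edge of a partition ends inside a cell or has the same cell on both
  sides.
\<close>

definition open_polygon :: "plane set \<Rightarrow> bool" where
  "open_polygon P \<longleftrightarrow>
     open P \<and> connected P \<and> bounded P \<and> P \<noteq> {} \<and> interior (closure P) = P \<and>
     (\<exists>S. finite S \<and> (\<forall>s\<in>S. \<exists>a b. s = closed_segment a b) \<and> frontier P = \<Union>S)"

text \<open>
  The edges join adjacent vertices: the only vertices on an edge are its end points, and two
  edges meet at most in vertices. The equation for \<open>frontier D\<close> says that the boundary of the
  domain is made up of entire edges.
\<close>

definition rectilinear_partition :: "plane set \<Rightarrow> plane set \<Rightarrow> plane set set \<Rightarrow> bool" where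
  "rectilinear_partition D V E \<longleftrightarrow>
     open D \<and> connected D \<and> bounded D \<and> D \<noteq> {} \<and>
     finite V \<and> V \<subseteq> \<Union>E \<and> \<Union>E \<subseteq> closure D \<and>
     (\<forall>e\<in>E. \<exists>a b. a \<noteq> b \<and> e = closed_segment a b \<and> e \<inter> V = {a, b}) \<and>
     (\<forall>e\<in>E. \<forall>e'\<in>E. e \<noteq> e' \<longrightarrow> e \<inter> e' \<subseteq> V) \<and>
     frontier D = \<Union>{e\<in>E. e \<subseteq> frontier D} \<and>
     (\<forall>P\<in>cells D E. open_polygon P)"

definition interior_vertices :: "plane set \<Rightarrow> plane set \<Rightarrow> plane set" where
  "interior_vertices D V = V \<inter> interior D"

definition interior_edges :: "plane set \<Rightarrow> plane set set \<Rightarrow> plane set set" where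
  "interior_edges D E = {e\<in>E. \<not> e \<subseteq> frontier D}"

definition num_directions :: "plane set set \<Rightarrow> plane \<Rightarrow> nat" where
  "num_directions E A = card {affine hull e | e. e \<in> E \<and> A \<in> e}"

text \<open>
  A segment composed of interior edges may touch the boundary of the domain only with its end
  points: if two collinear interior edges meet at a boundary vertex (a reflex corner of the
  domain), an l-edge stops there.
\<close>

definition edge_chain :: "plane set \<Rightarrow> plane set set \<Rightarrow> plane set \<Rightarrow> bool" where
  "edge_chain D E s \<longleftrightarrow>
     (\<exists>a b. a \<noteq> b \<and> s = closed_segment a b \<and> open_segment a b \<subseteq> D) \<and>
     (\<exists>F\<subseteq>interior_edges D E. s = \<Union>F)"

definition l_edges :: "plane set \<Rightarrow> plane set set \<Rightarrow> plane set set" where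
  "l_edges D E = {s. edge_chain D E s \<and> (\<forall>s'. edge_chain D E s' \<and> s \<subseteq> s' \<longrightarrow> s' = s)}"

definition cross_cuts :: "plane set \<Rightarrow> plane set set \<Rightarrow> plane set set" where
  "cross_cuts D E =
     {s \<in> l_edges D E. \<exists>a b. s = closed_segment a b \<and> a \<in> frontier D \<and> b \<in> frontier D}"

definition truncated_l_edges :: "plane set \<Rightarrow> plane set set \<Rightarrow> plane set set" where
  "truncated_l_edges D E =
     {s \<in> l_edges D E. \<exists>a b. s = closed_segment a b \<and> a \<notin> frontier D \<and> b \<notin> frontier D}"

definition disjoint_truncated_l_edges :: "plane set \<Rightarrow> plane set set \<Rightarrow> bool" where
  "disjoint_truncated_l_edges D E \<longleftrightarrow> pairwise disjnt (truncated_l_edges D E)"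

section \<open>Spline spaces\<close>

definition bivariate_polys :: "nat \<Rightarrow> (plane \<Rightarrow> real) set" where
  "bivariate_polys d =
     {p. \<exists>a. \<forall>x. p x = (\<Sum>(i, j) \<in> {(i, j). i + j \<le> d}. a i j * (x$1) ^ i * (x$2) ^ j)}"

text \<open>\<open>C\<^sup>k\<close> functions on an open set: all iterated directional derivatives up to order \<open>k\<close>
  exist in the Frechet sense and are continuous.\<close>

primrec Ck_on :: "nat \<Rightarrow> (plane \<Rightarrow> real) \<Rightarrow> plane set \<Rightarrow> bool" where
  "Ck_on 0 f D \<longleftrightarrow> continuous_on D f"
| "Ck_on (Suc k) f D \<longleftrightarrow>
     (\<forall>x\<in>D. f differentiable (at x)) \<and> (\<forall>v. Ck_on k (\<lambda>x. frechet_derivative f (at x) v) D)"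

text \<open>
  Functions on the domain are represented by total functions that vanish outside of it, so that
  equality of functions on the domain is equality.
\<close>

definition spline_space :: "nat \<Rightarrow> nat \<Rightarrow> plane set \<Rightarrow> plane set set \<Rightarrow> (plane \<Rightarrow> real) set" where
  "spline_space d \<mu> D E =
     {f. Ck_on \<mu> f D \<and> (\<forall>P\<in>cells D E. \<exists>p\<in>bivariate_polys d. \<forall>x\<in>P. f x = p x) \<and>
         (\<forall>x. x \<notin> D \<longrightarrow> f x = 0)}"

abbreviation scale_fun :: "real \<Rightarrow> (plane \<Rightarrow> real) \<Rightarrow> plane \<Rightarrow> real" where
  "scale_fun c f \<equiv> (\<lambda>x. c * f x)"

lemma vector_space_scale_fun: "vector_space scale_fun"
  by unfold_locales (auto simp: fun_eq_iff algebra_simps)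

text \<open>As always for \<open>dim\<close>, an infinite-dimensional space would get the value 0.\<close>

definition fun_dim :: "(plane \<Rightarrow> real) set \<Rightarrow> nat" where
  "fun_dim = vector_space.dim scale_fun"

text \<open>Integers, because the terms under the positive part may be negative.\<close>

definition k_num :: "nat \<Rightarrow> nat \<Rightarrow> nat \<Rightarrow> int" where
  "k_num d \<mu> N =
     (\<Sum>j = 1..d - \<mu>. max 0 (int N * (int d - int \<mu> - int j + 1) - (int d - int j + 2)))"

end

theory Submission
  imports Defs "HOL-Computational_Algebra.Polynomial" "HOL-Complex_Analysis.Riemann_Mapping"
begin

text \<open>
  Smoothing cofactors: a piecewise polynomial is a \<open>C\<^sup>\<mu>\<close> spline iff its jump across every interior edge is
  a multiple of the \<open>(\<mu> + 1)\<close>-st power of the linear form of the edge. The jumps of a spline form a flow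
  along the interior edges: at every interior vertex their signed sum vanishes. Conversely, every
  such flow is the family of jumps of a spline: the boundary of a simply connected bounded domain
  is connected, so the flow can be closed up along it, and the sum of the flow values weighted with
  the angles under which the edges are seen is then constant on cells with the prescribed
  jumps. Hence the spline space has the dimension of \<open>P\<^sub>d\<close> plus that of the space of flows.

  The vertex conditions are independent. At a vertex \<open>A\<close> at least \<open>\<mu> + 2\<close> l-edges are not truncated, and
  along each of them an arbitrary multiple of the power of its linear form can be led from \<open>A\<close> to the boundary
  without disturbing other vertices; \<open>\<mu> + 2\<close> such powers generate all polynomials vanishing to order
  \<open>\<mu> + 1\<close> at \<open>A\<close>. The number of interior edges is \<open>c - t + (\<Sum>A. N A)\<close>, because an l-edge has one more
  edge, as many edges, or one edge less than interior vertices when it is a cross-cut, a ray or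
  truncated.
\<close>

section \<open>Dimensions of spaces of functions\<close>

text \<open>With k = \<mu> + 1, the computation is rank-nullity for two maps: \<open>jump\<close>,
  whose kernel is a copy of P_d, and \<open>vertex_sum\<close>, whose kernel is the image of
  \<open>jump\<close>. The topology enters in the second claim: on a domain with holes, a flow
  balanced at all interior vertices may have net outflow into one boundary component, and then it is
  not a family of jumps. With a connected boundary only the total outflow matters, and it is 0
  because an edge counts with opposite signs at its two ends. Potentials are found for each point x
  separately; that the pieces are polynomials is recovered afterwards, by comparing each cell with
  one fixed cell through a chain of polynomial jumps. The bound \<mu> + 3 serves the surjectivity of
  \<open>vertex_sum\<close>: disjoint truncated l-edges leave at most one of them at a vertex, so k
  + 1 others remain, as many as there are monomials of degree k in two variables. For such N the
  terms under the positive part in \<open>k_num\<close> are nonnegative, and their sum is N times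
  dim P_{d-k} minus the number of conditions at one vertex.\<close>

definition fscale :: "real \<Rightarrow> ('i \<Rightarrow> real) \<Rightarrow> 'i \<Rightarrow> real" where
  "fscale c f = (\<lambda>i. c * f i)"

lemma fscale_apply [simp]: "fscale c f i = c * f i"
  by (simp add: fscale_def)

text \<open>One polymorphic scaling serves splines, which are functions of a point, as well as
  families of polynomials indexed by cells, edges or vertices, which are encoded as functions on
  pairs; \<open>scale_fun\<close> is its instance on the plane.\<close>

interpretation fv: vector_space fscale
  by unfold_locales (auto simp: fun_eq_iff algebra_simps)

text \<open>A relation instead of a number: it asserts a finite basis, so the value 0 that
  \<open>dim\<close> gives to infinite-dimensional spaces cannot interfere.\<close>

definition has_dim :: "('i \<Rightarrow> real) set \<Rightarrow> nat \<Rightarrow> bool" where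
  "has_dim S n \<longleftrightarrow> (\<exists>B. finite B \<and> fv.independent B \<and> fv.span B = S \<and> card B = n)"

lemma fun_dim_eqI:
  assumes "has_dim S n" shows "fun_dim S = n"
proof -
  have "scale_fun = fscale" by (auto simp: fun_eq_iff)
  then have "fun_dim S = fv.dim S" by (simp add: fun_dim_def)
  with assms show ?thesis
    unfolding has_dim_def using fv.dim_span_eq_card_independent by auto
qed

lemma has_dim_subspace: "has_dim S n \<Longrightarrow> fv.subspace S"
  unfolding has_dim_def using fv.subspace_span by blast

lemma has_dimI: "finite B \<Longrightarrow> fv.independent B \<Longrightarrow> fv.span B = S \<Longrightarrow> has_dim S (card B)"
  unfolding has_dim_def by blast

lemma has_dim_unique:
  assumes "has_dim S n" "has_dim S m" shows "n = m"
  using assms unfolding has_dim_def by (metis fv.dim_span_eq_card_independent)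

lemma linear_fscaleI:
  assumes "\<And>x y. f (x + y) = f x + f y" "\<And>c x. f (fscale c x) = fscale c (f x)"
  shows "Vector_Spaces.linear fscale fscale f"
  by unfold_locales (use assms in \<open>auto\<close>)

text \<open>The coordinates of \<open>x\<close> with respect to \<open>B\<close> are those with
  respect to \<open>C\<close>, hence zero off \<open>C\<close>, and also those with respect to
  \<open>B - C\<close>, hence zero on \<open>C\<close>.\<close>

lemma independent_span_disjoint:
  assumes "fv.independent B" "C \<subseteq> B" "x \<in> fv.span C" "x \<in> fv.span (B - C)"
  shows "x = 0"
proof -
  have eq: "fv.representation B x = fv.representation C x"
    "fv.representation B x = fv.representation (B - C) x"
    using assms by (auto intro!: fv.representation_extend)
  have "fv.representation B x b = 0" for b
    using fv.representation_ne_zero[of C x b] fv.representation_ne_zero[of "B - C" x b] eq by auto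
  moreover have "x \<in> fv.span B" using assms fv.span_mono by blast
  ultimately show ?thesis
    using fv.sum_nonzero_representation_eq[OF assms(1), of x] by simp
qed

text \<open>Rank-nullity in terms of bases: when a basis \<open>C\<close> of the kernel is extended
  to a basis \<open>B\<close> of \<open>S\<close>, the added vectors span a complement of the
  kernel, so \<open>f\<close> is injective there and carries them to a basis of the image.\<close>

lemma linear_image_complement:
  assumes lin: "Vector_Spaces.linear fscale fscale f"
    and C: "fv.span C = {x\<in>S. f x = 0}" "C \<subseteq> B"
    and B: "fv.independent B" "fv.span B = S"
  shows "inj_on f (B - C)" "fv.independent (f ` (B - C))" "fv.span (f ` (B - C)) = f ` S"
proof -
  interpret f: Vector_Spaces.linear fscale fscale f by (rule lin)
  have ker0: "x = 0" if x: "x \<in> fv.span (B - C)" "f x = 0" for x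
  proof -
    have "x \<in> S" using x(1) fv.span_mono[of "B - C" B] B(2) by auto
    then have "x \<in> fv.span C" using C(1) x(2) by auto
    then show ?thesis using independent_span_disjoint[OF B(1) C(2)] x(1) by auto
  qed
  have inj: "inj_on f (fv.span (B - C))"
    using ker0 f.inj_on_iff_eq_0[OF fv.subspace_span] by blast
  then show "inj_on f (B - C)" by (meson fv.span_superset inj_on_subset)
  show "fv.independent (f ` (B - C))"
    by (rule f.independent_injective_image)
       (use inj fv.independent_mono[OF B(1)] in auto)
  have "f ` B \<subseteq> fv.span (f ` (B - C))"
  proof
    fix y assume "y \<in> f ` B"
    then obtain b where b: "b \<in> B" "y = f b" by auto
    show "y \<in> fv.span (f ` (B - C))"
    proof (cases "b \<in> C")
      case True
      then have "b \<in> fv.span C" by (rule fv.span_base)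
      then have "f b = 0" using C(1) by auto
      then show ?thesis using b fv.span_zero by auto
    next
      case False
      then have "f b \<in> f ` (B - C)" using b by blast
      then show ?thesis using b(2) fv.span_base by metis
    qed
  qed
  then have "fv.span (f ` B) \<subseteq> fv.span (f ` (B - C))"
    by (simp add: fv.span_minimal)
  then have "fv.span (f ` (B - C)) = fv.span (f ` B)"
    using fv.span_mono[of "f ` (B - C)" "f ` B"] by auto
  also have "\<dots> = f ` S" by (simp add: f.span_image B(2))
  finally show "fv.span (f ` (B - C)) = f ` S" .
qed

lemma independent_in_has_dim:
  assumes "has_dim S n" "fv.independent B" "B \<subseteq> S"
  shows "finite B"
  using assms fv.independent_span_bound unfolding has_dim_def by blast

lemma span_eqI: "fv.subspace S \<Longrightarrow> B \<subseteq> S \<Longrightarrow> S \<subseteq> fv.span B \<Longrightarrow> fv.span B = S"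
  by (simp add: fv.span_minimal subset_antisym)

lemma subspace_kernel:
  assumes "Vector_Spaces.linear fscale fscale f" "fv.subspace S"
  shows "fv.subspace {x\<in>S. f x = 0}"
proof -
  interpret f: Vector_Spaces.linear fscale fscale f by (rule assms)
  have "{x\<in>S. f x = 0} = S \<inter> {x. f x = 0}" by blast
  then show ?thesis
    using fv.subspace_inter[OF assms(2) f.subspace_kernel] by metis
qed

text \<open>The inequality is recorded because \<open>n - m\<close> is a subtraction of natural
  numbers.\<close>

lemma has_dim_kernel:
  assumes lin: "Vector_Spaces.linear fscale fscale f" and S: "has_dim S n"
      and im: "has_dim (f ` S) m"
  shows "m \<le> n" "has_dim {x\<in>S. f x = 0} (n - m)"
proof -
  let ?K = "{x\<in>S. f x = 0}"
  have subS: "fv.subspace S" using S by (rule has_dim_subspace)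
  have subK: "fv.subspace ?K" by (rule subspace_kernel[OF lin subS])
  obtain C where C: "C \<subseteq> ?K" "fv.independent C" "?K \<subseteq> fv.span C"
    using fv.maximal_independent_subset by blast
  obtain B where B: "C \<subseteq> B" "B \<subseteq> S" "fv.independent B" "S \<subseteq> fv.span B"
    using fv.maximal_independent_subset_extend[of C S] C by blast
  have spC: "fv.span C = ?K" by (rule span_eqI[OF subK C(1,3)])
  have spB: "fv.span B = S" by (rule span_eqI[OF subS B(2,4)])
  have finB: "finite B" by (rule independent_in_has_dim[OF S B(3,2)])
  then have "has_dim S (card B)" unfolding has_dim_def using B spB by blast
  then have n: "card B = n" using S has_dim_unique by blast
  note im' = linear_image_complement[OF lin spC B(1) B(3) spB]
  have "has_dim (f ` S) (card (f ` (B - C)))"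
    by (rule has_dimI[OF _ im'(2,3)]) (use finB in simp)
  then have m: "card (B - C) = m" using has_dim_unique[OF im] card_image[OF im'(1)] by auto
  have finC: "finite C" using finB B(1) finite_subset by blast
  have cC: "card B = card C + card (B - C)"
    using B(1) finB finC by (metis card_Diff_subset card_mono le_add_diff_inverse)
  show "m \<le> n" using cC n m by auto
  show "has_dim ?K (n - m)"
    unfolding has_dim_def using C(2) spC finC cC n m by (intro exI[of _ C]) auto
qed

text \<open>The dimension of \<open>S\<close> is not known beforehand here; finite-dimensional
  kernel and image force it to be finite.\<close>

lemma has_dim_kernel_image:
  assumes lin: "Vector_Spaces.linear fscale fscale f" and subS: "fv.subspace S"
    and ker: "has_dim {x\<in>S. f x = 0} k" and im: "has_dim (f ` S) m"
  shows "has_dim S (k + m)"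
proof -
  obtain C where C: "finite C" "fv.independent C" "fv.span C = {x\<in>S. f x = 0}" "card C = k"
    using ker unfolding has_dim_def by blast
  have "C \<subseteq> S" using C(3) fv.span_superset[of C] by auto
  then obtain B where B: "C \<subseteq> B" "B \<subseteq> S" "fv.independent B" "S \<subseteq> fv.span B"
    using fv.maximal_independent_subset_extend[of C S] C by blast
  have spB: "fv.span B = S" by (rule span_eqI[OF subS B(2,4)])
  note im' = linear_image_complement[OF lin C(3) B(1) B(3) spB]
  have "f ` (B - C) \<subseteq> f ` S" using B(2) by auto
  then have "finite (f ` (B - C))" using independent_in_has_dim[OF im im'(2)] by blast
  then have fin: "finite (B - C)" using finite_imageD im'(1) by blast
  have "has_dim (f ` S) (card (f ` (B - C)))"
    by (rule has_dimI[OF _ im'(2,3)]) (use fin in simp)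
  then have m: "card (B - C) = m" using has_dim_unique[OF im] card_image[OF im'(1)] by auto
  have finB: "finite B" using fin C(1) by (metis finite_Diff2)
  have "card B = k + m"
    using B(1) finB C m by (metis card_Diff_subset card_mono le_add_diff_inverse)
  then show ?thesis unfolding has_dim_def using B spB finB by blast
qed

lemma has_dim_zero: "has_dim {0} 0"
  unfolding has_dim_def by (intro exI[of _ "{}"]) (auto simp: fv.independent_empty)

lemma has_dim_inj_image:
  assumes lin: "Vector_Spaces.linear fscale fscale f" and S: "has_dim S n"
    and ker: "\<And>x. x \<in> S \<Longrightarrow> f x = 0 \<Longrightarrow> x = 0"
  shows "has_dim (f ` S) n"
proof -
  interpret f: Vector_Spaces.linear fscale fscale f by (rule lin)
  obtain B where B: "finite B" "fv.independent B" "fv.span B = S" "card B = n"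
    using S unfolding has_dim_def by blast
  have "0 \<in> S" using has_dim_subspace[OF S] fv.subspace_0 by blast
  then have "fv.span {} = {x\<in>S. f x = 0}" using ker f.zero by auto
  note im' = linear_image_complement[OF lin this _ B(2,3), simplified]
  show ?thesis unfolding has_dim_def
    by (intro exI[of _ "f ` B"]) (use im' B card_image in auto)
qed

text \<open>The set is the span of a basis of \<open>S\<close> together with \<open>a\<close>, in
  the form that \<open>span_insert\<close> gives.\<close>

lemma has_dim_insert:
  assumes "has_dim S n" "a \<notin> S"
  shows "has_dim {x. \<exists>k. x - fscale k a \<in> S} (Suc n)"
proof -
  obtain B where B: "finite B" "fv.independent B" "fv.span B = S" "card B = n"
    using assms unfolding has_dim_def by blast
  have "a \<notin> B" using B(3) assms(2) fv.span_base by blast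
  then show ?thesis unfolding has_dim_def
    by (intro exI[of _ "insert a B"])
       (use B assms fv.independent_insertI[of a B] in \<open>auto simp: fv.span_insert\<close>)
qed

lemma has_dim_finite_support:
  assumes "finite I"
  shows "has_dim {f. \<forall>i. i \<notin> I \<longrightarrow> f i = 0} (card I)"
  using assms
proof (induction I)
  case empty
  have "{f :: 'a \<Rightarrow> real. \<forall>i. i \<notin> {} \<longrightarrow> f i = 0} = {0}" by (auto simp: fun_eq_iff)
  then show ?case using has_dim_zero by simp
next
  case (insert j I)
  let ?a = "(\<lambda>i. if i = j then 1 else 0) :: 'a \<Rightarrow> real"
  have "?a \<notin> {f. \<forall>i. i \<notin> I \<longrightarrow> f i = 0}" using insert by auto
  from has_dim_insert[OF insert.IH this]
  have *: "has_dim {x. \<exists>k. x - fscale k ?a \<in> {f. \<forall>i. i \<notin> I \<longrightarrow> f i = 0}} (card (insert j I))"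
    using insert by simp
  have "{x. \<exists>k. x - fscale k ?a \<in> {f. \<forall>i. i \<notin> I \<longrightarrow> f i = 0}} = {f. \<forall>i. i \<notin> insert j I \<longrightarrow> f i = 0}"
    (is "?L = ?R")
  proof (intro set_eqI iffI)
    fix x assume "x \<in> ?L"
    then obtain k where k: "\<And>i. i \<notin> I \<Longrightarrow> x i - k * ?a i = 0" by auto
    have "x i = 0" if "i \<notin> insert j I" for i using k[of i] that by simp
    then show "x \<in> ?R" by blast
  next
    fix x assume x: "x \<in> ?R"
    have "x - fscale (x j) ?a \<in> {f. \<forall>i. i \<notin> I \<longrightarrow> f i = 0}" using x by auto
    then show "x \<in> ?L" by blast
  qed
  then show ?case using * by simp
qed

section \<open>Bivariate polynomials\<close>

definition exponents :: "nat \<Rightarrow> nat \<Rightarrow> (nat \<times> nat) set" where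
  "exponents k d = {(i, j). k \<le> i + j \<and> i + j \<le> d}"

definition monomial_at :: "plane \<Rightarrow> nat \<times> nat \<Rightarrow> plane \<Rightarrow> real" where
  "monomial_at A ij x = (x$1 - A$1) ^ fst ij * (x$2 - A$2) ^ snd ij"

text \<open>Expanding at \<open>A\<close> makes the vanishing order visible: these are the
  polynomials of degree at most \<open>d\<close> whose partial derivatives of order below
  \<open>k\<close> are zero at \<open>A\<close>. For \<open>k = 0\<close> the space does not depend
  on \<open>A\<close> (\<open>polys_at_shift\<close>), and 0 serves as the standard base
  point.\<close>

definition polys_at :: "plane \<Rightarrow> nat \<Rightarrow> nat \<Rightarrow> (plane \<Rightarrow> real) set" where
  "polys_at A k d = {p. \<exists>c. \<forall>x. p x = (\<Sum>ij\<in>exponents k d. c ij * monomial_at A ij x)}"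

lemma exponents_subset: "exponents k d \<subseteq> {..d} \<times> {..d}"
  by (auto simp: exponents_def)

lemma finite_exponents [simp]: "finite (exponents k d)"
  by (rule finite_subset[OF exponents_subset]) auto

lemma bivariate_polys_eq: "bivariate_polys d = polys_at 0 0 d"
proof -
  have "(\<Sum>(i, j) \<in> {(i, j). i + j \<le> d}. a i j * (x$1) ^ i * (x$2) ^ j)
      = (\<Sum>ij\<in>exponents 0 d. a (fst ij) (snd ij) * monomial_at 0 ij x)" for a and x :: plane
    by (auto simp: exponents_def monomial_at_def case_prod_beta intro!: sum.cong)
  then have "p \<in> bivariate_polys d \<longleftrightarrow> (\<exists>a. \<forall>x. p x = (\<Sum>ij\<in>exponents 0 d. a (fst ij) (snd ij) *
      monomial_at 0 ij x))" for p
    unfolding bivariate_polys_def by simp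
  \<comment> \<open>Coefficients indexed by pairs and curried coefficients amount to the
    same.\<close>
  moreover have E: "(\<exists>a :: nat \<Rightarrow> nat \<Rightarrow> real. Q (\<lambda>ij. a (fst ij) (snd ij))) \<longleftrightarrow> (\<exists>c. Q c)" for Q
  proof
    assume "\<exists>c. Q c"
    then obtain c where "Q c" by blast
    then have "Q (\<lambda>ij. c (fst ij, snd ij))" by simp
    then show "\<exists>a :: nat \<Rightarrow> nat \<Rightarrow> real. Q (\<lambda>ij. a (fst ij) (snd ij))" by (rule exI[where x
        = "\<lambda>i j. c (i, j)"])
  qed blast
  ultimately have "p \<in> bivariate_polys d \<longleftrightarrow> (\<exists>c. \<forall>x. p x = (\<Sum>ij\<in>exponents 0 d. c ij * monomial_at 0
      ij x))" for p
    using E[of "\<lambda>c. \<forall>x. p x = (\<Sum>ij\<in>exponents 0 d. c ij * monomial_at 0 ij x)"] by simp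
  then show ?thesis unfolding polys_at_def by blast
qed

lemma polys_at_zero: "(\<lambda>x. 0) \<in> polys_at A k d"
  unfolding polys_at_def by (auto intro!: exI[of _ "\<lambda>_. 0"])

lemma polys_at_add: "p \<in> polys_at A k d \<Longrightarrow> q \<in> polys_at A k d \<Longrightarrow> (\<lambda>x. p x + q x) \<in> polys_at A k d"
proof -
  assume "p \<in> polys_at A k d" "q \<in> polys_at A k d"
  then obtain c c' where "\<And>x. p x = (\<Sum>ij\<in>exponents k d. c ij * monomial_at A ij x)"
    "\<And>x. q x = (\<Sum>ij\<in>exponents k d. c' ij * monomial_at A ij x)" unfolding polys_at_def by blast
  then show ?thesis unfolding polys_at_def
    by (auto intro!: exI[of _ "\<lambda>ij. c ij + c' ij"] simp: sum.distrib[symmetric] algebra_simps)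
qed

lemma polys_at_cmult: "p \<in> polys_at A k d \<Longrightarrow> (\<lambda>x. r * p x) \<in> polys_at A k d"
proof -
  assume "p \<in> polys_at A k d"
  then obtain c where "\<And>x. p x = (\<Sum>ij\<in>exponents k d. c ij * monomial_at A ij x)"
      unfolding polys_at_def by blast
  then show ?thesis unfolding polys_at_def
    by (auto intro!: exI[of _ "\<lambda>ij. r * c ij"] simp: sum_distrib_left algebra_simps)
qed

lemma polys_at_diff: "p \<in> polys_at A k d \<Longrightarrow> q \<in> polys_at A k d \<Longrightarrow> (\<lambda>x. p x - q x) \<in> polys_at A k d"
  using polys_at_add[of p A k d "\<lambda>x. -1 * q x"] polys_at_cmult[of q A k d "-1"] by simp

lemma polys_at_sum: "(\<And>i. i \<in> I \<Longrightarrow> f i \<in> polys_at A k d) \<Longrightarrow> (\<lambda>x. \<Sum>i\<in>I. f i x) \<in> polys_at A k d"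
  by (induction I rule: infinite_finite_induct) (auto intro: polys_at_zero polys_at_add)

lemma polys_at_monomial_at: "ij \<in> exponents k d \<Longrightarrow> monomial_at A ij \<in> polys_at A k d"
  unfolding polys_at_def
proof (rule CollectI, intro exI allI)
  fix x assume ij: "ij \<in> exponents k d"
  have "(\<Sum>i\<in>exponents k d. (if i = ij then 1 else 0) * monomial_at A i x) = (\<Sum>i\<in>exponents k d. if i
      = ij then monomial_at A i x else 0)"
    by (rule sum.cong) auto
  then show "monomial_at A ij x = (\<Sum>i\<in>exponents k d. (if i = ij then 1 else 0) * monomial_at A i x)"
    using ij by simp
qed

lemma polys_atE:
  assumes "p \<in> polys_at A k d"
  obtains c where "p = (\<lambda>x. \<Sum>ij\<in>exponents k d. c ij * monomial_at A ij x)"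
  using assms unfolding polys_at_def by (auto simp: fun_eq_iff)

lemma polys_at_mono: "k' \<le> k \<Longrightarrow> d \<le> d' \<Longrightarrow> p \<in> polys_at A k d \<Longrightarrow> p \<in> polys_at A k' d'"
  by (erule polys_atE) (auto simp: exponents_def intro!: polys_at_sum polys_at_cmult polys_at_monomial_at)

lemma monomial_at_mult: "monomial_at A ij x * monomial_at A kl x = monomial_at A (fst ij
    + fst kl, snd ij + snd kl) x"
  by (simp add: monomial_at_def power_add)

lemma polys_at_mult:
  assumes "p \<in> polys_at A k d" "q \<in> polys_at A k' d'"
  shows "(\<lambda>x. p x * q x) \<in> polys_at A (k + k') (d + d')"
proof -
  obtain c where p: "p = (\<lambda>x. \<Sum>ij\<in>exponents k d. c ij * monomial_at A ij x)" using assms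
      by (elim polys_atE)
  obtain c' where q: "q = (\<lambda>x. \<Sum>ij\<in>exponents k' d'. c' ij * monomial_at A ij x)" using assms
      by (elim polys_atE)
  have "(\<lambda>x. p x * q x) = (\<lambda>x. \<Sum>ij\<in>exponents k d. \<Sum>kl\<in>exponents k' d'.
      (c ij * c' kl) * monomial_at A (fst ij + fst kl, snd ij + snd kl) x)"
    unfolding p q sum_product by (simp add: monomial_at_mult[symmetric] ac_simps)
  also have "\<dots> \<in> polys_at A (k + k') (d + d')"
    by (intro polys_at_sum polys_at_cmult polys_at_monomial_at) (auto simp: exponents_def)
  finally show ?thesis .
qed

lemma polys_at_const: "(\<lambda>x. r) \<in> polys_at A 0 d"
proof -
  have "(\<lambda>x. r * monomial_at A (0, 0) x) \<in> polys_at A 0 d"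
      by (intro polys_at_cmult polys_at_monomial_at) (auto simp: exponents_def)
  then show ?thesis by (simp add: monomial_at_def)
qed

lemma polys_at_power: "p \<in> polys_at A k d \<Longrightarrow> (\<lambda>x. p x ^ n) \<in> polys_at A (n * k) (n * d)"
proof (induction n)
  case 0
  then show ?case using polys_at_const[of 1 A 0] by simp
next
  case (Suc n)
  then show ?case using polys_at_mult[of p A k d "\<lambda>x. p x ^ n"] by simp
qed

lemma polys_at_linear: "(\<lambda>x. r * (x$1 - A$1) + s * (x$2 - A$2)) \<in> polys_at A 1 1"
proof -
  have "(\<lambda>x. r * monomial_at A (1, 0) x + s * monomial_at A (0, 1) x) \<in> polys_at A 1 1"
    by (intro polys_at_add polys_at_cmult polys_at_monomial_at) (auto simp: exponents_def)
  then show ?thesis by (simp add: monomial_at_def)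
qed

lemma polys_at_affine: "(\<lambda>x. r * x$1 + s * x$2 + t) \<in> polys_at A 0 1"
proof -
  have "(\<lambda>x. (r * (x$1 - A$1) + s * (x$2 - A$2)) + (r * A$1 + s * A$2 + t)) \<in> polys_at A 0 1"
    by (intro polys_at_add polys_at_const polys_at_mono[OF _ _ polys_at_linear]) auto
  then show ?thesis by (simp add: algebra_simps)
qed

text \<open>An affine change of variables does not raise the degree. It is used for translations and
  for the coordinates along and across a line.\<close>

lemma polys_at_compose:
  assumes "p \<in> polys_at B 0 d" "\<alpha> \<in> polys_at A 0 1" "\<beta> \<in> polys_at A 0 1"
  shows "(\<lambda>x. p (vector [\<alpha> x, \<beta> x])) \<in> polys_at A 0 d"
proof -
  obtain c where p: "p = (\<lambda>x. \<Sum>ij\<in>exponents 0 d. c ij * monomial_at B ij x)" using assms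
      by (elim polys_atE)
  have "(\<lambda>x. monomial_at B ij (vector [\<alpha> x, \<beta> x])) \<in> polys_at A 0 d" if "ij \<in> exponents 0 d" for ij
  proof -
    have "(\<lambda>x. (\<alpha> x - B$1) ^ fst ij * (\<beta> x - B$2) ^ snd ij)
        \<in> polys_at A (fst ij * 0 + snd ij * 0) (fst ij * 1 + snd ij * 1)"
      by (intro polys_at_mult polys_at_power polys_at_diff assms polys_at_const)
    then show ?thesis using that by (auto simp: monomial_at_def exponents_def intro: polys_at_mono)
  qed
  then show ?thesis unfolding p by (intro polys_at_sum polys_at_cmult)
qed

lemma vector_eta2: "vector [x$1, x$2] = (x :: real^2)"
  by (simp add: vec_eq_iff forall_2)

lemma polys_at_shift: "polys_at A 0 d = polys_at B 0 d"
proof -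
  have "p \<in> polys_at B 0 d" if "p \<in> polys_at A 0 d" for p A B
    using polys_at_compose[OF that polys_at_affine[of 1 0 0 B] polys_at_affine[of 0 1 0 B]]
    by (simp add: vector_eta2)
  then show ?thesis by blast
qed

section \<open>Uniqueness of the coefficients of a bivariate polynomial\<close>

lemma sum_exponents:
  "(\<Sum>ij\<in>exponents k d. f ij) = (\<Sum>i\<le>d. \<Sum>j\<le>d. if (i, j) \<in> exponents k d then f (i, j) else 0)"
proof -
  have "(\<Sum>ij\<in>exponents k d. f ij) = (\<Sum>ij\<in>{..d} \<times> {..d}. if ij \<in> exponents k d then f ij else 0)"
    by (subst sum.inter_restrict[symmetric]) (use exponents_subset[of k d] in \<open>auto simp:
        Int_absorb1\<close>)
  then show ?thesis by (simp add: sum.cartesian_product case_prod_unfold cong: if_cong)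
qed

text \<open>For fixed y the polynomial in x has infinitely many roots, so its coefficients vanish;
  these are polynomials in y with infinitely many roots themselves.\<close>

lemma bipoly_zero:
  fixes C :: "nat \<Rightarrow> nat \<Rightarrow> real"
  assumes "infinite X" "infinite Y"
    and "\<And>x y. x \<in> X \<Longrightarrow> y \<in> Y \<Longrightarrow> (\<Sum>i\<le>n. \<Sum>j\<le>n. C i j * (x ^ i * y ^ j)) = 0"
    and "i \<le> n" "j \<le> n"
  shows "C i j = 0"
proof -
  have *: "(\<Sum>j\<le>n. C i j * y ^ j) = 0" if y: "y \<in> Y" and i: "i \<le> n" for y i
  proof (rule ccontr)
    assume "(\<Sum>j\<le>n. C i j * y ^ j) \<noteq> 0"
    then have "finite {x. (\<Sum>i\<le>n. (\<Sum>j\<le>n. C i j * y ^ j) * x ^ i) = 0}"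
      using polyfun_finite_roots[of "\<lambda>i. \<Sum>j\<le>n. C i j * y ^ j" n] i by blast
    moreover have "X \<subseteq> {x. (\<Sum>i\<le>n. (\<Sum>j\<le>n. C i j * y ^ j) * x ^ i) = 0}"
      using assms(3)[OF _ y] by (auto simp: sum_distrib_right sum_distrib_left ac_simps)
    ultimately show False using assms(1) finite_subset by blast
  qed
  show ?thesis
  proof (rule ccontr)
    assume "C i j \<noteq> 0"
    then have "finite {y. (\<Sum>j\<le>n. C i j * y ^ j) = 0}"
      using polyfun_finite_roots[of "C i" n] assms by blast
    moreover have "Y \<subseteq> {y. (\<Sum>j\<le>n. C i j * y ^ j) = 0}" using *[OF _ assms(4)] by blast
    ultimately show False using assms(2) finite_subset by blast
  qed
qed

lemma open_contains_box2:
  fixes x :: plane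
  assumes "open U" "x \<in> U"
  obtains e where "e > 0" "\<And>s t. \<bar>s - x$1\<bar> < e \<Longrightarrow> \<bar>t - x$2\<bar> < e \<Longrightarrow> vector [s, t] \<in> U"
proof -
  obtain r where r: "r > 0" "ball x r \<subseteq> U" using assms openE by blast
  show thesis
  proof (rule that[of "r/2"])
    fix s t assume st: "\<bar>s - x$1\<bar> < r/2" "\<bar>t - x$2\<bar> < r/2"
    have "norm (vector [s, t] - x) \<le> \<bar>s - x$1\<bar> + \<bar>t - x$2\<bar>"
      using norm_le_l1_cart[of "vector [s, t] - x"] by (simp add: sum_2)
    then have "dist x (vector [s, t]) < r" using st by (simp add: dist_norm norm_minus_commute)
    then show "vector [s, t] \<in> U" using r by auto
  qed (use r in auto)
qed

lemma monomial_at_coeffs_zero: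
  assumes "open U" "U \<noteq> {}" "\<And>x. x \<in> U \<Longrightarrow> (\<Sum>ij\<in>exponents k d. c ij * monomial_at A ij x) = 0"
    and "ij \<in> exponents k d"
  shows "c ij = 0"
proof -
  obtain x where "x \<in> U" using assms by blast
  then obtain e where e: "e > 0" "\<And>s t. \<bar>s - x$1\<bar> < e \<Longrightarrow> \<bar>t - x$2\<bar> < e \<Longrightarrow> vector [s, t] \<in> U"
    using open_contains_box2[OF assms(1)] by blast
  let ?C = "\<lambda>i j. if (i, j) \<in> exponents k d then c (i, j) else 0"
  let ?X = "\<lambda>m. {s. \<bar>s - (x$m - A$m)\<bar> < e}"
  have inf: "infinite (?X m)" for m
  proof -
    have "{x$m - A$m <..< x$m - A$m + e} \<subseteq> ?X m" by auto
    moreover have "infinite {x$m - A$m <..< x$m - A$m + e}" using e(1) by (simp add: infinite_Ioo)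
    ultimately show ?thesis using finite_subset by blast
  qed
  have "?C (fst ij) (snd ij) = 0"
  proof (rule bipoly_zero[of "?X 1" "?X 2" ?C, OF inf inf])
    fix s t assume "s \<in> ?X 1" "t \<in> ?X 2"
    \<comment> \<open>Shifting by \<open>A\<close> turns the monomials at \<open>A\<close> into
      plain monomials in \<open>s\<close> and \<open>t\<close>.\<close>
    then have "vector [s + A$1, t + A$2] \<in> U" by (intro e(2)) (auto simp: algebra_simps)
    from assms(3)[OF this] have "(\<Sum>ij\<in>exponents k d. c ij * (s ^ fst ij * t ^ snd ij)) = 0"
      by (simp add: monomial_at_def)
    then show "(\<Sum>i\<le>d. \<Sum>j\<le>d. ?C i j * (s ^ i * t ^ j)) = 0"
      by (subst (asm) sum_exponents) (simp add: if_distribR if_distrib[of "\<lambda>r. r * _"] cong: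
          if_cong)
  qed (use assms(4) in \<open>auto simp: exponents_def\<close>)
  then show ?thesis using assms(4) by simp
qed

lemma polys_at_eq_0:
  assumes "open U" "U \<noteq> {}" "p \<in> polys_at A k d" "\<And>x. x \<in> U \<Longrightarrow> p x = 0"
  shows "p x = 0"
proof -
  obtain c where p: "p = (\<lambda>x. \<Sum>ij\<in>exponents k d. c ij * monomial_at A ij x)" using assms
      by (elim polys_atE)
  have "(\<Sum>ij\<in>exponents k d. c ij * monomial_at A ij x) = 0" if "x \<in> U" for x
    using assms(4)[OF that] by (simp add: p)
  then have "c ij = 0" if "ij \<in> exponents k d" for ij
    by (rule monomial_at_coeffs_zero[OF assms(1,2) _ that])
  then show ?thesis by (simp add: p)
qed

section \<open>Linear forms of lines and the multiples of their powers\<close>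

definition det2 :: "plane \<Rightarrow> plane \<Rightarrow> real" where
  "det2 u v = u$1 * v$2 - u$2 * v$1"

lemma det2_simps [simp]: "det2 u u = 0" "det2 0 v = 0" "det2 u 0 = 0"
  "det2 u (c *\<^sub>R v) = c * det2 u v" "det2 (c *\<^sub>R u) v = c * det2 u v"
  by (auto simp: det2_def algebra_simps)

lemma det2_add: "det2 u (v + w) = det2 u v + det2 u w" "det2 (u + v) w = det2 u w + det2 v w"
  and det2_diff: "det2 u (v - w) = det2 u v - det2 u w" "det2 (u - v) w = det2 u w - det2 v w"
  and det2_uminus: "det2 (- u) v = - det2 u v" "det2 u (- v) = - det2 u v"
  by (auto simp: det2_def algebra_simps)

lemma det2_eq_0D:
  assumes "det2 u v = 0" "u \<noteq> 0"
  shows "\<exists>c. v = c *\<^sub>R u"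
proof (cases "u$1 = 0")
  case True
  then have "u$2 \<noteq> 0" using assms(2) by (auto simp: vec_eq_iff forall_2)
  then have "v = (v$2 / u$2) *\<^sub>R u" using assms True by (auto simp: vec_eq_iff forall_2 det2_def)
  then show ?thesis by blast
next
  case False
  then have "v = (v$1 / u$1) *\<^sub>R u" using assms by (auto simp: vec_eq_iff forall_2 det2_def
      field_simps)
  then show ?thesis by blast
qed

text \<open>Twice the signed area of the triangle \<open>a\<close>, \<open>b\<close>,
  \<open>x\<close>: zero on the line and positive to the left of the direction from \<open>a\<close>
  to \<open>b\<close>, so its sign separates the two sides of an edge.\<close>

definition line_form :: "plane \<Rightarrow> plane \<Rightarrow> plane \<Rightarrow> real" where
  "line_form a b x = det2 (b - a) (x - a)"

text \<open>The possible jumps across an edge on the line through \<open>a\<close> and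
  \<open>b\<close>; the quotient \<open>q\<close> is the smoothing cofactor.\<close>

definition line_multiples :: "plane \<Rightarrow> plane \<Rightarrow> nat \<Rightarrow> nat \<Rightarrow> (plane \<Rightarrow> real) set" where
  "line_multiples a b k d = {p. \<exists>q\<in>polys_at 0 0 (d - k). \<forall>x. p x = q x * line_form a b x ^ k}"

lemma line_form_shift: "line_form a b A = 0 \<Longrightarrow> line_form a b x = det2 (b - a) (x - A)"
  by (simp add: line_form_def det2_def algebra_simps)

lemma line_form_polys_at: "line_form a b A = 0 \<Longrightarrow> line_form a b \<in> polys_at A 1 1"
proof -
  assume "line_form a b A = 0"
  then have *: "line_form a b = (\<lambda>x. - (b - a)$2 * (x$1 - A$1) + (b - a)$1 * (x$2 - A$2))"
    unfolding fun_eq_iff using line_form_shift[of a b A] by (simp add: det2_def algebra_simps)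
  show ?thesis unfolding * by (rule polys_at_linear)
qed

lemma line_form_gp0: "line_form a b \<in> polys_at A 0 1"
proof -
  have "line_form a b \<in> polys_at a 1 1" by (rule line_form_polys_at) (simp add: line_form_def)
  then have "line_form a b \<in> polys_at a 0 1" by (rule polys_at_mono[rotated 2]) auto
  then show ?thesis using polys_at_shift by blast
qed

lemma line_multiples_polys_at:
  assumes "p \<in> line_multiples a b k d" "line_form a b A = 0" "k \<le> d"
  shows "p \<in> polys_at A k d"
proof -
  obtain q where q: "q \<in> polys_at A 0 (d - k)" "p = (\<lambda>x. q x * line_form a b x ^ k)"
    using assms(1) polys_at_shift unfolding line_multiples_def fun_eq_iff by blast
  have "(\<lambda>x. q x * line_form a b x ^ k) \<in> polys_at A (0 + k * 1) (d - k + k * 1)"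
    by (intro polys_at_mult polys_at_power q line_form_polys_at assms)
  then show ?thesis using q assms(3) by simp
qed

lemma line_multiples_gp0: "p \<in> line_multiples a b k d \<Longrightarrow> k \<le> d \<Longrightarrow> p \<in> polys_at 0 0 d"
  using line_multiples_polys_at[of p a b k d a] polys_at_mono[of 0 k d d p a] polys_at_shift[of a d
      0] by (auto simp: line_form_def)

lemma line_multiples_add: "p \<in> line_multiples a b k d \<Longrightarrow> q \<in> line_multiples a b k d \<Longrightarrow> (\<lambda>x. p x + q x)
    \<in> line_multiples a b k d"
  unfolding line_multiples_def
  by (clarsimp simp flip: distrib_right) (metis (no_types, lifting) polys_at_add)

lemma line_multiples_cmult: "p \<in> line_multiples a b k d \<Longrightarrow> (\<lambda>x. r * p x) \<in> line_multiples a b k d"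
  unfolding line_multiples_def
  by (clarsimp simp flip: mult.assoc) (metis (no_types, lifting) polys_at_cmult)

lemma line_multiples_zero: "(\<lambda>x. 0) \<in> line_multiples a b k d"
  unfolding line_multiples_def using polys_at_zero by fastforce

lemma line_multiples_sum: "(\<And>i. i \<in> I \<Longrightarrow> f i \<in> line_multiples a b k d) \<Longrightarrow> (\<lambda>x. \<Sum>i\<in>I. f i x)
    \<in> line_multiples a b k d"
  by (induction I rule: infinite_finite_induct) (auto intro: line_multiples_zero line_multiples_add)

text \<open>Coordinates \<open>(\<sigma>, \<tau>)\<close> along and across the line turn divisibility
    by a power of \<open>line_form a b\<close> into
  the vanishing of the low coefficients with respect to \<open>\<tau>\<close>.\<close>

lemma line_multiplesI:
  assumes p: "p \<in> polys_at 0 0 d" and ab: "a \<noteq> b" and kd: "k \<le> d" and X: "infinite X"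
    and line: "\<And>x. x \<in> X \<Longrightarrow> line_form a b x = 0"
    and vanishes: "\<And>x \<pi> m. x \<in> X \<Longrightarrow> m < k
      \<Longrightarrow> (\<And>t. p (x + t *\<^sub>R vector [a$2 - b$2, b$1 - a$1]) = poly \<pi> t) \<Longrightarrow> coeff \<pi> m = 0"
  shows "p \<in> line_multiples a b k d"
proof -
  define u where "u = b - a"
  define n :: plane where "n = vector [- u$2, u$1]"
  define N where "N = u$1 ^ 2 + u$2 ^ 2"
  have "u \<noteq> 0" using ab by (simp add: u_def)
  then have N: "N > 0" unfolding N_def
    by (auto simp: vec_eq_iff forall_2 sum_power2_gt_zero_iff)
  define \<sigma> where "\<sigma> = (\<lambda>x :: plane. (u$1 * (x$1 - a$1) + u$2 * (x$2 - a$2)) / N)"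
  define \<tau> where "\<tau> = (\<lambda>x. line_form a b x / N)"
  have tau: "\<tau> x = (u$1 * (x$2 - a$2) - u$2 * (x$1 - a$1)) / N" for x
    by (simp add: \<tau>_def line_form_def det2_def u_def)
  \<comment> \<open>\<open>P\<close> is \<open>p\<close> in the coordinates (s, t) of the point a +
    s u + t n, where n is u after a quarter turn; \<open>eta\<close> below says that \<sigma> and
    \<tau> recover these coordinates.\<close>
  define P where "P = (\<lambda>y :: plane. p (vector [a$1 + y$1 * u$1 - y$2 * u$2, a$2 + y$1 * u$2
      + y$2 * u$1]))"
  have "(\<lambda>y. a$1 + y$1 * u$1 - y$2 * u$2) \<in> polys_at 0 0 1" "(\<lambda>y. a$2 + y$1 * u$2 + y$2 * u$1)
      \<in> polys_at 0 0 1"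
    using polys_at_affine[of "u$1" "- u$2" "a$1" 0] polys_at_affine[of "u$2" "u$1" "a$2" 0]
    by (simp_all add: algebra_simps)
  then have "P \<in> polys_at 0 0 d" unfolding P_def by (rule polys_at_compose[OF p])
  then obtain c where c: "P = (\<lambda>x. \<Sum>ij\<in>exponents 0 d. c ij * monomial_at 0 ij x)" by (elim polys_atE)
  have eta: "x = vector [a$1 + \<sigma> x * u$1 - \<tau> x * u$2, a$2 + \<sigma> x * u$2 + \<tau> x * u$1]" for x :: plane
  proof -
    have "N * (\<sigma> x * u$1 - \<tau> x * u$2) = N * (x$1 - a$1)" "N * (\<sigma> x * u$2 + \<tau> x * u$1)
        = N * (x$2 - a$2)"
      using N unfolding tau \<sigma>_def by (simp_all add: field_simps) (simp_all add: N_def algebra_simps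
          power2_eq_square)
    then have "\<sigma> x * u$1 - \<tau> x * u$2 = x$1 - a$1" "\<sigma> x * u$2 + \<tau> x * u$1 = x$2 - a$2"
      using N by simp_all
    then show ?thesis by (simp add: vec_eq_iff forall_2)
  qed
  have pP: "p x = P (vector [\<sigma> x, \<tau> x])" for x
    unfolding P_def using eta[of x] by simp
  have c0: "c (i, m) = 0" if m: "m < k" and im: "(i, m) \<in> exponents 0 d" for i m
  proof -
    let ?C = "\<lambda>i. if (i, m) \<in> exponents 0 d then c (i, m) else 0"
    have "(\<Sum>i\<le>d. ?C i * s ^ i) = 0" if s: "s \<in> \<sigma> ` X" for s
    proof -
      obtain x where x: "x \<in> X" "s = \<sigma> x" using s by blast
      \<comment> \<open>Along the normal through \<open>x\<close> the first coordinate stays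
        \<open>s\<close> and the second one is t, so the coefficient of t^m is the sum of c (i, m)
        s^i over all i.\<close>
      let ?\<pi> = "\<Sum>ij\<in>exponents 0 d. monom (c ij * s ^ fst ij) (snd ij)"
      have tx: "\<tau> x = 0" using line[OF x(1)] by (simp add: \<tau>_def)
      have "p (x + t *\<^sub>R vector [a$2 - b$2, b$1 - a$1]) = poly ?\<pi> t" for t
      proof -
        have "x + t *\<^sub>R vector [a$2 - b$2, b$1 - a$1]
            = vector [a$1 + s * u$1 - t * u$2, a$2 + s * u$2 + t * u$1]"
          using eta[of x] unfolding tx x(2) by (simp add: vec_eq_iff forall_2 u_def algebra_simps)
        then have "p (x + t *\<^sub>R vector [a$2 - b$2, b$1 - a$1]) = P (vector [s, t])"
          unfolding P_def by simp
        then show ?thesis by (simp add: c monomial_at_def poly_sum poly_monom mult.assoc)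
      qed
      then have "coeff ?\<pi> m = 0" by (rule vanishes[OF x(1) m])
      then have "(\<Sum>ij\<in>exponents 0 d. if snd ij = m then c ij * s ^ fst ij else 0) = 0"
        by (simp add: coeff_sum)
      then have "(\<Sum>i\<le>d. \<Sum>j\<le>d. if (i, j) \<in> exponents 0 d then (if j
          = m then c (i, j) * s ^ i else 0) else 0) = 0"
        by (subst (asm) sum_exponents) (simp cong: if_cong)
      also have "(\<Sum>i\<le>d. \<Sum>j\<le>d. if (i, j) \<in> exponents 0 d then (if j
          = m then c (i, j) * s ^ i else 0) else 0)
          = (\<Sum>i\<le>d. \<Sum>j\<le>d. if j = m then ?C i * s ^ i else 0)"
        by (intro sum.cong) auto
      also have "\<dots> = (\<Sum>i\<le>d. ?C i * s ^ i)"
        using m kd by (simp add: sum.delta)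
      finally show ?thesis .
    qed
    then have sub: "\<sigma> ` X \<subseteq> {s. (\<Sum>i\<le>d. ?C i * s ^ i) = 0}" by blast
    \<comment> \<open>On the line \<tau> is 0, so \<sigma> alone determines the point: the
      infinitely many points of \<open>X\<close> give infinitely many roots of the polynomial in
      \<open>s\<close>.\<close>
    have "inj_on \<sigma> X"
    proof (rule inj_onI)
      fix x y assume "x \<in> X" "y \<in> X" "\<sigma> x = \<sigma> y"
      moreover have "\<tau> x = 0" "\<tau> y = 0" using calculation line by (auto simp: \<tau>_def)
      ultimately show "x = y" using eta[of x] eta[of y] by simp
    qed
    then have "infinite (\<sigma> ` X)" using X finite_imageD by blast
    then have "infinite {s. (\<Sum>i\<le>d. ?C i * s ^ i) = 0}" using sub finite_subset by blast
    then have "\<forall>i\<le>d. ?C i = 0" using polyfun_finite_roots[of ?C d] by blast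
    moreover have "i \<le> d" using im by (auto simp: exponents_def)
    ultimately have "?C i = 0" by blast
    then show ?thesis using im by simp
  qed
  \<comment> \<open>No exponent of \<tau> below \<open>k\<close> is left, so \<tau>^k splits off; it
    equals the \<open>k\<close>-th power of the line form divided by N^k, whence the
    denominator.\<close>
  let ?q = "\<lambda>x. \<Sum>ij\<in>{ij\<in>exponents 0 d. k \<le> snd ij}. (c ij / N ^ k) * (\<sigma> x ^ fst ij * \<tau> x ^ (snd ij -
      k))"
  have sig: "\<sigma> \<in> polys_at 0 0 1"
    using polys_at_affine[of "u$1 / N" "u$2 / N" "- (u$1 * a$1 + u$2 * a$2) / N" 0]
    by (simp add: \<sigma>_def algebra_simps add_divide_distrib diff_divide_distrib)
  have ta: "\<tau> \<in> polys_at 0 0 1"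
    using polys_at_cmult[OF line_form_gp0, of "1/N" a b 0] by (simp add: \<tau>_def)
  have "(\<lambda>x. \<sigma> x ^ fst ij * \<tau> x ^ (snd ij - k)) \<in> polys_at 0 0 (d - k)" if ij: "ij
      \<in> {ij\<in>exponents 0 d. k \<le> snd ij}" for ij
  proof -
    have "(\<lambda>x. \<sigma> x ^ fst ij * \<tau> x ^ (snd ij - k)) \<in> polys_at 0 (fst ij * 0
        + (snd ij - k) * 0) (fst ij * 1 + (snd ij - k) * 1)"
      by (intro polys_at_mult polys_at_power sig ta)
    then show ?thesis by (rule polys_at_mono[rotated 2]) (use ij in \<open>auto simp: exponents_def\<close>)
  qed
  then have q: "?q \<in> polys_at 0 0 (d - k)" by (intro polys_at_sum polys_at_cmult)
  have "p x = ?q x * line_form a b x ^ k" for x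
  proof -
    have "p x = (\<Sum>ij\<in>exponents 0 d. c ij * (\<sigma> x ^ fst ij * \<tau> x ^ snd ij))"
      by (simp add: pP c monomial_at_def)
    also have "\<dots> = (\<Sum>ij\<in>{ij\<in>exponents 0 d. k \<le> snd ij}. c ij * (\<sigma> x ^ fst ij * \<tau> x ^ snd ij))"
      using c0 by (intro sum.mono_neutral_right) (auto simp: not_le)
    also have "\<dots> = (\<Sum>ij\<in>{ij\<in>exponents 0 d. k \<le> snd ij}. (c ij / N ^ k) * (\<sigma> x ^ fst ij * \<tau> x ^ (snd
        ij - k)) * line_form a b x ^ k)"
    proof (rule sum.cong)
      fix ij assume "ij \<in> {ij\<in>exponents 0 d. k \<le> snd ij}"
      then have "\<tau> x ^ snd ij = \<tau> x ^ (snd ij - k) * \<tau> x ^ k" by (simp flip: power_add)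
      also have "\<tau> x ^ k = line_form a b x ^ k / N ^ k" by (simp add: \<tau>_def power_divide)
      finally show "c ij * (\<sigma> x ^ fst ij * \<tau> x ^ snd ij)
          = (c ij / N ^ k) * (\<sigma> x ^ fst ij * \<tau> x ^ (snd ij - k)) * line_form a b x ^ k" by simp
    qed simp
    finally show ?thesis by (simp add: sum_distrib_right)
  qed
  then show ?thesis unfolding line_multiples_def by (intro CollectI bexI[OF _ q] allI)
qed

text \<open>The coefficients are found by eliminating one point \<open>(\<alpha> z, \<beta> z)\<close>: the combination
  \<open>\<beta> z * r (a + 1) - \<alpha> z * r a\<close> does not see it.\<close>

lemma moment_problem:
  fixes \<alpha> \<beta> :: "'a \<Rightarrow> real"
  assumes "finite I" "card I = Suc k" "\<And>i j. i \<in> I \<Longrightarrow> j \<in> I \<Longrightarrow> i \<noteq> j \<Longrightarrow> \<alpha> i * \<beta> j \<noteq> \<alpha> j * \<beta> i"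
  shows "\<exists>c. \<forall>a\<le>k. (\<Sum>i\<in>I. c i * (\<alpha> i ^ a * \<beta> i ^ (k - a))) = r a"
  using assms
proof (induction k arbitrary: I r)
  case 0
  then obtain z where "I = {z}" by (auto simp: card_Suc_eq)
  then show ?case by (intro exI[of _ "\<lambda>_. r 0"]) simp
next
  case (Suc k)
  obtain z I' where I: "I = insert z I'" "z \<notin> I'" "card I' = Suc k" "finite I'"
    using Suc.prems(1,2) by (metis card_Suc_eq finite_insert)
  obtain w where w: "w \<in> I'" using I(3) by (metis card.empty equals0I nat.distinct(1))
  have nz: "\<beta> z * \<alpha> i - \<alpha> z * \<beta> i \<noteq> 0" if "i \<in> I'" for i
    using Suc.prems(3)[of z i] that I(1,2) by (cases "z = i") (auto simp: algebra_simps)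
  obtain c' where c': "\<And>a. a \<le> k \<Longrightarrow> (\<Sum>i\<in>I'. c' i * (\<alpha> i ^ a * \<beta> i ^ (k - a)))
      = \<beta> z * r (Suc a) - \<alpha> z * r a"
    using Suc.IH[OF I(4,3), of "\<lambda>a. \<beta> z * r (Suc a) - \<alpha> z * r a"] Suc.prems(3) I by blast
  \<comment> \<open>Combining consecutive equations multiplies the coefficient at \<open>i\<close>
    by \<beta> z * \<alpha> i - \<alpha> z * \<beta> i, which is nonzero since \<open>z\<close> and
    \<open>i\<close> are not proportional; the division undoes this.\<close>
  define c where "c = (\<lambda>i. c' i / (\<beta> z * \<alpha> i - \<alpha> z * \<beta> i))"
  \<comment> \<open>What the point \<open>z\<close> still has to contribute. By \<open>rec\<close>,
    consecutive entries are in the ratio of \<alpha> z to \<beta> z, like the moments of the single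
    point \<open>z\<close>.\<close>
  define s where "s = (\<lambda>a. r a - (\<Sum>i\<in>I'. c i * (\<alpha> i ^ a * \<beta> i ^ (Suc k - a))))"
  have rec: "\<beta> z * s (Suc a) = \<alpha> z * s a" if a: "a \<le> k" for a
  proof -
    have "\<beta> z * (\<Sum>i\<in>I'. c i * (\<alpha> i ^ Suc a * \<beta> i ^ (Suc k - Suc a)))
        - \<alpha> z * (\<Sum>i\<in>I'. c i * (\<alpha> i ^ a * \<beta> i ^ (Suc k - a)))
      = (\<Sum>i\<in>I'. c i * (\<beta> z * \<alpha> i - \<alpha> z * \<beta> i) * (\<alpha> i ^ a * \<beta> i ^ (k - a)))"
      using a by (simp add: sum_distrib_left sum_subtractf[symmetric] Suc_diff_le algebra_simps)
    also have "\<dots> = (\<Sum>i\<in>I'. c' i * (\<alpha> i ^ a * \<beta> i ^ (k - a)))"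
      using nz by (intro sum.cong) (auto simp: c_def)
    also have "\<dots> = \<beta> z * r (Suc a) - \<alpha> z * r a" by (rule c'[OF a])
    finally show ?thesis unfolding s_def by (simp add: algebra_simps)
  qed
  have "\<exists>cz. \<forall>a\<le>Suc k. cz * (\<alpha> z ^ a * \<beta> z ^ (Suc k - a)) = s a"
  proof (cases "\<beta> z = 0")
    \<comment> \<open>Only the last moment of \<open>z\<close> is nonzero here, and by
      \<open>rec\<close> all other entries of \<open>s\<close> vanish.\<close>
    case True
    then have az: "\<alpha> z \<noteq> 0" using nz[OF w] by auto
    have "s a = 0" if "a \<le> k" for a using rec[OF that] True az by simp
    then show ?thesis using True az
      by (intro exI[of _ "s (Suc k) / \<alpha> z ^ Suc k"]) (auto simp: le_Suc_eq zero_power Suc_diff_le)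
  next
    case False
    have s0: "s a = (\<alpha> z / \<beta> z) ^ a * s 0" if "a \<le> Suc k" for a
      using that
    proof (induction a)
      case (Suc a)
      then have "\<beta> z * s (Suc a) = \<alpha> z * ((\<alpha> z / \<beta> z) ^ a * s 0)" using rec[of a] by simp
      then show ?case using False by (simp add: field_simps)
    qed simp
    have cancel: "r / (x * y) * (p * y) = p / x * r" if "y \<noteq> 0" for p r x y :: real
      using that by simp
    have "s 0 / \<beta> z ^ Suc k * (\<alpha> z ^ a * \<beta> z ^ (Suc k - a)) = s a" if a: "a \<le> Suc k" for a
    proof -
      have "\<beta> z ^ Suc k = \<beta> z ^ a * \<beta> z ^ (Suc k - a)"
        using a by (simp flip: power_add)
      moreover have "\<beta> z ^ (Suc k - a) \<noteq> 0" using False by simp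
      ultimately show ?thesis
        using cancel s0[OF a] by (simp only: power_divide)
    qed
    then show ?thesis by blast
  qed
  then obtain cz where cz: "\<And>a. a \<le> Suc k \<Longrightarrow> cz * (\<alpha> z ^ a * \<beta> z ^ (Suc k - a)) = s a" by blast
  show ?case
  proof (intro exI[of _ "\<lambda>i. if i = z then cz else c i"] allI impI)
    fix a assume a: "a \<le> Suc k"
    have "(\<Sum>i\<in>I'. (if i = z then cz else c i) * (\<alpha> i ^ a * \<beta> i ^ (Suc k - a)))
        = (\<Sum>i\<in>I'. c i * (\<alpha> i ^ a * \<beta> i ^ (Suc k - a)))"
      using I(2) by (intro sum.cong) auto
    then show "(\<Sum>i\<in>I. (if i = z then cz else c i) * (\<alpha> i ^ a * \<beta> i ^ (Suc k - a))) = r a"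
      using I cz[OF a] by (simp add: s_def)
  qed
qed

text \<open>By the binomial theorem the coefficients of a \<open>k\<close>-th power of a linear form
  are, up to binomial coefficients, the moments of the point given by its two coefficients. So
  reaching a single monomial of degree \<open>k\<close> is a moment problem for \<open>k + 1\<close>
  pairwise nonproportional points, and monomials of higher degree are multiples of those of degree
  \<open>k\<close>.\<close>

lemma polys_at_generated_by_powers:
  assumes I: "finite I" "card I = Suc k" "\<And>i j. i \<in> I \<Longrightarrow> j \<in> I \<Longrightarrow> i \<noteq> j \<Longrightarrow> det2 (u i) (u j) \<noteq> 0"
    and p: "p \<in> polys_at A k d" and kd: "k \<le> d"
  shows "\<exists>q. (\<forall>i\<in>I. q i \<in> polys_at 0 0 (d - k)) \<and> (\<forall>x. p x
      = (\<Sum>i\<in>I. q i x * det2 (u i) (x - A) ^ k))"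
proof -
  define \<alpha> \<beta> where "\<alpha> = (\<lambda>i. - (u i)$2)" and "\<beta> = (\<lambda>i. (u i)$1)"
  have ab: "det2 (u i) (x - A) = \<alpha> i * (x$1 - A$1) + \<beta> i * (x$2 - A$2)" for i x
    by (simp add: det2_def \<alpha>_def \<beta>_def algebra_simps)
  have ne: "\<alpha> i * \<beta> j \<noteq> \<alpha> j * \<beta> i" if "i \<in> I" "j \<in> I" "i \<noteq> j" for i j
    using I(3)[OF that] by (auto simp: det2_def \<alpha>_def \<beta>_def algebra_simps)
  have top: "\<exists>c. \<forall>x. monomial_at A (a, k - a) x = (\<Sum>i\<in>I. c i * det2 (u i) (x - A) ^ k)" if a: "a
      \<le> k" for a
  proof -
    \<comment> \<open>The right-hand side anticipates the binomial coefficient that the expansion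
      brings in.\<close>
    obtain c where c: "\<And>b. b \<le> k \<Longrightarrow> (\<Sum>i\<in>I. c i * (\<alpha> i ^ b * \<beta> i ^ (k - b))) = (if b
        = a then 1 / real (k choose a) else 0)"
      using moment_problem[OF I(1,2), of \<alpha> \<beta> "\<lambda>b. if b = a then 1 / real (k choose a) else 0"] ne
          by blast
    have "(\<Sum>i\<in>I. c i * det2 (u i) (x - A) ^ k) = monomial_at A (a, k - a) x" for x
    proof -
      let ?X = "x$1 - A$1" and ?Y = "x$2 - A$2"
      have "(\<Sum>i\<in>I. c i * det2 (u i) (x - A) ^ k)
          = (\<Sum>i\<in>I. \<Sum>b\<le>k. c i * (\<alpha> i ^ b * \<beta> i ^ (k - b)) * ((k choose b) * ?X ^ b * ?Y ^ (k - b)))"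
        by (simp add: ab binomial_ring sum_distrib_left power_mult_distrib ac_simps)
      also have "\<dots> = (\<Sum>b\<le>k. (\<Sum>i\<in>I. c i * (\<alpha> i ^ b * \<beta> i ^ (k - b))) * ((k choose b) * ?X ^ b * ?Y ^
          (k - b)))"
        by (subst sum.swap) (simp add: sum_distrib_right)
      also have "\<dots> = (\<Sum>b\<le>k. if b = a then ?X ^ b * ?Y ^ (k - b) else 0)"
        using a by (intro sum.cong) (auto simp: c)
      finally show ?thesis using a by (simp add: monomial_at_def)
    qed
    then show ?thesis by metis
  qed
  have "\<exists>q. (\<forall>i\<in>I. q i \<in> polys_at 0 0 (d - k)) \<and> (\<forall>x. monomial_at A ij x
      = (\<Sum>i\<in>I. q i x * det2 (u i) (x - A) ^ k))"
    if ij: "ij \<in> exponents k d" for ij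
  proof -
    \<comment> \<open>Split off a factor of degree exactly \<open>k\<close>, taking as much as
      possible from the first variable; the factor \<open>rest\<close> goes into the
      quotients.\<close>
    define a where "a = min (fst ij) k"
    define rest where "rest = (fst ij - a, snd ij - (k - a))"
    have a: "a \<le> k" "a \<le> fst ij" "k - a \<le> snd ij" using ij by (auto simp: a_def exponents_def)
    obtain c where c: "\<And>x. monomial_at A (a, k - a) x = (\<Sum>i\<in>I. c i * det2 (u i) (x - A) ^ k)"
        using top[OF a(1)] by blast
    have "monomial_at A ij x = monomial_at A rest x * monomial_at A (a, k - a) x" for x
      using a by (simp add: monomial_at_mult rest_def)
    then have "monomial_at A ij x = (\<Sum>i\<in>I. (c i * monomial_at A rest x) * det2 (u i) (x - A) ^ k)"
        for x
      by (simp add: c sum_distrib_left algebra_simps)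
    moreover have "monomial_at A rest \<in> polys_at A 0 (d - k)"
      by (rule polys_at_monomial_at) (use ij a in \<open>auto simp: exponents_def rest_def\<close>)
    then have "(\<lambda>x. c i * monomial_at A rest x) \<in> polys_at 0 0 (d - k)" for i
      using polys_at_cmult polys_at_shift[of A "d - k" 0] by blast
    ultimately show ?thesis by (intro exI[of _ "\<lambda>i x. c i * monomial_at A rest x"] conjI ballI allI)
  qed
  then have "\<forall>ij\<in>exponents k d. \<exists>q. (\<forall>i\<in>I. q i \<in> polys_at 0 0 (d - k)) \<and> (\<forall>x. monomial_at A ij x
      = (\<Sum>i\<in>I. q i x * det2 (u i) (x - A) ^ k))"
    by blast
  then have "\<exists>q. \<forall>ij\<in>exponents k d. (\<forall>i\<in>I. q ij i \<in> polys_at 0 0 (d - k)) \<and> (\<forall>x. monomial_at A ij x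
      = (\<Sum>i\<in>I. q ij i x * det2 (u i) (x - A) ^ k))"
    by (rule bchoice)
  then obtain q where q: "\<And>ij i. ij \<in> exponents k d \<Longrightarrow> i \<in> I \<Longrightarrow> q ij i \<in> polys_at 0 0 (d - k)"
    "\<And>ij x. ij \<in> exponents k d \<Longrightarrow> monomial_at A ij x = (\<Sum>i\<in>I. q ij i x * det2 (u i) (x - A) ^ k)"
    by blast
  obtain c where c: "p = (\<lambda>x. \<Sum>ij\<in>exponents k d. c ij * monomial_at A ij x)" using p by (elim polys_atE)
  have "p x = (\<Sum>i\<in>I. (\<Sum>ij\<in>exponents k d. c ij * q ij i x) * det2 (u i) (x - A) ^ k)" for x
  proof -
    have "p x = (\<Sum>ij\<in>exponents k d. \<Sum>i\<in>I. c ij * q ij i x * det2 (u i) (x - A) ^ k)"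
      unfolding c by (intro sum.cong) (auto simp: q(2) sum_distrib_left algebra_simps)
    then show ?thesis by (subst (asm) sum.swap) (simp add: sum_distrib_right)
  qed
  moreover have "(\<lambda>x. \<Sum>ij\<in>exponents k d. c ij * q ij i x) \<in> polys_at 0 0 (d - k)" if "i \<in> I" for i
    by (intro polys_at_sum polys_at_cmult q that)
  ultimately show ?thesis
    by (intro exI[of _ "\<lambda>i x. \<Sum>ij\<in>exponents k d. c ij * q ij i x"] conjI ballI allI) assumption+
qed

section \<open>Vanishing orders and smoothness of piecewise polynomials\<close>

text \<open>The recursion follows that of \<open>Ck_on\<close>, so that both notions are handled
    by the same inductions.\<close>

primrec vanishes :: "nat \<Rightarrow> (plane \<Rightarrow> real) \<Rightarrow> plane \<Rightarrow> bool" where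
  "vanishes 0 p x \<longleftrightarrow> True"
| "vanishes (Suc k) p x \<longleftrightarrow> p x = 0 \<and> (\<forall>v. vanishes k (\<lambda>y. frechet_derivative p (at y) v) x)"

lemma has_derivative_vec_nth: "((\<lambda>x::real^'n. x $ i) has_derivative (\<lambda>h. h $ i)) F"
  by (rule bounded_linear_imp_has_derivative[OF bounded_linear_vec_nth])

lemma monomial_at_has_derivative:
  "(monomial_at A ij has_derivative (\<lambda>h. h$1 * (real (fst ij) * monomial_at A (fst ij - 1, snd ij)
      x)
      + h$2 * (real (snd ij) * monomial_at A (fst ij, snd ij - 1) x))) (at x)"
  unfolding monomial_at_def[abs_def]
  by (rule derivative_eq_intros has_derivative_vec_nth refl | simp add: algebra_simps)+

lemma polys_at_has_derivative:
  assumes "p \<in> polys_at 0 0 d"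
  shows "\<exists>p'. (\<forall>x. (p has_derivative p' x) (at x)) \<and> (\<forall>v. (\<lambda>x. p' x v) \<in> polys_at 0 0 d)"
proof -
  obtain c where c: "p = (\<lambda>x. \<Sum>ij\<in>exponents 0 d. c ij * monomial_at 0 ij x)" using assms
      by (elim polys_atE)
  define m' where "m' = (\<lambda>ij x (h :: plane). h$1 * (real (fst ij) * monomial_at 0 (fst ij - 1, snd
      ij) x)
      + h$2 * (real (snd ij) * monomial_at 0 (fst ij, snd ij - 1) x))"
  have m': "(monomial_at 0 ij has_derivative m' ij x) (at x)" for ij x
    unfolding m'_def by (rule monomial_at_has_derivative)
  let ?p' = "\<lambda>x h. \<Sum>ij\<in>exponents 0 d. c ij * m' ij x h"
  have "(p has_derivative ?p' x) (at x)" for x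
    unfolding c by (intro has_derivative_sum has_derivative_mult_right m')
  moreover have "(\<lambda>x. ?p' x v) \<in> polys_at 0 0 d" for v
    unfolding m'_def by (intro polys_at_sum polys_at_cmult polys_at_add polys_at_monomial_at) (auto
        simp: exponents_def)
  ultimately show ?thesis by (intro exI[of _ ?p']) auto
qed

lemma frechet_derivative_apply:
  "(f has_derivative f') (at x) \<Longrightarrow> frechet_derivative f (at x) v = f' v"
  by (simp flip: frechet_derivative_at)

lemma polys_at_differentiable: "p \<in> polys_at 0 0 d \<Longrightarrow> p differentiable (at x)"
  using polys_at_has_derivative differentiable_def by blast

lemma polys_at_frechet:
  "p \<in> polys_at 0 0 d \<Longrightarrow> (p has_derivative frechet_derivative p (at x)) (at x)"
  using polys_at_differentiable frechet_derivative_works by blast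

lemma polys_at_frechet_polys_at:
  assumes "p \<in> polys_at 0 0 d" shows "(\<lambda>x. frechet_derivative p (at x) v) \<in> polys_at 0 0 d"
proof -
  obtain p' where p': "\<And>x. (p has_derivative p' x) (at x)" "\<And>v. (\<lambda>x. p' x v) \<in> polys_at 0 0 d"
    using polys_at_has_derivative[OF assms] by blast
  have "frechet_derivative p (at x) = p' x" for x
    using frechet_derivative_at[OF p'(1)] by simp
  then show ?thesis using p'(2) by simp
qed

lemma polys_at_continuous: "p \<in> polys_at 0 0 d \<Longrightarrow> isCont p x"
  using polys_at_differentiable differentiable_imp_continuous_within by blast

lemma frechet_diff_polys_at:
  assumes "p \<in> polys_at 0 0 d" "q \<in> polys_at 0 0 d"
  shows "frechet_derivative (\<lambda>x. p x - q x) (at x) v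
    = frechet_derivative p (at x) v - frechet_derivative q (at x) v"
  by (rule frechet_derivative_apply[OF has_derivative_diff[OF polys_at_frechet[OF assms(1)]
      polys_at_frechet[OF assms(2)]]])

lemma vanishes_diff:
  assumes "p \<in> polys_at 0 0 d" "q \<in> polys_at 0 0 d" "vanishes k p x" "vanishes k q x"
  shows "vanishes k (\<lambda>x. p x - q x) x"
  using assms by (induction k arbitrary: p q) (auto simp: frechet_diff_polys_at
      polys_at_frechet_polys_at)

lemma vanishes_zero: "vanishes k (\<lambda>x. 0) x"
  by (induction k) auto

lemma line_form_has_derivative: "(line_form a b has_derivative det2 (b - a)) (at x)"
proof -
  have "(line_form a b has_derivative (\<lambda>h. (b - a)$1 * h$2 - (b - a)$2 * h$1)) (at x)"
    unfolding line_form_def[abs_def] det2_def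
    by (rule derivative_eq_intros has_derivative_vec_nth refl | simp)+
  then show ?thesis by (simp add: det2_def[abs_def])
qed

text \<open>A derivative of a multiple of the power \<open>Suc k\<close> is a multiple of the power
  \<open>k\<close>. Its new factor has a larger degree bound, so the induction must allow any
  \<open>q\<close> and any degree.\<close>

lemma vanishes_line_multiples:
  assumes "q \<in> polys_at 0 0 d" "line_form a b x = 0"
  shows "vanishes k (\<lambda>y. q y * line_form a b y ^ k) x"
  using assms(1)
proof (induction k arbitrary: q d)
  case (Suc k)
  have "frechet_derivative (\<lambda>y. q y * line_form a b y ^ Suc k) (at y) v
      = (frechet_derivative q (at y) v * line_form a b y
          + (Suc k * det2 (b - a) v) * q y) * line_form a b y ^ k" for y v
  proof -
    have "((\<lambda>y. q y * line_form a b y ^ Suc k) has_derivative (\<lambda>v.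
        q y * (of_nat (Suc k) * det2 (b - a) v * line_form a b y ^ (Suc k - 1))
        + frechet_derivative q (at y) v * line_form a b y ^ Suc k)) (at y)"
      by (intro has_derivative_mult polys_at_frechet[OF Suc.prems] has_derivative_power
          line_form_has_derivative)
    from frechet_derivative_apply[OF this]
    have "frechet_derivative (\<lambda>y. q y * line_form a b y ^ Suc k) (at y) v
      = q y * (of_nat (Suc k) * det2 (b - a) v * line_form a b y ^ (Suc k - 1))
        + frechet_derivative q (at y) v * line_form a b y ^ Suc k" .
    then show ?thesis by (simp add: algebra_simps)
  qed
  moreover have "vanishes k (\<lambda>y. (frechet_derivative q (at y) v * line_form a b y
      + (Suc k * det2 (b - a) v) * q y) * line_form a b y ^ k) x" for v
  proof (rule Suc.IH)
    have "(\<lambda>y. frechet_derivative q (at y) v * line_form a b y) \<in> polys_at 0 (0 + 0) (d + 1)"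
      by (intro polys_at_mult polys_at_frechet_polys_at Suc.prems line_form_gp0)
    moreover have "(\<lambda>y. (Suc k * det2 (b - a) v) * q y) \<in> polys_at 0 0 (d + 1)"
      by (rule polys_at_mono[OF _ _ polys_at_cmult[OF Suc.prems]]) auto
    ultimately show "(\<lambda>y. frechet_derivative q (at y) v * line_form a b y
        + (Suc k * det2 (b - a) v) * q y) \<in> polys_at 0 0 (d + 1)"
      using polys_at_add by auto
  qed
  ultimately show ?case using assms(2) by simp
qed simp

lemma line_multiples_vanishes: "p \<in> line_multiples a b k d \<Longrightarrow> line_form a b x = 0 \<Longrightarrow> vanishes k p x"
proof -
  assume "p \<in> line_multiples a b k d" and x: "line_form a b x = 0"
  then obtain q where q: "q \<in> polys_at 0 0 (d - k)" "p = (\<lambda>x. q x * line_form a b x ^ k)"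
    unfolding line_multiples_def fun_eq_iff by blast
  then show ?thesis using vanishes_line_multiples[OF q(1) x] by simp
qed

text \<open>Restricted to a line through \<open>x\<close>, the derivative in direction
  \<open>n\<close> becomes \<open>pderiv\<close>; iterating it reads off the coefficients up to
  factorials.\<close>

lemma vanishes_line_coeff:
  assumes "p \<in> polys_at 0 0 d" "vanishes k p x" "\<And>t. p (x + t *\<^sub>R n) = poly \<pi> t" "m < k"
  shows "coeff \<pi> m = 0"
  using assms
proof (induction k arbitrary: p \<pi> m)
  case (Suc k)
  have 0: "coeff \<pi> 0 = 0" using Suc.prems(2) Suc.prems(3)[of 0] by (simp add: poly_0_coeff_0)
  show ?case
  proof (cases m)
    case (Suc m')
    have "frechet_derivative p (at (x + t *\<^sub>R n)) n = poly (pderiv \<pi>) t" for t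
    proof -
      have "((\<lambda>t. p (x + t *\<^sub>R n)) has_derivative (\<lambda>h. frechet_derivative p (at (x
          + t *\<^sub>R n)) (h *\<^sub>R n))) (at t)"
        by (rule has_derivative_compose[where g = p, OF _ polys_at_frechet[OF Suc.prems(1)]])
           (auto intro!: derivative_eq_intros)
      moreover have "((\<lambda>t. p (x + t *\<^sub>R n)) has_derivative (\<lambda>h. poly (pderiv \<pi>) t * h)) (at t)"
        unfolding Suc.prems(3) using poly_DERIV[of \<pi> t] by (simp add: has_field_derivative_def)
      ultimately have "(\<lambda>h. frechet_derivative p (at (x + t *\<^sub>R n)) (h *\<^sub>R n))
          = (\<lambda>h. poly (pderiv \<pi>) t * h)"
        by (rule has_derivative_unique)
      from fun_cong[OF this, of 1] show ?thesis by simp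
    qed
    then have "coeff (pderiv \<pi>) m' = 0"
      using Suc.IH[OF polys_at_frechet_polys_at[OF Suc.prems(1), of n], of "pderiv \<pi>" m']
          Suc.prems(2,4) Suc by auto
    then show ?thesis by (simp add: coeff_pderiv Suc)
  qed (use 0 in simp)
qed simp

lemma vanishes_line_multiplesI:
  assumes p: "p \<in> polys_at 0 0 d" and "a \<noteq> b" "k \<le> d" "infinite X"
    "\<And>x. x \<in> X \<Longrightarrow> line_form a b x = 0" "\<And>x. x \<in> X \<Longrightarrow> vanishes k p x"
  shows "p \<in> line_multiples a b k d"
  using assms(2-5) by (rule line_multiplesI[OF p]) (auto intro: vanishes_line_coeff[OF p assms(6)])

text \<open>The finitely many closures that miss \<open>x\<close> form a closed set, so close to
  \<open>x\<close> only those containing \<open>x\<close> occur.\<close>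

lemma eventually_in_near_pieces:
  assumes "open D" "finite C" "D \<subseteq> (\<Union>c\<in>C. closure c)" "x \<in> D"
  shows "\<forall>\<^sub>F y in nhds x. y \<in> D \<and> (\<exists>c\<in>C. x \<in> closure c \<and> y \<in> closure c)"
proof -
  let ?F = "\<Union>c\<in>{c\<in>C. x \<notin> closure c}. closure c"
  have "closed ?F" using assms(2) by (intro closed_UN) auto
  then have "open (D - ?F)" using assms(1) by (rule open_Diff[rotated])
  moreover have "x \<in> D - ?F" using assms(4) by auto
  ultimately have "\<forall>\<^sub>F y in nhds x. y \<in> D - ?F" by (rule eventually_nhds_in_open)
  then show ?thesis by (rule eventually_mono) (use assms(3) in blast)
qed

text \<open>Note the shift: \<open>vanishes (Suc k)\<close> concerns the derivatives of orders 0 to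
  \<open>k\<close>. Pieces that meet at \<open>x\<close> have the same derivative there, and near
  \<open>x\<close> the function always agrees with one of these finitely many pieces, so it has this
  derivative too; the induction then continues with directional derivatives as pieces.\<close>

lemma Ck_on_pieces:
  assumes "open D" "finite C" "D \<subseteq> (\<Union>c\<in>C. closure c)"
    and "\<And>c. c \<in> C \<Longrightarrow> p c \<in> polys_at 0 0 d"
    and "\<And>c x. c \<in> C \<Longrightarrow> x \<in> D \<Longrightarrow> x \<in> closure c \<Longrightarrow> f x = p c x"
    and "\<And>c c' x. c \<in> C \<Longrightarrow> c' \<in> C \<Longrightarrow> x \<in> D \<Longrightarrow> x \<in> closure c \<Longrightarrow> x \<in> closure c'
        \<Longrightarrow> vanishes (Suc k) (\<lambda>y. p c y - p c' y) x"
  shows "Ck_on k f D"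
  using assms(4-6)
proof (induction k arbitrary: f p)
  case 0
  have "isCont f x" if x: "x \<in> D" for x
    unfolding isCont_def tendsto_iff
  proof (intro allI impI)
    fix e :: real assume e: "e > 0"
    have "\<forall>c\<in>{c\<in>C. x \<in> closure c}. \<forall>\<^sub>F y in at x. dist (p c y) (p c x) < e"
      using polys_at_continuous[OF 0(1)] e unfolding isCont_def tendsto_iff by blast
    then have "\<forall>\<^sub>F y in at x. \<forall>c\<in>{c\<in>C. x \<in> closure c}. dist (p c y) (p c x) < e"
      using assms(2) by (intro eventually_ball_finite) auto
    moreover have "\<forall>\<^sub>F y in at x. y \<in> D \<and> (\<exists>c\<in>C. x \<in> closure c \<and> y \<in> closure c)"
      using eventually_in_near_pieces[OF assms(1-3) x] by (simp add: eventually_at_filter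
          eventually_mono)
    ultimately show "\<forall>\<^sub>F y in at x. dist (f y) (f x) < e"
      by eventually_elim (use 0(2) x in auto)
  qed
  then show ?case by (simp add: continuous_at_imp_continuous_on)
next
  case (Suc k)
  have der: "(f has_derivative frechet_derivative (p c) (at x)) (at x)"
    if x: "x \<in> D" and c: "c \<in> C" "x \<in> closure c" for x c
  proof -
    let ?L = "frechet_derivative (p c) (at x)"
    \<comment> \<open>The difference of two pieces at \<open>x\<close> vanishes together with its
      first derivatives, so one linear map serves all of them.\<close>
    have L: "(p c' has_derivative ?L) (at x)" if c': "c' \<in> C" "x \<in> closure c'" for c'
    proof -
      have "frechet_derivative (p c') (at x) v = ?L v" for v
        using Suc.prems(3)[OF c'(1) c(1) x c'(2) c(2)] frechet_diff_polys_at[OF Suc.prems(1)[OF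
            c'(1)] Suc.prems(1)[OF c(1)]]
        by simp
      then have "frechet_derivative (p c') (at x) = ?L" by blast
      then show ?thesis using polys_at_frechet[OF Suc.prems(1)[OF c'(1)]] by metis
    qed
    show ?thesis unfolding has_derivative_at_alt
    proof (intro conjI allI impI)
      show "bounded_linear ?L" using L[OF c] by (rule has_derivative_bounded_linear)
      fix e :: real assume e: "e > 0"
      have "\<forall>c\<in>{c\<in>C. x \<in> closure c}. \<forall>\<^sub>F y in nhds x. norm (p c y - p c x - ?L (y - x))
          \<le> e * norm (y - x)"
      proof
        fix c assume "c \<in> {c\<in>C. x \<in> closure c}"
        with L[of c] e obtain \<delta> where "\<delta> > 0"
          "\<And>y. norm (y - x) < \<delta> \<Longrightarrow> norm (p c y - p c x - ?L (y - x)) \<le> e * norm (y - x)"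
          unfolding has_derivative_at_alt by blast
        then show "\<forall>\<^sub>F y in nhds x. norm (p c y - p c x - ?L (y - x)) \<le> e * norm (y - x)"
          unfolding eventually_nhds_metric dist_norm by blast
      qed
      \<comment> \<open>Finiteness makes the estimate uniform over the pieces, so it does not matter
        which of them contains y.\<close>
      then have "\<forall>\<^sub>F y in nhds x. \<forall>c\<in>{c\<in>C. x \<in> closure c}. norm (p c y - p c x - ?L (y - x))
          \<le> e * norm (y - x)"
        using assms(2) by (intro eventually_ball_finite) auto
      then have "\<forall>\<^sub>F y in nhds x. norm (f y - f x - ?L (y - x)) \<le> e * norm (y - x)"
        using eventually_in_near_pieces[OF assms(1-3) x]
        by eventually_elim (use Suc.prems(2) x in auto)
      then show "\<exists>d>0. \<forall>y. norm (y - x) < d \<longrightarrow> norm (f y - f x - ?L (y - x)) \<le> e * norm (y - x)"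
        unfolding eventually_nhds_metric dist_norm by blast
    qed
  qed
  have "f differentiable (at x)" if "x \<in> D" for x
    using der[OF that] assms(3) that differentiable_def by blast
  moreover have "Ck_on k (\<lambda>x. frechet_derivative f (at x) v) D" for v
  proof (rule Suc.IH[of "\<lambda>c x. frechet_derivative (p c) (at x) v"])
    fix c assume c: "c \<in> C"
    show "(\<lambda>x. frechet_derivative (p c) (at x) v) \<in> polys_at 0 0 d"
      by (rule polys_at_frechet_polys_at[OF Suc.prems(1)[OF c]])
    fix x assume x: "x \<in> D" "x \<in> closure c"
    show "frechet_derivative f (at x) v = frechet_derivative (p c) (at x) v"
      using frechet_derivative_at[OF der[OF x(1) c x(2)]] by simp
  next
    fix c c' x assume c: "c \<in> C" "c' \<in> C" and x: "x \<in> D" "x \<in> closure c" "x \<in> closure c'"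
    from Suc.prems(3)[OF c x]
    show "vanishes (Suc k) (\<lambda>y. frechet_derivative (p c) (at y) v - frechet_derivative (p c') (at y)
        v) x"
      by (simp only: vanishes.simps(2)[of "Suc k"] frechet_diff_polys_at[OF Suc.prems(1)[OF c(1)]
          Suc.prems(1)[OF c(2)]])
  qed
  ultimately show ?case by simp
qed

lemma Ck_on_continuous: "Ck_on k f D \<Longrightarrow> open D \<Longrightarrow> x \<in> D \<Longrightarrow> isCont f x"
  by (cases k) (auto simp: continuous_on_eq_continuous_at differentiable_imp_continuous_within)

lemma eq_on_closure:
  fixes f g :: "'a::metric_space \<Rightarrow> real"
  assumes "isCont f x" "isCont g x" "x \<in> closure c" "\<And>y. y \<in> c \<Longrightarrow> f y = g y"
  shows "f x = g x"
proof -
  obtain s where s: "\<And>n. s n \<in> c" "s \<longlonglongrightarrow> x" using assms(3) closure_sequential by metis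
  have "(\<lambda>n. f (s n)) \<longlonglongrightarrow> f x" "(\<lambda>n. g (s n)) \<longlonglongrightarrow> g x"
    using assms(1,2) s(2) by (simp_all add: isCont_tendsto_compose)
  moreover have "(\<lambda>n. f (s n)) = (\<lambda>n. g (s n))" using assms(4) s(1) by auto
  ultimately show ?thesis using LIMSEQ_unique by metis
qed

text \<open>On the open sets \<open>c\<close> and \<open>c'\<close> the derivatives of
  \<open>f\<close> are those of \<open>p\<close> and of \<open>p'\<close>; up to order
  \<open>k\<close> they are continuous, so both agree with those of \<open>f\<close> at the common
  closure point \<open>x\<close>.\<close>

lemma Ck_on_vanishes:
  assumes "Ck_on k f D" "open D" "x \<in> D" "p \<in> polys_at 0 0 d" "p' \<in> polys_at 0 0 d"
    and "open c" "c \<subseteq> D" "x \<in> closure c" "\<And>y. y \<in> c \<Longrightarrow> f y = p y"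
    and "open c'" "c' \<subseteq> D" "x \<in> closure c'" "\<And>y. y \<in> c' \<Longrightarrow> f y = p' y"
  shows "vanishes (Suc k) (\<lambda>y. p y - p' y) x"
  using assms
proof (induction k arbitrary: f p p')
  have val: "p x - p' x = 0" if "Ck_on k f D" "open D" "x \<in> D" "p \<in> polys_at 0 0 d" "p'
      \<in> polys_at 0 0 d"
     "x \<in> closure c" "\<And>y. y \<in> c \<Longrightarrow> f y = p y" "x \<in> closure c'" "\<And>y. y \<in> c' \<Longrightarrow> f y = p' y" for k f p p'
    using eq_on_closure[OF Ck_on_continuous[OF that(1-3)] polys_at_continuous[OF that(4)] that(6,7)]
      eq_on_closure[OF Ck_on_continuous[OF that(1-3)] polys_at_continuous[OF that(5)] that(8,9)]
          by simp
  {
    case 0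
    then show ?case using val[of 0 f p p'] by simp
  next
    case (Suc k)
    have der: "frechet_derivative f (at y) v = frechet_derivative q (at y) v"
      if "open b" "y \<in> b" "\<And>y. y \<in> b \<Longrightarrow> f y = q y" "q \<in> polys_at 0 0 d" for b y q v
    proof -
      have "(f has_derivative frechet_derivative q (at y)) (at y)"
        using has_derivative_transform_within_open[OF polys_at_frechet[OF that(4)] that(1,2)]
            that(3) by metis
      then show ?thesis using frechet_derivative_at by metis
    qed
    have "vanishes (Suc k) (\<lambda>y. frechet_derivative p (at y) v - frechet_derivative p' (at y) v) x"
        for v
    proof (rule Suc.IH[of "\<lambda>y. frechet_derivative f (at y) v"])
      show "Ck_on k (\<lambda>y. frechet_derivative f (at y) v) D" using Suc.prems(1) by simp
    qed (use Suc.prems der polys_at_frechet_polys_at in auto)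
    then show ?case using val[OF Suc.prems(1-5) Suc.prems(8,9,12,13)]
      by (simp only: vanishes.simps(2)[of "Suc k"] frechet_diff_polys_at[OF Suc.prems(4,5)]) auto
  }
qed

section \<open>Cells and edges of a rectilinear partition\<close>

lemma line_form_affine: "u + v = 1 \<Longrightarrow> line_form a b (u *\<^sub>R x + v *\<^sub>R y) = u * line_form a b x
    + v * line_form a b y"
proof -
  assume uv: "u + v = 1"
  have "u *\<^sub>R x + v *\<^sub>R y - a = u *\<^sub>R (x - a) + v *\<^sub>R (y - a)"
    using uv by (simp add: algebra_simps flip: scaleR_add_left)
  then show ?thesis by (simp add: line_form_def det2_add)
qed

lemma line_form_ends [simp]: "line_form a b a = 0" "line_form a b b = 0"
  by (simp_all add: line_form_def)

lemma line_form_segment: "x \<in> closed_segment a b \<Longrightarrow> line_form a b x = 0"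
  by (auto simp: in_segment line_form_affine)

lemma line_form_0D: "line_form a b x = 0 \<Longrightarrow> a \<noteq> b \<Longrightarrow> \<exists>t. x = a + t *\<^sub>R (b - a)"
proof -
  assume "line_form a b x = 0" "a \<noteq> b"
  then obtain t where "x - a = t *\<^sub>R (b - a)" using det2_eq_0D[of "b - a" "x - a"]
      by (auto simp: line_form_def)
  then have "x = a + t *\<^sub>R (b - a)" by (simp add: algebra_simps)
  then show ?thesis by blast
qed

lemma open_segment_param: "a \<noteq> b \<Longrightarrow> a + t *\<^sub>R (b - a) \<in> open_segment a b \<longleftrightarrow> 0 < t \<and> t < 1"
  for a b :: "'a::real_vector"
proof -
  assume ab: "a \<noteq> b"
  have eq: "(1 - u) *\<^sub>R a + u *\<^sub>R b = a + u *\<^sub>R (b - a)" for u by (simp add: algebra_simps)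
  show ?thesis using ab unfolding in_segment eq by auto
qed

lemma closed_segment_param: "a \<noteq> b \<Longrightarrow> a + t *\<^sub>R (b - a) \<in> closed_segment a b \<longleftrightarrow> 0 \<le> t \<and> t \<le> 1"
  for a b :: "'a::real_vector"
proof -
  assume ab: "a \<noteq> b"
  have eq: "(1 - u) *\<^sub>R a + u *\<^sub>R b = a + u *\<^sub>R (b - a)" for u by (simp add: algebra_simps)
  show ?thesis using ab unfolding in_segment eq by auto
qed

lemma open_segment_nbhd:
  assumes "x \<in> open_segment a b"
  shows "\<exists>r>0. \<forall>y\<in>ball x r. line_form a b y = 0 \<longrightarrow> y \<in> open_segment a b"
proof -
  have ab: "a \<noteq> b" using assms by auto
  obtain s where s: "0 < s" "s < 1" "x = a + s *\<^sub>R (b - a)"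
    using assms by (auto simp: in_segment algebra_simps)
  let ?r = "min s (1 - s) * norm (b - a)"
  have "y \<in> open_segment a b" if y: "y \<in> ball x ?r" "line_form a b y = 0" for y
  proof -
    obtain t where t: "y = a + t *\<^sub>R (b - a)" using line_form_0D[OF y(2) ab] by blast
    have "x - y = (s - t) *\<^sub>R (b - a)" by (simp add: s t algebra_simps)
    then have "\<bar>s - t\<bar> * norm (b - a) < min s (1 - s) * norm (b - a)"
      using y(1) by (simp add: dist_norm)
    then have "\<bar>s - t\<bar> < min s (1 - s)" using ab by simp
    then have "0 < t" "t < 1" by auto
    then show ?thesis unfolding t open_segment_param[OF ab] by simp
  qed
  moreover have "?r > 0" using s ab by simp
  ultimately show ?thesis by blast
qed

definition normal_vec :: "plane \<Rightarrow> plane \<Rightarrow> plane" where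
  "normal_vec a b = vector [a$2 - b$2, b$1 - a$1]"

lemma line_form_normal_vec: "line_form a b (x + t *\<^sub>R normal_vec a b) = line_form a b x
    + t * (norm (b - a))\<^sup>2"
  by (simp add: line_form_def det2_def normal_vec_def power2_norm_eq_inner inner_vec_def sum_2
      algebra_simps)

text \<open>The sign of \<sigma> selects the side: a short step along the normal vector changes the
  line form at constant rate.\<close>

lemma half_ball_meets:
  assumes "line_form a b x = 0" "a \<noteq> b" "r > 0" "\<sigma> \<noteq> 0"
  shows "\<exists>y\<in>ball x r. 0 < \<sigma> * line_form a b y"
proof -
  define t where "t = sgn \<sigma> * (r / (2 * (norm (normal_vec a b) + 1)))"
  have pos: "norm (normal_vec a b) + 1 > 0" by (simp add: add_nonneg_pos)
  have "norm (t *\<^sub>R normal_vec a b) = r / (2 * (norm (normal_vec a b) + 1)) * norm (normal_vec a b)"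
    using assms pos by (simp add: t_def abs_mult sgn_if)
  also have "\<dots> < r" using assms(3) pos by (simp add: divide_simps mult_less_cancel_left_pos)
  finally have "x + t *\<^sub>R normal_vec a b \<in> ball x r" by (simp add: dist_norm)
  moreover have "0 < \<sigma> * line_form a b (x + t *\<^sub>R normal_vec a b)"
  proof -
    have "\<sigma> * t = \<bar>\<sigma>\<bar> * (r / (2 * (norm (normal_vec a b) + 1)))"
        by (simp add: t_def abs_sgn mult.assoc)
    also have "\<dots> > 0" using assms(3,4) pos by simp
    finally show ?thesis using assms(1,2) by (simp add: line_form_normal_vec mult.assoc[symmetric])
  qed
  ultimately show ?thesis by blast
qed

lemma half_ball_connected: "connected {y \<in> ball x r. 0 < \<sigma> * line_form a b y}"
proof (rule convex_connected, rule convexI)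
  fix y z u v assume yz: "y \<in> {y \<in> ball x r. 0 < \<sigma> * line_form a b y}" "z \<in> {y
      \<in> ball x r. 0 < \<sigma> * line_form a b y}"
    and uv: "0 \<le> u" "0 \<le> v" "u + v = (1::real)"
  have "u *\<^sub>R y + v *\<^sub>R z \<in> ball x r"
    using yz uv convex_ball[of x r] unfolding convex_def by blast
  moreover have "0 < \<sigma> * line_form a b (u *\<^sub>R y + v *\<^sub>R z)"
  proof -
    have "0 < u * (\<sigma> * line_form a b y) + v * (\<sigma> * line_form a b z)"
    proof (cases "u = 0")
      case False
      then have "0 < u * (\<sigma> * line_form a b y)" using yz uv by simp
      moreover have "0 \<le> v * (\<sigma> * line_form a b z)" using yz uv by simp
      ultimately show ?thesis by linarith
    qed (use yz uv in auto)
    then show ?thesis by (simp add: line_form_affine[OF uv(3)] algebra_simps)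
  qed
  ultimately show "u *\<^sub>R y + v *\<^sub>R z \<in> {y \<in> ball x r. 0 < \<sigma> * line_form a b y}" by simp
qed

text \<open>An edge is only a point set. \<open>src\<close> and \<open>dst\<close> choose an
  orientation for it once and for all, on which the signs of flows and the distinction of left and
  right rest.\<close>

definition src :: "plane set \<Rightarrow> plane" where
  "src e = fst (SOME ab. fst ab \<noteq> snd ab \<and> e = closed_segment (fst ab) (snd ab))"

definition dst :: "plane set \<Rightarrow> plane" where
  "dst e = snd (SOME ab. fst ab \<noteq> snd ab \<and> e = closed_segment (fst ab) (snd ab))"

abbreviation edge_form :: "plane set \<Rightarrow> plane \<Rightarrow> real" where
  "edge_form e \<equiv> line_form (src e) (dst e)"

text \<open>The incidence number of a vertex and an oriented edge, so that the sum of
  \<open>end_sign e A * w e\<close> is the net flow out of \<open>A\<close>.\<close>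

definition end_sign :: "plane set \<Rightarrow> plane \<Rightarrow> real" where
  "end_sign e A = (if src e = A then 1 else if dst e = A then -1 else 0)"

text \<open>The sign 1 gives the left cell and -1 the right one. Only points of the edge other than
  vertices are considered, because a half ball at an end point may meet further edges and
  cells.\<close>

definition side_cell :: "plane set \<Rightarrow> plane set set \<Rightarrow> plane set \<Rightarrow> real \<Rightarrow> plane set \<Rightarrow> plane set" where
  "side_cell D E V \<sigma> e = (SOME P. P \<in> cells D E \<and> (\<forall>x\<in>e - V. \<exists>r>0. \<forall>y\<in>ball x r. 0 < \<sigma> * edge_form e
      y \<longrightarrow> y \<in> P))"

section \<open>Edges, cells and the two sides of an edge\<close>

locale partition =
  fixes D V :: "plane set" and E :: "plane set set"
  assumes rect: "rectilinear_partition D V E"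
begin

abbreviation Ei where "Ei \<equiv> interior_edges D E"
abbreviation Vi where "Vi \<equiv> interior_vertices D V"
abbreviation left where "left \<equiv> side_cell D E V 1"
abbreviation right where "right \<equiv> side_cell D E V (-1)"

lemmas rect_conj = rect[unfolded rectilinear_partition_def]

lemmas
  open_D = rect_conj[THEN conjunct1] and
  connected_D = rect_conj[THEN conjunct2, THEN conjunct1] and
  bounded_D = rect_conj[THEN conjunct2, THEN conjunct2, THEN conjunct1] and
  D_ne = rect_conj[THEN conjunct2, THEN conjunct2, THEN conjunct2, THEN conjunct1] and
  fin_V = rect_conj[THEN conjunct2, THEN conjunct2, THEN conjunct2, THEN conjunct2, THEN conjunct1]
      and
  V_sub = rect_conj[THEN conjunct2, THEN conjunct2, THEN conjunct2, THEN conjunct2, THEN conjunct2,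
      THEN conjunct1] and
  E_sub = rect_conj[THEN conjunct2, THEN conjunct2, THEN conjunct2, THEN conjunct2, THEN conjunct2,
      THEN conjunct2, THEN conjunct1] and
  edges_seg = rect_conj[THEN conjunct2, THEN conjunct2, THEN conjunct2, THEN conjunct2, THEN
      conjunct2, THEN conjunct2, THEN conjunct2, THEN conjunct1] and
  edges_meet_all = rect_conj[THEN conjunct2, THEN conjunct2, THEN conjunct2, THEN conjunct2, THEN
      conjunct2, THEN conjunct2, THEN conjunct2, THEN conjunct2, THEN conjunct1] and
  frontier_D = rect_conj[THEN conjunct2, THEN conjunct2, THEN conjunct2, THEN conjunct2, THEN
      conjunct2, THEN conjunct2, THEN conjunct2, THEN conjunct2, THEN conjunct2, THEN conjunct1]

lemma edges_meet: "e \<in> E \<Longrightarrow> e' \<in> E \<Longrightarrow> e \<noteq> e' \<Longrightarrow> e \<inter> e' \<subseteq> V"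
  using edges_meet_all by blast

lemma Vi_eq: "Vi = V \<inter> D"
  using open_D by (simp add: interior_vertices_def interior_open)

lemma edge:
  assumes "e \<in> E"
  shows "src e \<noteq> dst e" "e = closed_segment (src e) (dst e)" "e \<inter> V = {src e, dst e}"
proof -
  obtain a b where ab: "a \<noteq> b" "e = closed_segment a b" "e \<inter> V = {a, b}"
    using bspec[OF edges_seg assms] by blast
  let ?P = "\<lambda>ab. fst ab \<noteq> snd ab \<and> e = closed_segment (fst ab) (snd ab)"
  have "?P (SOME ab. ?P ab)" by (rule someI[of ?P "(a, b)"]) (use ab in simp)
  then show 1: "src e \<noteq> dst e" and 2: "e = closed_segment (src e) (dst e)"
    unfolding src_def dst_def by blast+
  have "closed_segment (src e) (dst e) = closed_segment a b"
    using 2 ab(2) by (rule trans[OF sym])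
  then have "{src e, dst e} = {a, b}" by (simp only: closed_segment_eq)
  then show "e \<inter> V = {src e, dst e}" using ab(3) by simp
qed

lemma open_edge: "e \<in> E \<Longrightarrow> e - V = open_segment (src e) (dst e)"
proof -
  assume e: "e \<in> E"
  have "e - V = e - e \<inter> V" by blast
  also have "\<dots> = e - {src e, dst e}" by (simp only: edge(3)[OF e])
  also have "\<dots> = closed_segment (src e) (dst e) - {src e, dst e}"
    by (rule arg_cong[OF edge(2)[OF e]])
  finally show ?thesis by (simp only: open_segment_def)
qed

lemma edge_ends: "e \<in> E \<Longrightarrow> src e \<in> V" "e \<in> E \<Longrightarrow> dst e \<in> V" "e \<in> E \<Longrightarrow> src e \<in> e" "e \<in> E \<Longrightarrow> dst e \<in> e"
  using edge(3) by blast+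

lemma edge_form_edge: "e \<in> E \<Longrightarrow> x \<in> e \<Longrightarrow> edge_form e x = 0"
  using edge(2) line_form_segment by metis

lemma closed_edge: "e \<in> E \<Longrightarrow> closed e"
  using edge(2) closed_segment by metis

lemma fin_E: "finite E"
proof (rule inj_on_finite[of "\<lambda>e. (src e, dst e)"])
  show "inj_on (\<lambda>e. (src e, dst e)) E"
    by (rule inj_onI) (metis edge(2) Pair_inject)
  show "(\<lambda>e. (src e, dst e)) ` E \<subseteq> V \<times> V" using edge_ends by auto
  show "finite (V \<times> V)" using fin_V by simp
qed

lemma Ei_sub: "Ei \<subseteq> E" and fin_Ei: "finite Ei"
  using fin_E by (auto simp: interior_edges_def)

lemma EiD: "e \<in> Ei \<Longrightarrow> e \<in> E"
  using Ei_sub by blast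

lemma D_frontier: "x \<in> D \<Longrightarrow> x \<notin> frontier D"
  using open_D by (simp add: frontier_def interior_open)

lemma edge_at_D: "e \<in> E \<Longrightarrow> x \<in> e \<Longrightarrow> x \<in> D \<Longrightarrow> e \<in> Ei"
  using D_frontier by (auto simp: interior_edges_def)

lemma closure_D_cases: "x \<in> closure D \<Longrightarrow> x \<in> D \<or> x \<in> frontier D"
  using open_D by (simp add: frontier_def interior_open)

text \<open>At a boundary point an interior edge would meet a boundary edge, and distinct edges meet
  only in vertices.\<close>

lemma open_edge_sub_D: "e \<in> Ei \<Longrightarrow> e - V \<subseteq> D"
proof
  fix x assume e: "e \<in> Ei" and x: "x \<in> e - V"
  then have "x \<in> closure D" using E_sub Ei_sub by blast
  moreover have "x \<notin> frontier D"
  proof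
    assume "x \<in> frontier D"
    then obtain e' where e': "e' \<in> E" "e' \<subseteq> frontier D" "x \<in> e'" using frontier_D by blast
    then have "e \<noteq> e'" using e by (auto simp: interior_edges_def)
    then show False using edges_meet[OF EiD[OF e] e'(1)] x e' by blast
  qed
  ultimately show "x \<in> D" using closure_D_cases by blast
qed

lemma closed_edges: "closed (\<Union>E)"
  using fin_E closed_edge by blast

lemma open_complement: "open (D - \<Union>E)"
  using open_D closed_edges by (rule open_Diff)

lemma cells_open: "P \<in> cells D E \<Longrightarrow> open P"
  using open_complement open_components by (auto simp: cells_def)

lemma cells_connected: "P \<in> cells D E \<Longrightarrow> connected P"
  by (auto simp: cells_def in_components_connected)

lemma cells_ne: "P \<in> cells D E \<Longrightarrow> P \<noteq> {}"
  by (auto simp: cells_def in_components_nonempty)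

lemma cells_sub: "P \<in> cells D E \<Longrightarrow> P \<subseteq> D - \<Union>E"
  unfolding cells_def by (rule in_components_subset)

lemma cells_disjoint: "P \<in> cells D E \<Longrightarrow> Q \<in> cells D E \<Longrightarrow> x \<in> P \<Longrightarrow> x \<in> Q \<Longrightarrow> P = Q"
  using components_nonoverlap[of P "D - \<Union>E" Q] by (auto simp: cells_def)

lemma cell_exists: "x \<in> D - \<Union>E \<Longrightarrow> \<exists>P\<in>cells D E. x \<in> P"
  using Union_components[of "D - \<Union>E"] unfolding cells_def by (metis UnionE)

lemma connected_in_cell:
  assumes "connected K" "K \<subseteq> D - \<Union>E" "K \<noteq> {}"
  shows "\<exists>P\<in>cells D E. K \<subseteq> P"
  using exists_component_superset[OF assms(2) _ assms(1)] assms by (auto simp: cells_def)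

text \<open>Away from its ends an edge has positive distance from all other edges and vertices, and
  there it looks like its whole line.\<close>

lemma edge_nbhd:
  assumes e: "e \<in> Ei" and x: "x \<in> e - V"
  shows "\<exists>r>0. ball x r \<subseteq> D - V \<and> (\<forall>y\<in>ball x r. (y \<in> \<Union>E \<longleftrightarrow> edge_form e y = 0) \<and> (edge_form e y = 0
      \<longrightarrow> y \<in> e - V))"
proof -
  have eE: "e \<in> E" using e by (rule EiD)
  let ?F = "\<Union>(E - {e}) \<union> V"
  have "closed ?F" using fin_E fin_V closed_edge by (intro closed_Un closed_Union) (auto intro:
      finite_imp_closed)
  then have "open (D - ?F)" using open_D by (intro open_Diff)
  moreover have "x \<in> D - ?F" using open_edge_sub_D[OF e] x edges_meet[OF eE] by blast
  ultimately obtain r1 where r1: "r1 > 0" "ball x r1 \<subseteq> D - ?F" by (meson openE)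
  obtain r2 where r2: "r2 > 0" "\<And>y. y \<in> ball x r2 \<Longrightarrow> edge_form e y = 0 \<Longrightarrow> y \<in> e - V"
    using open_segment_nbhd[of x "src e" "dst e"] x open_edge[OF eE] by blast
  show ?thesis
  proof (intro exI[of _ "min r1 r2"] conjI ballI impI)
    fix y assume "y \<in> ball x (min r1 r2)"
    then have y: "y \<in> ball x r1" "y \<in> ball x r2" by auto
    show "y \<in> \<Union>E \<longleftrightarrow> edge_form e y = 0"
      using y r1 r2 edge_form_edge[OF eE] eE by blast
    show "y \<in> e - V" if "edge_form e y = 0" using r2(2)[OF y(2) that] .
  qed (use r1 r2 in auto)
qed

lemma side_unique:
  assumes e: "e \<in> E" and x: "x \<in> e" and \<sigma>: "\<sigma> \<noteq> 0"
    and "r > 0" "r' > 0" "\<forall>y\<in>ball x r. 0 < \<sigma> * edge_form e y \<longrightarrow> y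
        \<in> P" "\<forall>y\<in>ball x r'. 0 < \<sigma> * edge_form e y \<longrightarrow> y \<in> P'"
    and "P \<in> cells D E" "P' \<in> cells D E"
  shows "P = P'"
proof -
  obtain y where "y \<in> ball x (min r r')" "0 < \<sigma> * edge_form e y"
    using half_ball_meets[OF edge_form_edge[OF e x] edge(1)[OF e] _ \<sigma>, of "min r r'"] assms by auto
  then have "y \<in> P" "y \<in> P'" using assms by auto
  then show ?thesis using cells_disjoint assms by blast
qed

text \<open>A small half ball at a point of the open edge is connected and meets no edge, so it lies
  in one cell. This cell is locally constant along the open edge, which is connected.\<close>

lemma side_exists:
  assumes e: "e \<in> Ei" and \<sigma>: "\<sigma> \<noteq> 0"
  shows "\<exists>P\<in>cells D E. \<forall>x\<in>e - V. \<exists>r>0. \<forall>y\<in>ball x r. 0 < \<sigma> * edge_form e y \<longrightarrow> y \<in> P"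
proof -
  have eE: "e \<in> E" using e by (rule EiD)
  let ?Q = "\<lambda>x P. P \<in> cells D E \<and> (\<exists>r>0. \<forall>y\<in>ball x r. 0 < \<sigma> * edge_form e y \<longrightarrow> y \<in> P)"
  define f where "f x = (SOME P. ?Q x P)" for x
  have f: "?Q x (f x)" if x: "x \<in> e - V" for x
  proof -
    obtain r where r: "r > 0" "ball x r \<subseteq> D - V" "\<And>y. y \<in> ball x r \<Longrightarrow> y \<in> \<Union>E \<longleftrightarrow> edge_form e y = 0"
      using edge_nbhd[OF e x] by blast
    let ?K = "{y \<in> ball x r. 0 < \<sigma> * edge_form e y}"
    have "?K \<subseteq> D - \<Union>E" using r(2,3) by force
    moreover have "?K \<noteq> {}"
      using half_ball_meets[OF edge_form_edge[OF eE, of x] edge(1)[OF eE] r(1) \<sigma>] x by blast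
    ultimately obtain P where "P \<in> cells D E" "?K \<subseteq> P"
      using connected_in_cell[OF half_ball_connected] by blast
    then have "?Q x P" using r(1) by blast
    then show ?thesis unfolding f_def by (rule someI)
  qed
  have uniq: "P = f x" if "x \<in> e - V" "?Q x P" for x P
    using side_unique[OF eE _ \<sigma>, of x] f[OF that(1)] that by blast
  have const: "f x = f x'" if "x \<in> e - V" "x' \<in> e - V" for x x'
  proof (rule connected_local_const[OF _ that])
    show "connected (e - V)" unfolding open_edge[OF eE] by (intro convex_connected
        convex_open_segment)
    show "\<forall>x\<in>e - V. \<forall>\<^sub>F y in at x within e - V. f x = f y"
    proof
      fix x assume x: "x \<in> e - V"
      obtain r where r: "r > 0" "\<forall>y\<in>ball x r. 0 < \<sigma> * edge_form e y \<longrightarrow> y \<in> f x" using f[OF x]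
          by blast
      show "\<forall>\<^sub>F y in at x within e - V. f x = f y"
        unfolding eventually_at
      proof (intro exI[of _ r] conjI ballI impI)
        fix y assume y: "y \<in> e - V" "y \<noteq> x \<and> dist y x < r"
        \<comment> \<open>The smaller ball inherits its half ball from the one at \<open>x\<close>,
          so the cell of \<open>x\<close> also serves \<open>y\<close>.\<close>
        have "ball y (r - dist y x) \<subseteq> ball x r"
        proof
          fix z assume "z \<in> ball y (r - dist y x)"
          then show "z \<in> ball x r" using dist_triangle[of x z y] by (simp add: dist_commute)
        qed
        then have "?Q y (f x)" using f[OF x] r y(2) by (intro conjI exI[of _ "r - dist y x"]) auto
        then show "f x = f y" by (rule uniq[OF y(1)])
      qed (rule r(1))
    qed
  qed
  have "open_segment (src e) (dst e) \<noteq> {}" using edge(1)[OF eE] by simp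
  then obtain x0 where x0: "x0 \<in> e - V" using open_edge[OF eE] by blast
  show ?thesis using f const[OF x0] f[OF x0] by (intro bexI[of _ "f x0"]) (metis (no_types,
      lifting))+
qed

lemma side_cell:
  assumes "e \<in> Ei" "\<sigma> \<noteq> 0"
  shows "side_cell D E V \<sigma> e \<in> cells D E"
    "x \<in> e - V \<Longrightarrow> \<exists>r>0. \<forall>y\<in>ball x r. 0 < \<sigma> * edge_form e y \<longrightarrow> y \<in> side_cell D E V \<sigma> e"
proof -
  have "\<exists>P. P \<in> cells D E \<and> (\<forall>x\<in>e - V. \<exists>r>0. \<forall>y\<in>ball x r. 0 < \<sigma> * edge_form e y \<longrightarrow> y \<in> P)"
    using side_exists[OF assms] by blast
  from someI_ex[OF this] have "side_cell D E V \<sigma> e \<in> cells D E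
      \<and> (\<forall>x\<in>e - V. \<exists>r>0. \<forall>y\<in>ball x r. 0 < \<sigma> * edge_form e y \<longrightarrow> y \<in> side_cell D E V \<sigma> e)"
    unfolding side_cell_def .
  then show "side_cell D E V \<sigma> e \<in> cells D E"
    "x \<in> e - V \<Longrightarrow> \<exists>r>0. \<forall>y\<in>ball x r. 0 < \<sigma> * edge_form e y \<longrightarrow> y \<in> side_cell D E V \<sigma> e" by blast+
qed

lemma left_right:
  assumes e: "e \<in> Ei" and x: "x \<in> e - V"
  shows "\<exists>r>0. ball x r \<subseteq> D - V \<and> (\<forall>y\<in>ball x r. (0 < edge_form e y \<longrightarrow> y \<in> left e)
      \<and> (edge_form e y < 0 \<longrightarrow> y \<in> right e)
      \<and> (edge_form e y = 0 \<longrightarrow> y \<in> e - V))"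
proof -
  obtain r1 where r1: "r1 > 0" "ball x r1 \<subseteq> D - V" "\<forall>y\<in>ball x r1. edge_form e y = 0 \<longrightarrow> y \<in> e - V"
    using edge_nbhd[OF assms] by blast
  obtain r2 where r2: "r2 > 0" "\<forall>y\<in>ball x r2. 0 < 1 * edge_form e y \<longrightarrow> y \<in> left e"
    using side_cell(2)[OF e _ x] zero_neq_one by metis
  obtain r3 where r3: "r3 > 0" "\<forall>y\<in>ball x r3. 0 < -1 * edge_form e y \<longrightarrow> y \<in> right e"
    using side_cell(2)[OF e _ x] zero_neq_neg_one by metis
  show ?thesis
    by (rule exI[of _ "min r1 (min r2 r3)"]) (use r1 r2 r3 in auto)
qed

text \<open>The induction principle for pairs of cells: in a connected open set without vertices, a
  cell can be left only through the relative interior of an edge, so an equivalence relation that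
  holds across these edges relates all cells there.\<close>

lemma cells_related:
  assumes U: "open U" "connected U" "U \<subseteq> D - V"
    and refl: "\<And>P. P \<in> cells D E \<Longrightarrow> R P P"
    and sym: "\<And>P Q. P \<in> cells D E \<Longrightarrow> Q \<in> cells D E \<Longrightarrow> R P Q \<Longrightarrow> R Q P"
    and trans: "\<And>P Q S. P \<in> cells D E \<Longrightarrow> Q \<in> cells D E \<Longrightarrow> S \<in> cells D E \<Longrightarrow> R P Q \<Longrightarrow> R Q S \<Longrightarrow> R P S"
    and cross: "\<And>e. e \<in> Ei \<Longrightarrow> e \<inter> U \<noteq> {} \<Longrightarrow> R (left e) (right e)"
    and P: "P \<in> cells D E" "P \<inter> U \<noteq> {}" and Q: "Q \<in> cells D E" "Q \<inter> U \<noteq> {}"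
  shows "R P Q"
proof -
  \<comment> \<open>Every point needs a cell; a point on an edge is assigned the left one, an
    arbitrary choice.\<close>
  define rep where "rep y = (if y \<in> \<Union>E then left (SOME e. e \<in> Ei \<and> y \<in> e) else (SOME P. P
      \<in> cells D E \<and> y \<in> P))" for y
  have rep_cell: "rep y = S" if "S \<in> cells D E" "y \<in> S" for y S
  proof -
    have "y \<notin> \<Union>E" using cells_sub that by blast
    moreover have "(SOME P. P \<in> cells D E \<and> y \<in> P) = S"
      by (rule some_equality) (use that cells_disjoint in blast)+
    ultimately show ?thesis by (simp add: rep_def)
  qed
  have rep_edge: "rep y = left e" if "e \<in> Ei" "y \<in> e - V" for y e
  proof -
    have "(SOME e. e \<in> Ei \<and> y \<in> e) = e"
      by (rule some_equality) (use that edges_meet Ei_sub in blast)+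
    then show ?thesis using that EiD by (auto simp: rep_def)
  qed
  have rep_in: "rep y \<in> cells D E" if y: "y \<in> U" for y
  proof (cases "y \<in> \<Union>E")
    case True
    then obtain e where "e \<in> E" "y \<in> e" by blast
    then have "e \<in> Ei" "y \<in> e - V" using y U(3) edge_at_D by auto
    then show ?thesis using rep_edge side_cell(1)[of e 1] by simp
  next
    case False
    then show ?thesis using cell_exists y U(3) rep_cell by blast
  qed
  obtain p q where p: "p \<in> P" "p \<in> U" and q: "q \<in> Q" "q \<in> U" using P Q by blast
  have "R (rep p) (rep q)"
  proof (rule connected_equivalence_relation[OF U(2) p(2) q(2), where R
      = "\<lambda>x y. R (rep x) (rep y)"])
    show "R (rep y) (rep x)" if "R (rep x) (rep y)" "x \<in> U" "y \<in> U" for x y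
      using sym rep_in that by blast
    show "R (rep x) (rep z)" if "R (rep x) (rep y)" "R (rep y) (rep z)" "x \<in> U" "y \<in> U" "z \<in> U"
        for x y z
      using trans rep_in that by blast
    fix x assume x: "x \<in> U"
    show "\<exists>T. openin (top_of_set U) T \<and> x \<in> T \<and> (\<forall>y\<in>T. R (rep x) (rep y))"
    proof (cases "x \<in> \<Union>E")
      case False
      then obtain S where S: "S \<in> cells D E" "x \<in> S" using cell_exists x U(3) by blast
      have "openin (top_of_set U) (U \<inter> S)" using cells_open[OF S(1)] by (rule openin_open_Int)
      moreover have "\<forall>y\<in>U \<inter> S. R (rep x) (rep y)" using rep_cell S refl by simp
      ultimately show ?thesis using x S by blast
    next
      case True
      then obtain e where e: "e \<in> Ei" "x \<in> e - V" using x U(3) edge_at_D by blast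
      obtain r where r: "r > 0" "\<forall>y\<in>ball x r. (0 < edge_form e y \<longrightarrow> y \<in> left e) \<and> (edge_form e y < 0
          \<longrightarrow> y \<in> right e)
          \<and> (edge_form e y = 0 \<longrightarrow> y \<in> e - V)"
        using left_right[OF e] by blast
      have lr: "left e \<in> cells D E" "right e \<in> cells D E" using side_cell(1)[OF e(1)] by auto
      have "R (rep x) (rep y)" if y: "y \<in> U \<inter> ball x r" for y
      proof -
        have *: "rep x = left e" by (rule rep_edge[OF e])
        have "y \<in> ball x r" using y by blast
        moreover have "0 < edge_form e y \<or> edge_form e y < 0 \<or> edge_form e y = 0" by linarith
        ultimately consider "y \<in> left e" | "y \<in> right e" | "y \<in> e - V" using r(2) by blast
        then show ?thesis
        proof cases
          case 1
          then show ?thesis using * rep_cell lr refl by simp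
        next
          case 2
          then have "rep y = right e" using rep_cell lr by blast
          then show ?thesis using * cross[OF e(1)] e(2) x by auto
        next
          case 3
          then show ?thesis using * rep_edge[OF e(1)] lr refl by simp
        qed
      qed
      moreover have "openin (top_of_set U) (U \<inter> ball x r)" by (rule openin_open_Int) simp
      ultimately show ?thesis using x r(1) by (intro exI[of _ "U \<inter> ball x r"]) auto
    qed
  qed
  then show ?thesis using rep_cell P Q p q by simp
qed

lemma connected_D_minus_V: "connected (D - V)"
  using connected_open_delete_finite[OF open_D connected_D _ fin_V] by simp

lemma open_minus_V: "open U \<Longrightarrow> open (U - V)"
  using fin_V by (intro open_Diff finite_imp_closed)

text \<open>By \<open>cells_related\<close>, any two cells are equal or both adjacent to some edge.
  So besides the finitely many adjacent cells there is at most one.\<close>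

lemma finite_cells: "finite (cells D E)"
proof -
  let ?X = "left ` Ei \<union> right ` Ei"
  have "P = Q \<or> P \<in> ?X \<and> Q \<in> ?X" if P: "P \<in> cells D E" and Q: "Q \<in> cells D E" for P Q
  proof (rule cells_related[OF open_minus_V[OF open_D] connected_D_minus_V subset_refl,
        where R = "\<lambda>P Q. P = Q \<or> P \<in> ?X \<and> Q \<in> ?X"])
    have "S \<inter> (D - V) \<noteq> {}" if "S \<in> cells D E" for S
      using cells_ne[OF that] cells_sub[OF that] V_sub by blast
    then show "P \<inter> (D - V) \<noteq> {}" "Q \<inter> (D - V) \<noteq> {}" using P Q by auto
  qed (use P Q in auto)
  then have "cells D E \<subseteq> insert P ?X" if "P \<in> cells D E" for P using that by blast
  then have "cells D E = {} \<or> (\<exists>P. cells D E \<subseteq> insert P ?X)" by blast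
  moreover have "finite (insert P ?X)" for P using fin_Ei by simp
  ultimately show ?thesis using finite_subset by (metis finite.emptyI)
qed

lemma interior_edges_empty: "interior (\<Union>E) = {}"
proof -
  have "interior (\<Union>F) = {}" if "finite F" "F \<subseteq> E" for F
    using that
  proof (induction F)
    case (insert e F)
    have "interior (\<Union>F \<union> e) = interior (\<Union>F)"
    proof (rule interior_closed_Un_empty_interior)
      show "closed (\<Union>F)" using insert closed_edge by blast
      have "interior (closed_segment (src e) (dst e)) = {}"
          by (rule interior_closed_segment_ge2) simp
      then show "interior e = {}" using edge(2)[of e] insert.prems by simp
    qed
    then show ?case using insert by (simp add: Un_commute)
  qed simp
  then show ?thesis using fin_E by blast
qed

text \<open>Finitely many segments have no interior point, so the complement of the edges is dense
  in \<open>D\<close>; for finitely many cells the closure commutes with the union.\<close>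

lemma D_covered: "D \<subseteq> (\<Union>P\<in>cells D E. closure P)"
proof -
  have "D \<subseteq> closure (D - \<Union>E)"
  proof
    fix x assume x: "x \<in> D"
    show "x \<in> closure (D - \<Union>E)"
    proof (rule ccontr)
      assume "x \<notin> closure (D - \<Union>E)"
      then have "x \<in> D - closure (D - \<Union>E)" using x by blast
      moreover have "open (D - closure (D - \<Union>E))" using open_D by (intro open_Diff) auto
      moreover have "D - closure (D - \<Union>E) \<subseteq> \<Union>E" using closure_subset by blast
      ultimately have "x \<in> interior (\<Union>E)" using interiorI by blast
      then show False using interior_edges_empty by simp
    qed
  qed
  also have "D - \<Union>E = \<Union>(cells D E)" by (simp add: cells_def Union_components)
  also have "closure (\<Union>(cells D E)) = (\<Union>P\<in>cells D E. closure P)"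
    using finite_cells by (induction rule: finite_induct) (simp_all add: closure_Un)
  finally show ?thesis .
qed

lemma cells_ex: "cells D E \<noteq> {}"
  using D_covered D_ne by auto

lemma point_nbhd:
  assumes x: "x \<in> D"
  shows "\<exists>r>0. ball x r \<subseteq> D \<and> ball x r \<inter> V \<subseteq> {x} \<and> (\<forall>e\<in>E. e \<inter> ball x r \<noteq> {} \<longrightarrow> x \<in> e)"
proof -
  let ?F = "\<Union>{e\<in>E. x \<notin> e} \<union> (V - {x})"
  have "closed ?F" using fin_E fin_V closed_edge by (intro closed_Un closed_Union) (auto intro:
      finite_imp_closed)
  then have "open (D - ?F)" using open_D by (intro open_Diff)
  moreover have "x \<in> D - ?F" using x by blast
  ultimately obtain r where "r > 0" "ball x r \<subseteq> D - ?F" by (meson openE)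
  then show ?thesis by blast
qed

lemma closure_meets_punctured:
  assumes "P \<in> cells D E" "x \<in> closure P" "r > 0"
  shows "P \<inter> (ball x r - {x}) \<noteq> {}"
proof
  assume *: "P \<inter> (ball x r - {x}) = {}"
  have "P \<inter> ball x r \<noteq> {}"
    using assms(2,3) unfolding closure_approachable by (metis IntI dist_commute empty_iff mem_ball)
  then have "P \<inter> ball x r = {x}" using * by blast
  moreover have "open (P \<inter> ball x r)" using cells_open[OF assms(1)] by auto
  ultimately show False using not_open_singleton by metis
qed

text \<open>The local form of \<open>cells_related\<close>, also when \<open>x\<close> is a vertex:
  in the plane a punctured ball is still connected, and a small one contains no vertex and meets
  only edges through \<open>x\<close>.\<close>

lemma cells_related_at:
  assumes x: "x \<in> D"
    and "\<And>P. P \<in> cells D E \<Longrightarrow> R P P"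
    and "\<And>P Q. P \<in> cells D E \<Longrightarrow> Q \<in> cells D E \<Longrightarrow> R P Q \<Longrightarrow> R Q P"
    and "\<And>P Q S. P \<in> cells D E \<Longrightarrow> Q \<in> cells D E \<Longrightarrow> S \<in> cells D E \<Longrightarrow> R P Q \<Longrightarrow> R Q S \<Longrightarrow> R P S"
    and cross: "\<And>e. e \<in> Ei \<Longrightarrow> x \<in> e \<Longrightarrow> R (left e) (right e)"
    and P: "P \<in> cells D E" "x \<in> closure P" and Q: "Q \<in> cells D E" "x \<in> closure Q"
  shows "R P Q"
proof -
  obtain r where r: "r > 0" "ball x r \<subseteq> D" "ball x r \<inter> V \<subseteq> {x}" "\<forall>e\<in>E. e \<inter> ball x r \<noteq> {} \<longrightarrow> x \<in> e"
    using point_nbhd[OF x] by blast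
  show ?thesis
  proof (rule cells_related[where U = "ball x r - {x}" and R = R])
    show "open (ball x r - {x})" by auto
    show "connected (ball x r - {x})" by (rule connected_punctured_ball) simp
    show "ball x r - {x} \<subseteq> D - V" using r by blast
    show "R (left e) (right e)" if "e \<in> Ei" "e \<inter> (ball x r - {x}) \<noteq> {}" for e
      using that r(4) EiD by (intro cross) blast+
  qed (use assms closure_meets_punctured[OF _ _ r(1)] in blast)+
qed

end

section \<open>Jumps around an interior vertex\<close>

text \<open>Induction on the number of jumps: lowering the function by \<open>j i\<close> to the
  right of \<tau> i removes this jump and keeps the others. Without jumps it is locally constant on
  an interval.\<close>

lemma step_function_total_jump:
  fixes g :: "real \<Rightarrow> real" and \<tau> :: "'a \<Rightarrow> real"
  assumes "finite I" "inj_on \<tau> I" "a \<le> b" "\<And>i. i \<in> I \<Longrightarrow> a < \<tau> i \<and> \<tau> i < b"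
    and "\<And>t. t \<in> {a..b} \<Longrightarrow> t \<notin> \<tau> ` I \<Longrightarrow> \<exists>\<delta>>0. \<forall>s\<in>{a..b}. \<bar>s - t\<bar> < \<delta> \<longrightarrow> g s = g t"
    and "\<And>i. i \<in> I \<Longrightarrow> \<exists>c. \<exists>\<delta>>0. \<forall>s\<in>{a..b}. \<bar>s - \<tau> i\<bar> < \<delta> \<longrightarrow>
        (s < \<tau> i \<longrightarrow> g s = c) \<and> (\<tau> i < s \<longrightarrow> g s = c + j i)"
  shows "g b - g a = (\<Sum>i\<in>I. j i)"
  using assms
proof (induction I arbitrary: g)
  case empty
  have "g a = g b"
  proof (rule connected_local_const[of "{a..b}" _ _ g])
    show "\<forall>t\<in>{a..b}. \<forall>\<^sub>F s in at t within {a..b}. g t = g s"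
    proof
      fix t assume t: "t \<in> {a..b}"
      then obtain \<delta> where "\<delta> > 0" "\<forall>s\<in>{a..b}. \<bar>s - t\<bar> < \<delta> \<longrightarrow> g s = g t"
        using empty.prems(4) by blast
      then show "\<forall>\<^sub>F s in at t within {a..b}. g t = g s"
        unfolding eventually_at dist_real_def by (intro exI[of _ \<delta>]) auto
    qed
  qed (use empty in auto)
  then show ?case by simp
next
  case (insert i I)
  obtain c \<delta> where c: "\<delta> > 0" "\<And>s. s \<in> {a..b} \<Longrightarrow> \<bar>s - \<tau> i\<bar> < \<delta> \<Longrightarrow>
        (s < \<tau> i \<longrightarrow> g s = c) \<and> (\<tau> i < s \<longrightarrow> g s = c + j i)"
    using insert.prems(5)[of i] by blast
  \<comment> \<open>The value of \<open>g\<close> at \<tau> i itself is unconstrained, so it is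
    replaced by the limit \<open>c\<close> from the left.\<close>
  define g' where "g' = (\<lambda>s. if s < \<tau> i then g s else if s = \<tau> i then c else g s - j i)"
  have "g' b - g' a = (\<Sum>i\<in>I. j i)"
  proof (rule insert.IH)
    show "inj_on \<tau> I" "a \<le> b" "\<And>k. k \<in> I \<Longrightarrow> a < \<tau> k \<and> \<tau> k < b" using insert.prems by auto
    fix t assume t: "t \<in> {a..b}" "t \<notin> \<tau> ` I"
    show "\<exists>\<delta>>0. \<forall>s\<in>{a..b}. \<bar>s - t\<bar> < \<delta> \<longrightarrow> g' s = g' t"
    proof (cases "t = \<tau> i")
      case True
      then show ?thesis using c by (intro exI[of _ \<delta>]) (auto simp: g'_def)
    next
      case False
      then obtain \<delta>' where \<delta>': "\<delta>' > 0" "\<And>s. s \<in> {a..b} \<Longrightarrow> \<bar>s - t\<bar> < \<delta>' \<Longrightarrow> g s = g t"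
        using insert.prems(4)[OF t(1)] t(2) by blast
      show ?thesis
      proof (intro exI[of _ "min \<delta>' \<bar>t - \<tau> i\<bar>"] conjI ballI impI)
        fix s assume s: "s \<in> {a..b}" "\<bar>s - t\<bar> < min \<delta>' \<bar>t - \<tau> i\<bar>"
        then have "s < \<tau> i \<longleftrightarrow> t < \<tau> i" "s \<noteq> \<tau> i" by auto
        then show "g' s = g' t" using \<delta>'(2)[OF s(1)] s(2) False by (simp add: g'_def)
      qed (use \<delta>'(1) False in auto)
    qed
  next
    fix k assume k: "k \<in> I"
    have ne: "\<tau> k \<noteq> \<tau> i" using inj_onD[OF insert.prems(1), of k i] insert.hyps(2) k by blast
    obtain c' \<delta>' where c': "\<delta>' > 0" "\<And>s. s \<in> {a..b} \<Longrightarrow> \<bar>s - \<tau> k\<bar> < \<delta>' \<Longrightarrow>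
        (s < \<tau> k \<longrightarrow> g s = c') \<and> (\<tau> k < s \<longrightarrow> g s = c' + j k)"
      using insert.prems(5)[of k] k by blast
    \<comment> \<open>To the right of \<tau> i the new function is shifted by \<open>j i\<close>,
      and so is the value on the left of the jump at \<tau> k.\<close>
    show "\<exists>c. \<exists>\<delta>>0. \<forall>s\<in>{a..b}. \<bar>s - \<tau> k\<bar> < \<delta> \<longrightarrow>
        (s < \<tau> k \<longrightarrow> g' s = c) \<and> (\<tau> k < s \<longrightarrow> g' s = c + j k)"
    proof (rule exI[of _ "if \<tau> k < \<tau> i then c' else c' - j i"], rule exI[of _ "min \<delta>' \<bar>\<tau> k - \<tau> i\<bar>"],
        rule conjI[OF _ ballI], rule_tac [2] impI)
      fix s assume s: "s \<in> {a..b}" "\<bar>s - \<tau> k\<bar> < min \<delta>' \<bar>\<tau> k - \<tau> i\<bar>"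
      then have "s < \<tau> i \<longleftrightarrow> \<tau> k < \<tau> i" "s \<noteq> \<tau> i" by auto
      then show "(s < \<tau> k \<longrightarrow> g' s = (if \<tau> k < \<tau> i then c' else c' - j i))
          \<and> (\<tau> k < s \<longrightarrow> g' s = (if \<tau> k < \<tau> i then c' else c' - j i) + j k)"
        using c'(2)[OF s(1)] s(2) by (simp add: g'_def)
    qed (use c'(1) ne in auto)
  qed
  moreover have "g' b = g b - j i" "g' a = g a" using insert.prems(3)[of i] by (auto simp: g'_def)
  ultimately show ?case using insert.hyps by simp
qed

definition unit_vec :: "real \<Rightarrow> plane" where
  "unit_vec t = vector [cos t, sin t]"

lemma norm_unit_vec [simp]: "norm (unit_vec t) = 1"
  by (simp add: unit_vec_def norm_eq_sqrt_inner inner_vec_def sum_2 flip: power2_eq_square)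

lemma det2_unit_vec: "det2 (unit_vec s) (unit_vec t) = sin (t - s)"
  by (simp add: unit_vec_def det2_def sin_diff)

lemma continuous_unit_vec: "continuous_on S unit_vec"
proof -
  have eq: "unit_vec = (\<lambda>t. cos t *\<^sub>R axis 1 1 + sin t *\<^sub>R axis 2 1)"
    by (auto simp: unit_vec_def fun_eq_iff vec_eq_iff forall_2 axis_def)
  show ?thesis unfolding eq by (intro continuous_intros)
qed

lemma unit_vec_eq_iff: "unit_vec s = unit_vec t \<longleftrightarrow> (\<exists>n::int. s = t + 2 * pi * n)"
  using sin_cos_eq_iff[of s t] by (auto simp: unit_vec_def vec_eq_iff forall_2)

lemma unit_vec_eqD: "unit_vec s = unit_vec t \<Longrightarrow> \<bar>s - t\<bar> < 2 * pi \<Longrightarrow> s = t"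
proof -
  assume "unit_vec s = unit_vec t" and *: "\<bar>s - t\<bar> < 2 * pi"
  then obtain n :: int where n: "s = t + 2 * pi * n" using unit_vec_eq_iff by blast
  then have "2 * pi * \<bar>real_of_int n\<bar> < 2 * pi * 1" using * by (simp add: abs_mult)
  then have "\<bar>real_of_int n\<bar> < 1" using pi_gt_zero by (simp only: mult_less_cancel_left_pos
      mult_pos_pos zero_less_numeral)
  then have "n = 0" by linarith
  then show ?thesis using n by simp
qed

lemma unit_vec_polar: "\<exists>t. a \<le> t \<and> t < a + 2 * pi \<and> v = norm v *\<^sub>R unit_vec t"
proof (cases "v = 0")
  case True
  then show ?thesis by (intro exI[of _ a]) auto
next
  case False
  have "(norm v)\<^sup>2 = (v$1)\<^sup>2 + (v$2)\<^sup>2"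
    unfolding power2_norm_eq_inner by (simp add: inner_vec_def sum_2 power2_eq_square)
  then have "(v$1 / norm v)\<^sup>2 + (v$2 / norm v)\<^sup>2 = (norm v)\<^sup>2 / (norm v)\<^sup>2"
    by (simp only: power_divide add_divide_distrib)
  also have "\<dots> = 1" using False by simp
  finally have unit: "(v$1 / norm v)\<^sup>2 + (v$2 / norm v)\<^sup>2 = 1" .
  obtain t where t: "v$1 / norm v = cos t" "v$2 / norm v = sin t"
    by (rule sincos_total_2pi[OF unit])
  have "norm v * cos t = v$1" "norm v * sin t = v$2" unfolding t[symmetric] using False by simp_all
  then have v: "v = norm v *\<^sub>R unit_vec t" unfolding unit_vec_def vec_eq_iff forall_2 by simp
  define n :: int where "n = \<lceil>(a - t) / (2 * pi)\<rceil>"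
  have "(a - t) / (2 * pi) \<le> n" "n < (a - t) / (2 * pi) + 1" unfolding n_def by linarith+
  then have "a \<le> t + 2 * pi * n" "t + 2 * pi * n < a + 2 * pi"
    by (simp_all add: field_simps)
  moreover have "unit_vec (t + 2 * pi * n) = unit_vec t" using unit_vec_eq_iff by blast
  ultimately show ?thesis using v by (intro exI[of _ "t + 2 * pi * n"]) simp
qed

context partition
begin

text \<open>Walking once around an interior vertex, one crosses each edge at this vertex exactly once.\<close>

lemma jumps_around_vertex:
  fixes g :: "plane set \<Rightarrow> real"
  assumes A: "A \<in> Vi"
  shows "(\<Sum>e\<in>Ei. end_sign e A * (g (left e) - g (right e))) = 0"
proof -
  have AD: "A \<in> D" and AV: "A \<in> V" using A by (auto simp: Vi_eq)
  obtain r where r: "r > 0" "ball A r \<subseteq> D" "ball A r \<inter> V \<subseteq> {A}" "\<And>e. e \<in> E \<Longrightarrow> e \<inter> ball A r \<noteq> {} \<Longrightarrow> A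
      \<in> e"
    using point_nbhd[OF AD] by metis
  \<comment> \<open>The circle of half the radius stays in a ball in which \<open>A\<close> is the
    only vertex and every edge that is met passes through \<open>A\<close>.\<close>
  define \<rho> where "\<rho> = r / 2"
  have \<rho>: "0 < \<rho>" "\<rho> < r" using r(1) by (auto simp: \<rho>_def)
  define \<gamma> where "\<gamma> t = A + \<rho> *\<^sub>R unit_vec t" for t
  have \<gamma>_ball: "\<gamma> t \<in> ball A r" for t using \<rho> by (simp add: \<gamma>_def dist_norm)
  have \<gamma>_ne: "\<gamma> t \<noteq> A" for t
    using \<rho>(1) norm_unit_vec[of t] by (auto simp: \<gamma>_def simp del: norm_unit_vec)
  have \<gamma>_D: "\<gamma> t \<in> D - V" for t using \<gamma>_ball[of t] \<gamma>_ne[of t] r(2,3) by blast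
  have \<gamma>_cont: "continuous_on UNIV \<gamma>" unfolding \<gamma>_def by (intro continuous_intros
      continuous_unit_vec)
  have \<gamma>_near: "\<exists>\<delta>>0. \<forall>s. \<bar>s - t\<bar> < \<delta> \<longrightarrow> \<gamma> s \<in> W" if W: "open W" "\<gamma> t \<in> W" for W t
  proof -
    have "open (\<gamma> -` W)" using \<gamma>_cont W(1) by (simp add: continuous_on_open_vimage)
    then obtain \<delta> where "\<delta> > 0" "ball t \<delta> \<subseteq> \<gamma> -` W" using W(2) openE[of "\<gamma> -` W" t] by auto
    then show ?thesis by (intro exI[of _ \<delta>]) (auto simp: subset_eq dist_real_def abs_minus_commute)
  qed
  define I where "I = {e\<in>E. A \<in> e}"
  have I_Ei: "I \<subseteq> Ei" using edge_at_D AD by (auto simp: I_def)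
  have finI: "finite I" using fin_E by (simp add: I_def)
  define u where "u e = (if src e = A then dst e - A else src e - A)" for e
  have Iend: "src e = A \<or> dst e = A" if "e \<in> I" for e
  proof -
    have "A \<in> e \<inter> V" "e \<in> E" using that AV by (auto simp: I_def)
    then show ?thesis using edge(3)[of e] by auto
  qed
  have eseg: "closed_segment A (A + u e) = e" if e: "e \<in> I" for e
  proof (cases "src e = A")
    case True
    then show ?thesis using edge(2)[of e] e by (simp add: I_def u_def)
  next
    case False
    then have "A = dst e" using Iend[OF e] by simp
    then show ?thesis using edge(2)[of e] e False by (simp add: I_def u_def closed_segment_commute)
  qed
  have u_ne: "u e \<noteq> 0" if "e \<in> I" for e
    using edge(1)[of e] Iend[OF that] that by (auto simp: I_def u_def)
  \<comment> \<open>The other end of the edge is a vertex and so lies outside the ball; hence the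
    edge reaches the circle.\<close>
  have u_norm: "r \<le> norm (u e)" if "e \<in> I" for e
  proof -
    have "A + u e \<in> V" using edge_ends[of e] that by (auto simp: I_def u_def)
    moreover have "A + u e \<noteq> A" using u_ne[OF that] by simp
    ultimately have "A + u e \<notin> ball A r" using r(3) by blast
    then show ?thesis by (simp add: dist_norm)
  qed
  have on_edge: "\<gamma> t \<in> e \<longleftrightarrow> u e = norm (u e) *\<^sub>R unit_vec t" if e: "e \<in> I" for e t
  proof -
    have "\<gamma> t \<in> e \<longleftrightarrow> \<gamma> t \<in> closed_segment A (A + u e)" by (simp only: eseg[OF e])
    also have "\<dots> \<longleftrightarrow> (\<exists>s. 0 \<le> s \<and> s \<le> 1 \<and> \<rho> *\<^sub>R unit_vec t = s *\<^sub>R u e)"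
    proof -
      have "(1 - s) *\<^sub>R A + s *\<^sub>R (A + u e) = A + s *\<^sub>R u e" for s by (simp add: algebra_simps)
      then show ?thesis unfolding in_segment \<gamma>_def by simp
    qed
    also have "\<dots> \<longleftrightarrow> u e = norm (u e) *\<^sub>R unit_vec t"
    proof
      assume "\<exists>s. 0 \<le> s \<and> s \<le> 1 \<and> \<rho> *\<^sub>R unit_vec t = s *\<^sub>R u e"
      then obtain s where s: "0 \<le> s" "\<rho> *\<^sub>R unit_vec t = s *\<^sub>R u e" by blast
      have "\<rho> = s * norm (u e)" using arg_cong[OF s(2), of norm] s(1) \<rho> by simp
      then have "s *\<^sub>R (norm (u e) *\<^sub>R unit_vec t) = s *\<^sub>R u e" "s \<noteq> 0" using s(2) \<rho> by auto
      then show "u e = norm (u e) *\<^sub>R unit_vec t" using scaleR_left_imp_eq by metis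
    next
      assume *: "u e = norm (u e) *\<^sub>R unit_vec t"
      have "\<rho> *\<^sub>R unit_vec t = (\<rho> / norm (u e)) *\<^sub>R (norm (u e) *\<^sub>R unit_vec t)" using u_ne[OF e]
          by simp
      then have "\<rho> *\<^sub>R unit_vec t = (\<rho> / norm (u e)) *\<^sub>R u e" using * by simp
      moreover have "\<rho> / norm (u e) \<le> 1" using u_norm[OF e] \<rho>
          by (subst divide_le_eq_1_pos) linarith+
      ultimately show "\<exists>s. 0 \<le> s \<and> s \<le> 1 \<and> \<rho> *\<^sub>R unit_vec t = s *\<^sub>R u e"
        using \<rho> by (intro exI[of _ "\<rho> / norm (u e)"]) auto
    qed
    finally show ?thesis .
  qed
  have same: "unit_vec s = unit_vec t" if "e \<in> I" "\<gamma> s \<in> e" "\<gamma> t \<in> e" for e s t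
  proof -
    have "norm (u e) *\<^sub>R unit_vec s = norm (u e) *\<^sub>R unit_vec t" using on_edge that by metis
    then show ?thesis using u_ne[OF that(1)] by simp
  qed
  have inI: "e \<in> I" if "e \<in> E" "\<gamma> t \<in> e" for e t
    using r(4)[OF that(1)] that \<gamma>_ball[of t] unfolding I_def by blast
  \<comment> \<open>The walk must start inside a cell. Each edge takes at most one angle per turn,
    so finitely many edges cannot block them all.\<close>
  have "\<exists>a. \<gamma> a \<notin> \<Union>E"
  proof (rule ccontr)
    assume "\<not> (\<exists>a. \<gamma> a \<notin> \<Union>E)"
    then have "{0..<2 * pi} \<subseteq> (\<Union>e\<in>I. {t \<in> {0..<2 * pi}. \<gamma> t \<in> e})" using inI by blast
    moreover have "finite (\<Union>e\<in>I. {t \<in> {0..<2 * pi}. \<gamma> t \<in> e})"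
    proof (intro finite_UN_I finI)
      fix e assume e: "e \<in> I"
      have "s = t" if "s \<in> {t \<in> {0..<2 * pi}. \<gamma> t \<in> e}" "t \<in> {t \<in> {0..<2 * pi}. \<gamma> t \<in> e}" for s t
        by (rule unit_vec_eqD) (use same[OF e] that in auto)
      then show "finite {t \<in> {0..<2 * pi}. \<gamma> t \<in> e}"
        by (metis (no_types, lifting) finite.simps is_singletonI' is_singleton_the_elem)
    qed
    ultimately have "finite {0..<2 * pi}" using finite_subset by blast
    then show False by (simp add: infinite_Ico)
  qed
  then obtain a where a: "\<gamma> a \<notin> \<Union>E" by blast
  have "\<exists>t. a < t \<and> t < a + 2 * pi \<and> \<gamma> t \<in> e" if e: "e \<in> I" for e
  proof -
    obtain t where t: "a \<le> t" "t < a + 2 * pi" "u e = norm (u e) *\<^sub>R unit_vec t"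
        using unit_vec_polar[of a "u e"] by blast
    then have "\<gamma> t \<in> e" using on_edge[OF e] by blast
    moreover have "t \<noteq> a" using calculation a e by (auto simp: I_def)
    ultimately show ?thesis using t by (intro exI[of _ t]) auto
  qed
  then obtain \<tau> where \<tau>: "\<And>e. e \<in> I \<Longrightarrow> a < \<tau> e \<and> \<tau> e < a + 2 * pi" "\<And>e. e \<in> I \<Longrightarrow> \<gamma> (\<tau> e) \<in> e"
    by metis
  \<comment> \<open>The value of \<open>g\<close> on the cell at angle \<open>t\<close>; at the
    angles of the edges it is an arbitrary value, which the jump lemma permits.\<close>
  define G where "G t = g (SOME P. P \<in> cells D E \<and> \<gamma> t \<in> P)" for t
  have G: "G t = g P" if "P \<in> cells D E" "\<gamma> t \<in> P" for P t
  proof -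
    have "(SOME P. P \<in> cells D E \<and> \<gamma> t \<in> P) = P"
      by (rule some_equality) (use that cells_disjoint in blast)+
    then show ?thesis by (simp add: G_def)
  qed
  have "G (a + 2 * pi) - G a = (\<Sum>e\<in>I. end_sign e A * (g (left e) - g (right e)))"
  proof (rule step_function_total_jump[where \<tau> = \<tau> and g = G and j
      = "\<lambda>e. end_sign e A * (g (left e) - g (right e))"])
    show "inj_on \<tau> I"
    proof (rule inj_onI, rule ccontr)
      fix e e' assume "e \<in> I" "e' \<in> I" "\<tau> e = \<tau> e'" "e \<noteq> e'"
      then have "\<gamma> (\<tau> e) \<in> V" using \<tau>(2)[of e] \<tau>(2)[of e'] edges_meet[of e e'] by (auto simp: I_def)
      then show False using \<gamma>_D by blast
    qed
    fix t assume t: "t \<in> {a..a + 2 * pi}" "t \<notin> \<tau> ` I"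
    have "\<gamma> t \<notin> \<Union>E"
    proof
      assume "\<gamma> t \<in> \<Union>E"
      then obtain e where e: "e \<in> I" "\<gamma> t \<in> e" using inI by blast
      have "t = \<tau> e" by (rule unit_vec_eqD[OF same[OF e(1)]]) (use \<tau>[OF e(1)] e t in auto)
      then show False using t e by blast
    qed
    then obtain P where P: "P \<in> cells D E" "\<gamma> t \<in> P" using cell_exists \<gamma>_D[of t] by blast
    obtain \<delta> where "\<delta> > 0" "\<forall>s. \<bar>s - t\<bar> < \<delta> \<longrightarrow> \<gamma> s \<in> P" using \<gamma>_near[OF cells_open[OF P(1)] P(2)]
        by blast
    then show "\<exists>\<delta>>0. \<forall>s\<in>{a..a + 2 * pi}. \<bar>s - t\<bar> < \<delta> \<longrightarrow> G s = G t"
      using G P by (intro exI[of _ \<delta>]) auto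
  next
    fix e assume e: "e \<in> I"
    have eEi: "e \<in> Ei" using e I_Ei by blast
    have x: "\<gamma> (\<tau> e) \<in> e - V" using \<tau>(2)[OF e] \<gamma>_D by blast
    obtain r' where r': "r' > 0" "\<And>y. y \<in> ball (\<gamma> (\<tau> e)) r' \<Longrightarrow> 0 < edge_form e y \<Longrightarrow> y \<in> left e"
      "\<And>y. y \<in> ball (\<gamma> (\<tau> e)) r' \<Longrightarrow> edge_form e y < 0 \<Longrightarrow> y \<in> right e"
      using left_right[OF eEi x] by blast
    obtain \<delta> where \<delta>: "\<delta> > 0" "\<And>s. \<bar>s - \<tau> e\<bar> < \<delta> \<Longrightarrow> \<gamma> s \<in> ball (\<gamma> (\<tau> e)) r'"
      using \<gamma>_near[of "ball (\<gamma> (\<tau> e)) r'" "\<tau> e"] r'(1) by auto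
    have u: "u e = norm (u e) *\<^sub>R unit_vec (\<tau> e)" using on_edge[OF e] \<tau>(2)[OF e] by blast
    have det2_u: "det2 (u e) (\<gamma> s - A) = norm (u e) * \<rho> * sin (s - \<tau> e)" for s
      by (subst u) (simp add: \<gamma>_def det2_unit_vec)
    \<comment> \<open>Moving counterclockwise crosses an edge that starts at \<open>A\<close> from
      right to left, and one that ends at \<open>A\<close> from left to right;
      \<open>end_sign\<close> is the sign of the crossing.\<close>
    have line_form_\<gamma>: "edge_form e (\<gamma> s) = end_sign e A * (norm (u e) * \<rho> * sin (s - \<tau> e))" for s
    proof (cases "src e = A")
      case True
      then show ?thesis using det2_u[of s] by (simp add: line_form_def u_def end_sign_def)
    next
      case False
      then have dA: "dst e = A" using Iend[OF e] by simp
      have "edge_form e (\<gamma> s) = det2 (dst e - src e) (\<gamma> s - A)"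
          by (rule line_form_shift) (simp flip: dA)
      also have "\<dots> = - det2 (u e) (\<gamma> s - A)" using False dA
          by (simp add: u_def flip: det2_uminus(1))
      finally show ?thesis using False dA det2_u[of s] by (simp add: end_sign_def)
    qed
    have pos: "0 < norm (u e) * \<rho>" using u_ne[OF e] \<rho> by simp
    have cells: "left e \<in> cells D E" "right e \<in> cells D E" using side_cell(1)[OF eEi] by auto
    have end_sign: "end_sign e A = 1 \<or> end_sign e A = -1" using Iend[OF e]
        by (auto simp: end_sign_def)
    show "\<exists>c. \<exists>\<delta>>0. \<forall>s\<in>{a..a + 2 * pi}. \<bar>s - \<tau> e\<bar> < \<delta> \<longrightarrow> (s < \<tau> e \<longrightarrow> G s = c)
        \<and> (\<tau> e < s \<longrightarrow> G s = c + end_sign e A * (g (left e) - g (right e)))"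
    proof (rule exI[of _ "if end_sign e A = 1 then g (right e) else g (left e)"], rule exI[of _ "min
        \<delta> pi"],
          rule conjI[OF _ ballI], rule_tac [2] impI)
      fix s assume s: "\<bar>s - \<tau> e\<bar> < min \<delta> pi"
      have ball: "\<gamma> s \<in> ball (\<gamma> (\<tau> e)) r'" using \<delta>(2) s by simp
      have L: "G s = g (left e)" if "0 < end_sign e A * sin (s - \<tau> e)"
      proof (rule G[OF cells(1) r'(2)[OF ball]])
        have "0 < (norm (u e) * \<rho>) * (end_sign e A * sin (s - \<tau> e))" using pos that
            by (rule mult_pos_pos)
        then show "0 < edge_form e (\<gamma> s)" by (simp add: line_form_\<gamma> ac_simps)
      qed
      have R: "G s = g (right e)" if "end_sign e A * sin (s - \<tau> e) < 0"
      proof (rule G[OF cells(2) r'(3)[OF ball]])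
        have "(norm (u e) * \<rho>) * (end_sign e A * sin (s - \<tau> e)) < 0" using pos that
            by (rule mult_pos_neg)
        then show "edge_form e (\<gamma> s) < 0" by (simp add: line_form_\<gamma> ac_simps)
      qed
      have "\<tau> e < s \<Longrightarrow> 0 < sin (s - \<tau> e)" using s by (intro sin_gt_zero) auto
      moreover have "s < \<tau> e \<Longrightarrow> 0 < sin (\<tau> e - s)" using s by (intro sin_gt_zero) auto
      moreover have "sin (\<tau> e - s) = - sin (s - \<tau> e)" by (metis minus_diff_eq sin_minus)
      ultimately show "(s < \<tau> e \<longrightarrow> G s = (if end_sign e A = 1 then g (right e) else g (left e)))
        \<and> (\<tau> e < s \<longrightarrow> G s = (if end_sign e A = 1 then g (right e) else g (left e))
            + end_sign e A * (g (left e) - g (right e)))"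
        using L R end_sign by auto
    qed (use \<delta>(1) pi_gt_zero in auto)
  qed (use finI \<tau>(1) pi_gt_zero in auto)
  \<comment> \<open>The walk closes up, so the total jump is zero.\<close>
  moreover have "\<gamma> (a + 2 * pi) = \<gamma> a" by (simp add: \<gamma>_def unit_vec_def)
  ultimately have "(\<Sum>e\<in>I. end_sign e A * (g (left e) - g (right e))) = 0" by (simp add: G_def)
  moreover have "(\<Sum>e\<in>Ei. end_sign e A * (g (left e) - g (right e)))
      = (\<Sum>e\<in>I. end_sign e A * (g (left e) - g (right e)))"
  proof (rule sum.mono_neutral_right[OF fin_Ei I_Ei], rule ballI)
    fix e assume e: "e \<in> Ei - I"
    then have "src e \<noteq> A" "dst e \<noteq> A" using edge_ends[of e] EiD by (auto simp: I_def)
    then show "end_sign e A * (g (left e) - g (right e)) = 0" by (simp add: end_sign_def)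
  qed
  ultimately show ?thesis by simp
qed

end

section \<open>Counting along l-edges\<close>

lemma segment_on_line:
  fixes u x :: "'a::real_vector"
  assumes "\<alpha> \<le> \<beta>"
  shows "closed_segment (x + \<alpha> *\<^sub>R u) (x + \<beta> *\<^sub>R u) = (\<lambda>t. x + t *\<^sub>R u) ` {\<alpha>..\<beta>}"
proof -
  have "linear (\<lambda>t. t *\<^sub>R u)" by (rule linear_scaleR_left)
  then have "closed_segment (x + \<alpha> *\<^sub>R u) (x + \<beta> *\<^sub>R u) = (\<lambda>y. x
      + y) ` (\<lambda>t. t *\<^sub>R u) ` closed_segment \<alpha> \<beta>"
    by (simp add: closed_segment_translation closed_segment_linear_image[of "\<lambda>t. t *\<^sub>R u" \<alpha> \<beta>])
  then show ?thesis using assms by (simp add: closed_segment_eq_real_ivl image_image)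
qed

lemma open_segment_on_line:
  fixes u x :: "'a::real_vector"
  assumes "\<alpha> < \<beta>" "u \<noteq> 0"
  shows "open_segment (x + \<alpha> *\<^sub>R u) (x + \<beta> *\<^sub>R u) = (\<lambda>t. x + t *\<^sub>R u) ` {\<alpha><..<\<beta>}"
proof -
  have "inj (\<lambda>t. x + t *\<^sub>R u)" using assms(2) by (auto intro!: injI)
  then have "(\<lambda>t. x + t *\<^sub>R u) ` ({\<alpha>..\<beta>} - {\<alpha>, \<beta>}) = (\<lambda>t. x + t *\<^sub>R u) ` {\<alpha>..\<beta>} - (\<lambda>t. x
      + t *\<^sub>R u) ` {\<alpha>, \<beta>}"
    by (rule image_set_diff)
  moreover have "{\<alpha>..\<beta>} - {\<alpha>, \<beta>} = {\<alpha><..<\<beta>}" by auto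
  ultimately show ?thesis
    using segment_on_line[of \<alpha> \<beta> x u] assms(1) by (simp add: open_segment_def)
qed

text \<open>The parameter 0 at \<open>x\<close> lies in the interval, so two segments through
  \<open>x\<close> on the same line have overlapping parameter intervals.\<close>

lemma segment_param_on_line:
  fixes x :: "'a::euclidean_space"
  assumes ab: "a \<noteq> b" "s = closed_segment a b" and u: "u \<noteq> 0"
    and hull: "affine hull s \<subseteq> range (\<lambda>t. x + t *\<^sub>R u)" and x: "x \<in> s"
  shows "\<exists>\<alpha> \<beta>. \<alpha> \<le> 0 \<and> 0 \<le> \<beta> \<and> \<alpha> < \<beta> \<and> s = (\<lambda>t. x + t *\<^sub>R u) ` {\<alpha>..\<beta>} \<and>
     open_segment a b = (\<lambda>t. x + t *\<^sub>R u) ` {\<alpha><..<\<beta>}"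
proof -
  have *: "\<exists>\<alpha> \<beta>. \<alpha> \<le> 0 \<and> 0 \<le> \<beta> \<and> \<alpha> < \<beta> \<and> closed_segment p q = (\<lambda>t. x + t *\<^sub>R u) ` {\<alpha>..\<beta>} \<and>
     open_segment p q = (\<lambda>t. x + t *\<^sub>R u) ` {\<alpha><..<\<beta>}"
    if p: "p = x + \<alpha> *\<^sub>R u" and q: "q = x + \<beta> *\<^sub>R u" and ab: "\<alpha> < \<beta>" and x: "x \<in> closed_segment p q"
    for p q \<alpha> \<beta>
  proof -
    have seg: "closed_segment p q = (\<lambda>t. x + t *\<^sub>R u) ` {\<alpha>..\<beta>}"
      unfolding p q using ab by (intro segment_on_line) simp
    obtain t where "t \<in> {\<alpha>..\<beta>}" "x = x + t *\<^sub>R u" using x unfolding seg by blast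
    then have "0 \<in> {\<alpha>..\<beta>}" using u by simp
    then show ?thesis using seg open_segment_on_line[OF ab u, of x] ab unfolding p q by auto
  qed
  have "a \<in> affine hull s" "b \<in> affine hull s" using ab(2) by (auto intro: hull_inc)
  then obtain \<alpha> \<beta> where ends: "a = x + \<alpha> *\<^sub>R u" "b = x + \<beta> *\<^sub>R u" using hull by blast
  then have "\<alpha> \<noteq> \<beta>" using ab(1) by auto
  then consider "\<alpha> < \<beta>" | "\<beta> < \<alpha>" by linarith
  then show ?thesis
  proof cases
    case 1
    then show ?thesis using *[OF ends] x unfolding ab(2) by blast
  next
    case 2
    then show ?thesis using *[OF ends(2,1)] x unfolding ab(2)
      by (metis closed_segment_commute open_segment_commute)
  qed
qed

lemma affine_hull_segment_range:
  fixes a b x :: "'a::euclidean_space"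
  assumes "x \<in> affine hull (closed_segment a b)"
  shows "affine hull (closed_segment a b) = range (\<lambda>t. x + t *\<^sub>R (b - a))"
proof -
  have r: "affine hull (closed_segment a b) = range (\<lambda>t. a + t *\<^sub>R (b - a))"
    using affine_hull_2_alt[of a b] by (simp add: affine_hull_closed_segment)
  then obtain t0 where x: "x = a + t0 *\<^sub>R (b - a)" using assms by blast
  have "range (\<lambda>t. x + t *\<^sub>R (b - a)) = range (\<lambda>t. a + t *\<^sub>R (b - a))"
  proof (intro subset_antisym subsetI)
    fix y assume "y \<in> range (\<lambda>t. x + t *\<^sub>R (b - a))"
    then obtain t where "y = x + t *\<^sub>R (b - a)" by blast
    then have "y = a + (t0 + t) *\<^sub>R (b - a)" by (simp add: x algebra_simps)
    then show "y \<in> range (\<lambda>t. a + t *\<^sub>R (b - a))" by blast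
  next
    fix y assume "y \<in> range (\<lambda>t. a + t *\<^sub>R (b - a))"
    then obtain t where "y = a + t *\<^sub>R (b - a)" by blast
    then have "y = x + (t - t0) *\<^sub>R (b - a)" by (simp add: x algebra_simps)
    then show "y \<in> range (\<lambda>t. x + t *\<^sub>R (b - a))" by blast
  qed
  then show ?thesis using r by simp
qed

text \<open>The end at which a walk from \<open>a\<close> to \<open>b\<close> enters the
  edge.\<close>

definition first_end :: "plane \<Rightarrow> plane \<Rightarrow> plane set \<Rightarrow> plane" where
  "first_end a b e = (if (b - a) \<bullet> src e < (b - a) \<bullet> dst e then src e else dst e)"

definition other_end :: "plane set \<Rightarrow> plane \<Rightarrow> plane" where
  "other_end e v = (if src e = v then dst e else src e)"

section \<open>Edges along segments, l-edges and their flows\<close>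

context partition
begin

lemma other_end:
  assumes "e \<in> E" "v \<in> e" "v \<in> V"
  shows "e = closed_segment v (other_end e v)" "other_end e v \<in> V" "other_end e v \<noteq> v" "e - V
      = open_segment v (other_end e v)"
    "v = src e \<and> other_end e v = dst e \<or> v = dst e \<and> other_end e v = src e"
proof -
  have "v \<in> e \<inter> V" using assms by blast
  then have "v = src e \<or> v = dst e" using edge(3)[OF assms(1)] by auto
  then show *: "v = src e \<and> other_end e v = dst e \<or> v = dst e \<and> other_end e v = src e"
    using edge(1)[OF assms(1)] by (auto simp: other_end_def)
  have "closed_segment v (other_end e v) = closed_segment (src e) (dst e)"
    unfolding other_end_def using * by (auto simp: closed_segment_commute)
  then show "e = closed_segment v (other_end e v)" using edge(2)[OF assms(1)]
      by (rule trans[OF _ sym, symmetric])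
  show "other_end e v \<in> V" using * edge_ends[OF assms(1)] by auto
  show "other_end e v \<noteq> v" using * edge(1)[OF assms(1)] by auto
  have "open_segment v (other_end e v) = open_segment (src e) (dst e)"
    unfolding other_end_def using * by (auto simp: open_segment_commute)
  then show "e - V = open_segment v (other_end e v)" using open_edge[OF assms(1)] by (simp only:)
qed

text \<open>A point of the segment close enough to \<open>v\<close> can only lie on edges that
  contain \<open>v\<close>. Such an edge points towards \<open>b\<close>, and it cannot run past
  \<open>b\<close>, as \<open>b\<close> would then be a vertex inside it.\<close>

lemma next_edge_exists:
  assumes v: "v \<in> V" and b: "b \<in> V" and vb: "v \<noteq> b" and seg: "closed_segment v b \<subseteq> \<Union>Ei"
  shows "\<exists>e\<in>Ei. v \<in> e \<and> e \<subseteq> closed_segment v b"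
proof -
  let ?F = "\<Union>{e\<in>Ei. v \<notin> e}"
  have "closed ?F" using fin_Ei closed_edge EiD by (intro closed_Union) auto
  then have "open (- ?F)" by (rule open_Compl)
  moreover have "v \<in> - ?F" by blast
  ultimately obtain r where r: "r > 0" "ball v r \<subseteq> - ?F" by (meson openE)
  define t where "t = min 1 (r / (2 * norm (b - v)))"
  have nb: "norm (b - v) > 0" using vb by simp
  have t: "0 < t" "t \<le> 1" using r(1) nb by (auto simp: t_def)
  have "t * norm (b - v) \<le> r / (2 * norm (b - v)) * norm (b - v)"
    using nb by (intro mult_right_mono) (auto simp: t_def)
  also have "\<dots> < r" using nb r(1) by simp
  finally have "v + t *\<^sub>R (b - v) \<in> ball v r" using t by (simp add: dist_norm)
  moreover have x: "v + t *\<^sub>R (b - v) \<in> closed_segment v b"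
    unfolding closed_segment_param[OF vb] using t by simp
  ultimately obtain e where e: "e \<in> Ei" "v + t *\<^sub>R (b - v) \<in> e" "v \<in> e" using seg r(2) by blast
  define q where "q = other_end e v"
  note o = other_end[OF EiD[OF e(1)] e(3) v, folded q_def]
  obtain s where s: "0 \<le> s" "t *\<^sub>R (b - v) = s *\<^sub>R (q - v)"
  proof -
    have "v + t *\<^sub>R (b - v) \<in> closed_segment v q" using e(2) o(1) by blast
    then obtain s where "0 \<le> s" "v + t *\<^sub>R (b - v) = (1 - s) *\<^sub>R v + s *\<^sub>R q" unfolding in_segment
        by blast
    moreover have "(1 - s) *\<^sub>R v + s *\<^sub>R q = v + s *\<^sub>R (q - v)" by (simp add: algebra_simps)
    ultimately have "t *\<^sub>R (b - v) = s *\<^sub>R (q - v)" by simp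
    then show thesis using that \<open>0 \<le> s\<close> by blast
  qed
  have s0: "s > 0"
  proof (rule ccontr)
    assume "\<not> s > 0"
    then have "s = 0" using s(1) by simp
    then show False using s(2) t vb by simp
  qed
  define \<kappa> where "\<kappa> = t / s"
  have \<kappa>: "\<kappa> > 0" using t s0 by (simp add: \<kappa>_def)
  have "s *\<^sub>R (q - v) = s *\<^sub>R (\<kappa> *\<^sub>R (b - v))" using s(2) s0 by (simp add: \<kappa>_def)
  then have qv: "q - v = \<kappa> *\<^sub>R (b - v)" using s0 by (metis less_irrefl scaleR_left_imp_eq)
  have "\<kappa> \<le> 1"
  proof (rule ccontr)
    assume k: "\<not> \<kappa> \<le> 1"
    have "b = v + (1 / \<kappa>) *\<^sub>R (q - v)" using \<kappa> by (simp add: qv)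
    moreover have "v + (1 / \<kappa>) *\<^sub>R (q - v) \<in> open_segment v q"
      unfolding open_segment_param[OF o(3)[symmetric]] using k \<kappa> by simp
    ultimately have "b \<in> e - V" using o(4) by simp
    then show False using b by blast
  qed
  then have "v + \<kappa> *\<^sub>R (b - v) \<in> closed_segment v b" unfolding closed_segment_param[OF vb] using \<kappa>
      by simp
  moreover have "q = v + \<kappa> *\<^sub>R (b - v)" using qv by (metis diff_add_cancel add.commute)
  ultimately have "q \<in> closed_segment v b" by (simp only:)
  then have "closed_segment v q \<subseteq> closed_segment v b" by (simp add: subset_closed_segment)
  then show ?thesis using e o(1) by blast
qed

text \<open>Two edges that leave \<open>v\<close> in the same direction share a point that is not a
  vertex.\<close>

lemma next_edge_unique:
  assumes v: "v \<in> V" and vb: "v \<noteq> b" and e: "e \<in> E" "v \<in> e" "e \<subseteq> closed_segment v b"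
    and e': "e' \<in> E" "v \<in> e'" "e' \<subseteq> closed_segment v b"
  shows "e = e'"
proof (rule ccontr)
  assume ne: "e \<noteq> e'"
  have *: "\<exists>\<kappa>>0. other_end e v = v + \<kappa> *\<^sub>R (b - v)" if e: "e \<in> E" "v \<in> e" "e \<subseteq> closed_segment v b"
      for e
  proof -
    have "other_end e v \<in> closed_segment v b" using other_end(1)[OF e(1,2) v] e(3) by blast
    then obtain k where k: "0 \<le> k" "other_end e v = (1 - k) *\<^sub>R v + k *\<^sub>R b" unfolding in_segment
        by blast
    then have eq: "other_end e v = v + k *\<^sub>R (b - v)" by (simp add: algebra_simps)
    then have "k \<noteq> 0" using other_end(3)[OF e(1,2) v] by auto
    then show ?thesis using k(1) eq by (intro exI[of _ k]) auto
  qed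
  obtain k where k: "k > 0" "other_end e v = v + k *\<^sub>R (b - v)" using *[OF e] by blast
  obtain k' where k': "k' > 0" "other_end e' v = v + k' *\<^sub>R (b - v)" using *[OF e'] by blast
  \<comment> \<open>Half of the shorter length: a parameter strictly inside both edges.\<close>
  define m where "m = min k k' / 2"
  have m: "0 < m" "m < k" "m < k'" using k(1) k'(1) by (auto simp: m_def)
  have in_e: "v + m *\<^sub>R (b - v) \<in> e - V" if e: "e \<in> E" "v \<in> e" and k: "other_end e v = v
      + k *\<^sub>R (b - v)" "m < k" for e k
  proof -
    have "v + m *\<^sub>R (b - v) = v + (m / k) *\<^sub>R (other_end e v - v)" using m(1) k by simp
    also have "\<dots> \<in> open_segment v (other_end e v)"
      unfolding open_segment_param[OF other_end(3)[OF e v, symmetric]] using m(1) k(2) by simp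
    finally show ?thesis using other_end(4)[OF e v] by simp
  qed
  show False using in_e[OF e(1,2) k(2) m(2)] in_e[OF e'(1,2) k'(2) m(3)] edges_meet[OF e(1) e'(1)
      ne] by blast
qed

text \<open>Every vertex of the segment except the last starts exactly one edge. This gives the
  count of edges, and, read in both directions, the balance of a unit flow along the
  segment.\<close>

lemma first_end_bij:
  assumes ab: "a \<in> V" "b \<in> V" "a \<noteq> b" and seg: "closed_segment a b \<subseteq> \<Union>Ei"
  shows "bij_betw (first_end a b) {e\<in>Ei. e \<subseteq> closed_segment a b} (V \<inter> closed_segment a b - {b})"
proof -
  have pos: "(b - a) \<bullet> (b - a) > 0" using ab(3) by simp
  have sub_end: "closed_segment v b \<subseteq> closed_segment a b" if "v \<in> closed_segment a b" for v
    using that by (simp add: subset_closed_segment)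
  have char: "first_end a b e \<in> V \<inter> closed_segment a b - {b} \<and> first_end a b e \<in> e \<and> e
      \<subseteq> closed_segment (first_end a b e) b"
    if e: "e \<in> Ei" "e \<subseteq> closed_segment a b" for e
  proof -
    have eE: "e \<in> E" using e(1) by (rule EiD)
    define v where "v = first_end a b e"
    have v: "v \<in> V" "v \<in> e" using edge_ends[OF eE] by (auto simp: v_def first_end_def)
    note o = other_end[OF eE v(2,1)]
    have le: "(b - a) \<bullet> v \<le> (b - a) \<bullet> other_end e v"
      using o(5) edge(1)[OF eE] by (auto simp: v_def first_end_def split: if_splits)
    have vs: "v \<in> closed_segment a b" "other_end e v \<in> closed_segment a b" using v(2) e(2) o(1)
        by blast+
    obtain s where s: "0 \<le> s" "s \<le> 1" "v = a + s *\<^sub>R (b - a)"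
      using vs(1) by (auto simp: in_segment algebra_simps)
    obtain t where t: "0 \<le> t" "t \<le> 1" "other_end e v = a + t *\<^sub>R (b - a)"
      using vs(2) by (auto simp: in_segment algebra_simps)
    have "(b - a) \<bullet> v = (b - a) \<bullet> a + s * ((b - a) \<bullet> (b - a))"
      "(b - a) \<bullet> other_end e v = (b - a) \<bullet> a + t * ((b - a) \<bullet> (b - a))"
      by (subst s(3), simp add: inner_add_right) (subst t(3), simp add: inner_add_right)
    then have "s * ((b - a) \<bullet> (b - a)) \<le> t * ((b - a) \<bullet> (b - a))" using le by simp
    then have "s \<le> t" using pos by simp
    moreover have "s \<noteq> t" using o(3) s(3) t(3) by auto
    ultimately have st: "s < t" by simp
    have vb: "v \<noteq> b"
    proof
      assume "v = b"
      then have "(1 - s) *\<^sub>R (b - a) = 0" using s(3) by (auto simp: algebra_simps)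
      then show False using st t(2) ab(3) by simp
    qed
    have "other_end e v = v + ((t - s) / (1 - s)) *\<^sub>R (b - v)"
    proof -
      have "b - v = (1 - s) *\<^sub>R (b - a)" by (simp add: s(3) algebra_simps)
      then have "((t - s) / (1 - s)) *\<^sub>R (b - v) = (t - s) *\<^sub>R (b - a)" using st t(2) by simp
      moreover have "other_end e v = v + (t - s) *\<^sub>R (b - a)"
        by (subst t(3), subst s(3)) (simp add: algebra_simps)
      ultimately show ?thesis by (simp only:)
    qed
    also have "\<dots> \<in> closed_segment v b" unfolding closed_segment_param[OF vb] using st t(2) by simp
    finally have "closed_segment v (other_end e v) \<subseteq> closed_segment v b"
        by (simp add: subset_closed_segment)
    then have "e \<subseteq> closed_segment v b" using o(1) by blast
    then show ?thesis using v vs(1) vb unfolding v_def by blast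
  qed
  have conv: "first_end a b e = v" if e: "e \<in> Ei" "v \<in> e" "v \<in> V \<inter> closed_segment a b - {b}" "e
      \<subseteq> closed_segment v b" for e v
  proof -
    have "e \<subseteq> closed_segment a b" using e(3,4) sub_end by blast
    from char[OF e(1) this] have c: "first_end a b e \<in> e" "e
        \<subseteq> closed_segment (first_end a b e) b" "first_end a b e \<in> V" by auto
    have "v \<in> closed_segment (first_end a b e) b" "first_end a b e \<in> closed_segment v b" using c e
        by auto
    then have "dist v b \<le> dist (first_end a b e) b" "dist (first_end a b e) b \<le> dist v b"
      "dist (first_end a b e) v \<le> dist (first_end a b e) b"
      using dist_in_closed_segment by (metis dist_commute)+
    then have d: "dist v b = dist (first_end a b e) b" by simp
    obtain k where k: "0 \<le> k" "k \<le> 1" "first_end a b e = (1 - k) *\<^sub>R v + k *\<^sub>R b"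
      using \<open>first_end a b e \<in> closed_segment v b\<close> unfolding in_segment by blast
    then have "first_end a b e - b = (1 - k) *\<^sub>R (v - b)" by (simp add: algebra_simps)
    then have "norm (v - b) = (1 - k) * norm (v - b)" using d k(2) by (simp add: dist_norm)
    moreover have "norm (v - b) > 0" using e(3) by auto
    ultimately have "k = 0" by simp
    then show ?thesis using k(3) by simp
  qed
  show ?thesis
  proof (rule bij_betwI')
    fix e e' assume "e \<in> {e\<in>Ei. e \<subseteq> closed_segment a b}" "e' \<in> {e\<in>Ei. e \<subseteq> closed_segment a b}"
    then have e: "e \<in> Ei" "e \<subseteq> closed_segment a b" and e': "e' \<in> Ei" "e' \<subseteq> closed_segment a b"
        by auto
    show "first_end a b e = first_end a b e' \<longleftrightarrow> e = e'"
    proof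
      assume eq: "first_end a b e = first_end a b e'"
      show "e = e'"
        using next_edge_unique[of "first_end a b e" b e e'] char[OF e] char[OF e'] EiD[OF e(1)]
            EiD[OF e'(1)]
        unfolding eq by blast
    qed simp
  next
    show "first_end a b e \<in> V \<inter> closed_segment a b - {b}" if "e \<in> {e\<in>Ei. e \<subseteq> closed_segment a b}"
        for e
      using char that by blast
  next
    fix v assume v: "v \<in> V \<inter> closed_segment a b - {b}"
    then have "closed_segment v b \<subseteq> closed_segment a b" using sub_end by blast
    then obtain e where e: "e \<in> Ei" "v \<in> e" "e \<subseteq> closed_segment v b"
      using next_edge_exists[of v b] v ab(2) seg by blast
    then have "v = first_end a b e" using conv v by metis
    then show "\<exists>e\<in>{e\<in>Ei. e \<subseteq> closed_segment a b}. v = first_end a b e" using e sub_end v by blast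
  qed
qed

text \<open>The ends of a chain are vertices: an extreme point of the segment cannot lie strictly
  inside an edge contained in the segment.\<close>

lemma chainD:
  assumes "edge_chain D E s"
  obtains a b where "a \<noteq> b" "s = closed_segment a b" "open_segment a b \<subseteq> D" "a \<in> V" "b \<in> V" "s
      \<subseteq> \<Union>Ei"
proof -
  obtain a b where ab: "a \<noteq> b" "s = closed_segment a b" "open_segment a b \<subseteq> D"
    using assms unfolding edge_chain_def by blast
  obtain F where F: "F \<subseteq> Ei" "s = \<Union>F" using assms unfolding edge_chain_def by blast
  have V: "x \<in> V" if x: "x = a \<or> x = b" for x
  proof (rule ccontr)
    assume "x \<notin> V"
    have "x \<in> s" using x ab(2) by auto
    then obtain e where e: "e \<in> F" "x \<in> e" using F(2) by blast
    then have eE: "e \<in> E" using F(1) EiD by blast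
    then have "x \<in> open_segment (src e) (dst e)" using e(2) \<open>x \<notin> V\<close> open_edge by blast
    moreover have "src e \<in> s" "dst e \<in> s" using edge_ends[OF eE] e F(2) by blast+
    moreover have "x extreme_point_of s" using x unfolding ab(2) extreme_point_of_segment .
    ultimately show False unfolding extreme_point_of_def by blast
  qed
  show thesis using that[OF ab V V] F by blast
qed

lemma edge_is_chain: "e \<in> Ei \<Longrightarrow> edge_chain D E e"
  unfolding edge_chain_def
proof
  assume e: "e \<in> Ei"
  note eE = EiD[OF e]
  have "open_segment (src e) (dst e) \<subseteq> D" using open_edge_sub_D[OF e] open_edge[OF eE] by simp
  then show "\<exists>a b. a \<noteq> b \<and> e = closed_segment a b \<and> open_segment a b \<subseteq> D"
    using edge(1,2)[OF eE] by blast
  show "\<exists>F\<subseteq>Ei. e = \<Union>F" using e by (intro exI[of _ "{e}"]) auto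
qed

lemma finite_chains: "finite {s. edge_chain D E s}"
proof (rule finite_subset)
  show "{s. edge_chain D E s} \<subseteq> Union ` Pow Ei" unfolding edge_chain_def by blast
  show "finite (Union ` Pow Ei)" using fin_Ei by simp
qed

lemma finite_l_edges: "finite (l_edges D E)"
  by (rule finite_subset[OF _ finite_chains]) (auto simp: l_edges_def)

lemma l_edge_chain: "s \<in> l_edges D E \<Longrightarrow> edge_chain D E s"
  by (simp add: l_edges_def)

lemma l_edge_exists:
  assumes "edge_chain D E s"
  shows "\<exists>s'\<in>l_edges D E. s \<subseteq> s'"
proof -
  obtain m where "m \<in> {s. edge_chain D E s}" "s \<le> m" "\<forall>b\<in>{s. edge_chain D E s}. m \<le> b \<longrightarrow> b = m"
    using finite_has_maximal2[OF finite_chains, of s] assms by blast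
  then show ?thesis unfolding l_edges_def by (intro bexI[of _ m]) auto
qed

text \<open>Both segments are parametrized on their common line from \<open>x\<close>, so their
  union is again a segment. That \<open>x\<close> lies in \<open>D\<close> keeps the interior of the
  union in \<open>D\<close> even if both segments end at \<open>x\<close>.\<close>

lemma chain_union:
  assumes s: "edge_chain D E s" and s': "edge_chain D E s'" and x: "x \<in> s" "x \<in> s'" "x \<in> D"
    and hull: "affine hull s = affine hull s'"
  shows "edge_chain D E (s \<union> s')"
proof -
  obtain a b where ab: "a \<noteq> b" "s = closed_segment a b" "open_segment a b \<subseteq> D"
      by (rule chainD[OF s])
  obtain a' b' where ab': "a' \<noteq> b'" "s' = closed_segment a' b'" "open_segment a' b' \<subseteq> D"
      by (rule chainD[OF s'])
  let ?u = "b - a"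
  let ?f = "\<lambda>t. x + t *\<^sub>R ?u"
  have u: "?u \<noteq> 0" using ab by simp
  have r: "affine hull s = range ?f"
    unfolding ab(2) by (rule affine_hull_segment_range) (use x(1) ab(2) hull_inc in metis)
  obtain \<alpha> \<beta> where A: "\<alpha> \<le> 0" "0 \<le> \<beta>" "\<alpha> < \<beta>" "s = ?f ` {\<alpha>..\<beta>}" "open_segment a b = ?f ` {\<alpha><..<\<beta>}"
    using segment_param_on_line[OF ab(1,2) u _ x(1)] r by blast
  obtain \<alpha>' \<beta>' where A': "\<alpha>' \<le> 0" "0 \<le> \<beta>'" "\<alpha>' < \<beta>'" "s' = ?f ` {\<alpha>'..\<beta>'}" "open_segment a' b'
      = ?f ` {\<alpha>'<..<\<beta>'}"
    using segment_param_on_line[OF ab'(1,2) u _ x(2)] r hull by blast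
  let ?m = "min \<alpha> \<alpha>'" and ?M = "max \<beta> \<beta>'"
  have mM: "?m < ?M" using A A' by linarith
  have "{\<alpha>..\<beta>} \<union> {\<alpha>'..\<beta>'} = {?m..?M}" using A A' by auto
  then have "s \<union> s' = ?f ` {?m..?M}" using A(4) A'(4) by (metis image_Un)
  then have "s \<union> s' = closed_segment (?f ?m) (?f ?M)" using segment_on_line[of ?m ?M x ?u] mM
      by simp
  moreover have "?f ?m \<noteq> ?f ?M" using mM u by auto
  moreover have "open_segment (?f ?m) (?f ?M) \<subseteq> D"
  proof -
    have "?f t \<in> D" if t: "t \<in> {?m<..<?M}" for t
    proof -
      \<comment> \<open>The case of \<open>x\<close> itself is separate because \<open>x\<close> may
        be an end point of both segments.\<close>
      consider "t = 0" | "t \<in> {\<alpha><..<\<beta>}" | "t \<in> {\<alpha>'<..<\<beta>'}" using t A(1,2) A'(1,2) by fastforce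
      then show ?thesis
      proof cases
        case 1
        then show ?thesis using x(3) by simp
      next
        case 2
        then show ?thesis using A(5) ab(3) by blast
      next
        case 3
        then show ?thesis using A'(5) ab'(3) by blast
      qed
    qed
    then show ?thesis using open_segment_on_line[OF mM u, of x] by auto
  qed
  moreover have "\<exists>F\<subseteq>Ei. s \<union> s' = \<Union>F"
  proof -
    obtain F F' where "F \<subseteq> Ei" "s = \<Union>F" "F' \<subseteq> Ei" "s' = \<Union>F'"
      using s s' unfolding edge_chain_def by blast
    then show ?thesis by (intro exI[of _ "F \<union> F'"]) auto
  qed
  ultimately show ?thesis unfolding edge_chain_def by blast
qed

text \<open>The union of the two would be a longer chain. At a boundary point this fails, since
  l-edges stop there even if they continue collinearly.\<close>

lemma l_edge_unique:
  assumes "s \<in> l_edges D E" "s' \<in> l_edges D E" "x \<in> s" "x \<in> s'" "x \<in> D" "affine hull s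
      = affine hull s'"
  shows "s = s'"
proof -
  have "edge_chain D E (s \<union> s')"
    by (rule chain_union) (use assms l_edge_chain in auto)
  then show ?thesis using assms(1,2) unfolding l_edges_def by blast
qed

lemma hull_edge_in_segment:
  assumes "e \<in> E" "s = closed_segment a b" "e \<subseteq> s" "a \<noteq> b"
  shows "affine hull e = affine hull s"
proof -
  have e: "src e \<in> s" "dst e \<in> s" using edge_ends[OF assms(1)] assms(3) by blast+
  have r: "affine hull s = range (\<lambda>t. src e + t *\<^sub>R (b - a))"
    unfolding assms(2) by (rule affine_hull_segment_range) (use e(1) assms(2) hull_inc in metis)
  have "dst e \<in> affine hull s" using e(2) by (rule hull_inc)
  then obtain k where k: "dst e = src e + k *\<^sub>R (b - a)" unfolding r by (elim rangeE)
  have k0: "k \<noteq> 0" using k edge(1)[OF assms(1)] by auto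
  have "affine hull e = affine hull (closed_segment (src e) (dst e))" using edge(2)[OF assms(1)]
      by (rule arg_cong)
  also have "\<dots> = range (\<lambda>t. src e + t *\<^sub>R (dst e - src e))"
    by (rule affine_hull_segment_range) (simp add: hull_inc)
  also have "\<dots> = range (\<lambda>t. src e + t *\<^sub>R (b - a))"
  proof (intro subset_antisym subsetI)
    fix y assume "y \<in> range (\<lambda>t. src e + t *\<^sub>R (dst e - src e))"
    then obtain t where "y = src e + (t * k) *\<^sub>R (b - a)" by (auto simp: k)
    then show "y \<in> range (\<lambda>t. src e + t *\<^sub>R (b - a))" by blast
  next
    fix y assume "y \<in> range (\<lambda>t. src e + t *\<^sub>R (b - a))"
    then obtain t where "y = src e + t *\<^sub>R (b - a)" by blast
    then have "y = src e + (t / k) *\<^sub>R (dst e - src e)" using k0 by (simp add: k)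
    then show "y \<in> range (\<lambda>t. src e + t *\<^sub>R (dst e - src e))" by blast
  qed
  finally show ?thesis using r by simp
qed

lemma l_edge_hull:
  assumes "s \<in> l_edges D E" "e \<in> Ei" "e \<subseteq> s"
  shows "affine hull e = affine hull s"
proof -
  obtain a b where "a \<noteq> b" "s = closed_segment a b" by (rule chainD[OF l_edge_chain[OF assms(1)]])
  then show ?thesis using hull_edge_in_segment[OF EiD[OF assms(2)]] assms(3) by blast
qed

lemma l_edge_edge_at:
  assumes "s \<in> l_edges D E" "x \<in> s"
  shows "\<exists>e\<in>Ei. x \<in> e \<and> e \<subseteq> s"
proof -
  obtain F where "F \<subseteq> Ei" "s = \<Union>F" using l_edge_chain[OF assms(1)] unfolding edge_chain_def by blast
  then show ?thesis using assms(2) by blast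
qed

text \<open>Each interior edge extends to an l-edge, and only to one, since its relative interior
  lies in \<open>D\<close>.\<close>

lemma card_edges_by_l_edges: "card Ei = (\<Sum>s\<in>l_edges D E. card {e\<in>Ei. e \<subseteq> s})"
proof -
  have un: "Ei = (\<Union>s\<in>l_edges D E. {e\<in>Ei. e \<subseteq> s})"
    using l_edge_exists[OF edge_is_chain] by blast
  have disj: "{e\<in>Ei. e \<subseteq> s} \<inter> {e\<in>Ei. e \<subseteq> s'} = {}" if "s \<in> l_edges D E" "s' \<in> l_edges D E" "s \<noteq> s'"
      for s s'
  proof (rule ccontr)
    assume "{e\<in>Ei. e \<subseteq> s} \<inter> {e\<in>Ei. e \<subseteq> s'} \<noteq> {}"
    then obtain e where e: "e \<in> Ei" "e \<subseteq> s" "e \<subseteq> s'" by blast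
    have "open_segment (src e) (dst e) \<noteq> {}" using edge(1)[OF EiD[OF e(1)]] by simp
    then obtain x where "x \<in> e" "x \<in> D" using open_edge[OF EiD[OF e(1)]] open_edge_sub_D[OF e(1)]
        by blast
    then show False using l_edge_unique[OF that(1,2), of x] l_edge_hull[OF that(1) e(1,2)]
        l_edge_hull[OF that(2) e(1,3)] e that(3) by auto
  qed
  have "card (\<Union>s\<in>l_edges D E. {e\<in>Ei. e \<subseteq> s}) = (\<Sum>s\<in>l_edges D E. card {e\<in>Ei. e \<subseteq> s})"
    using finite_l_edges fin_Ei disj by (intro card_UN_disjoint) auto
  then show ?thesis using un by simp
qed

lemma directions_bij:
  assumes "A \<in> Vi"
  shows "bij_betw (\<lambda>s. affine hull s) {s\<in>l_edges D E. A \<in> s} {affine hull e | e. e \<in> E \<and> A \<in> e}"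
proof (rule bij_betwI')
  have AD: "A \<in> D" using assms by (simp add: Vi_eq)
  show "affine hull s = affine hull s' \<longleftrightarrow> s = s'"
    if "s \<in> {s\<in>l_edges D E. A \<in> s}" "s' \<in> {s\<in>l_edges D E. A \<in> s}" for s s'
    using l_edge_unique[of s s' A] that AD by blast
  show "affine hull s \<in> {affine hull e | e. e \<in> E \<and> A \<in> e}" if s: "s \<in> {s\<in>l_edges D E. A \<in> s}" for s
  proof -
    obtain e where "e \<in> Ei" "A \<in> e" "e \<subseteq> s" using l_edge_edge_at[of s A] s by blast
    then have "affine hull s = affine hull e \<and> e \<in> E \<and> A \<in> e" using l_edge_hull[of s e] EiD s
        by auto
    then show ?thesis by blast
  qed
  show "\<exists>s\<in>{s\<in>l_edges D E. A \<in> s}. h = affine hull s" if h: "h \<in> {affine hull e | e. e \<in> E \<and> A \<in> e}"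
      for h
  proof -
    obtain e where e: "e \<in> E" "A \<in> e" "h = affine hull e" using h by blast
    have "e \<in> Ei" using edge_at_D e AD by blast
    then obtain s where "s \<in> l_edges D E" "e \<subseteq> s" using l_edge_exists[OF edge_is_chain] by blast
    then show ?thesis using l_edge_hull[OF _ \<open>e \<in> Ei\<close>] e by blast
  qed
qed

lemma card_l_edges_at: "A \<in> Vi \<Longrightarrow> card {s\<in>l_edges D E. A \<in> s} = num_directions E A"
  using bij_betw_same_card[OF directions_bij] by (simp add: num_directions_def)

text \<open>A chain has one more vertex than edges. Its vertices are the interior ones together with
  the end points on the boundary, and there are 2, 1 or 0 of the latter.\<close>

lemma l_edge_euler:
  assumes s: "s \<in> l_edges D E"
  shows "int (card {e\<in>Ei. e \<subseteq> s}) - int (card (Vi \<inter> s))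
    = of_bool (s \<in> cross_cuts D E) - of_bool (s \<in> truncated_l_edges D E)"
proof -
  obtain a b where ab: "a \<noteq> b" "s = closed_segment a b" "open_segment a b \<subseteq> D" "a \<in> V" "b \<in> V" "s
      \<subseteq> \<Union>Ei"
    by (rule chainD[OF l_edge_chain[OF s]])
  have "card {e\<in>Ei. e \<subseteq> s} = card (V \<inter> s - {b})"
    using bij_betw_same_card[OF first_end_bij[OF ab(4,5,1)]] ab(2,6) by simp
  moreover have "b \<in> V \<inter> s" "finite (V \<inter> s)" using ab fin_V by auto
  ultimately have c1: "int (card {e\<in>Ei. e \<subseteq> s}) = int (card (V \<inter> s)) - 1"
    using card.remove[of "V \<inter> s" b] by simp
  have split: "V \<inter> s = (Vi \<inter> s) \<union> ({a, b} \<inter> frontier D)"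
  proof -
    have "x \<in> D \<or> x \<in> frontier D" if "x \<in> V" for x using that V_sub E_sub closure_D_cases by blast
    moreover have "x \<in> D" if "x \<in> s" "x \<noteq> a" "x \<noteq> b" for x
      using that ab(2,3) by (auto simp: open_segment_def)
    ultimately show ?thesis using ab by (auto simp: Vi_eq)
  qed
  have "(Vi \<inter> s) \<inter> ({a, b} \<inter> frontier D) = {}" using D_frontier by (auto simp: Vi_eq)
  then have c2: "card (V \<inter> s) = card (Vi \<inter> s) + card ({a, b} \<inter> frontier D)"
    unfolding split using fin_V by (intro card_Un_disjoint) (auto simp: Vi_eq)
  have cross: "s \<in> cross_cuts D E \<longleftrightarrow> a \<in> frontier D \<and> b \<in> frontier D"
    using s unfolding cross_cuts_def ab(2) by (auto simp: doubleton_eq_iff)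
  have trunc: "s \<in> truncated_l_edges D E \<longleftrightarrow> a \<notin> frontier D \<and> b \<notin> frontier D"
    using s unfolding truncated_l_edges_def ab(2) by (auto simp: doubleton_eq_iff)
  show ?thesis unfolding c1 c2 cross trunc using ab(1) by (simp add: Int_insert_left)
qed

text \<open>Incidences of interior vertices with l-edges are counted in two ways; at a vertex their
  number is the number of directions.\<close>

lemma card_interior_edges:
  "int (card Ei) = int (card (cross_cuts D E)) - int (card (truncated_l_edges D E))
     + (\<Sum>A\<in>Vi. int (num_directions E A))"
proof -
  have finVi: "finite Vi" using fin_V by (simp add: Vi_eq)
  have sumbool: "(\<Sum>s\<in>l_edges D E. of_bool (s \<in> X)) = int (card X)" if "X \<subseteq> l_edges D E" for X
    using that finite_l_edges by (simp add: sum.If_cases of_bool_def Int_absorb1)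
  have "int (card Ei) = (\<Sum>s\<in>l_edges D E. int (card {e\<in>Ei. e \<subseteq> s}))"
    by (simp add: card_edges_by_l_edges)
  also have "\<dots> = (\<Sum>s\<in>l_edges D E. int (card (Vi \<inter> s)) + (of_bool (s \<in> cross_cuts D E) - of_bool (s
      \<in> truncated_l_edges D E)))"
    using l_edge_euler by (intro sum.cong) (auto simp: algebra_simps)
  also have "\<dots> = (\<Sum>s\<in>l_edges D E. int (card (Vi \<inter> s))) + (int (card (cross_cuts D E)) - int (card
      (truncated_l_edges D E)))"
    using sumbool[of "cross_cuts D E"] sumbool[of "truncated_l_edges D E"]
    by (simp only: sum.distrib sum_subtractf) (auto simp: cross_cuts_def truncated_l_edges_def)
  also have "(\<Sum>s\<in>l_edges D E. int (card (Vi \<inter> s))) = (\<Sum>s\<in>l_edges D E. \<Sum>A\<in>Vi. of_bool (A \<in> s))"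
    using finVi by (intro sum.cong) (auto simp: sum.If_cases of_bool_def Int_def)
  also have "\<dots> = (\<Sum>A\<in>Vi. \<Sum>s\<in>l_edges D E. of_bool (A \<in> s))" by (rule sum.swap)
  also have "\<dots> = (\<Sum>A\<in>Vi. int (num_directions E A))"
    using finite_l_edges by (intro sum.cong) (auto simp: sum.If_cases of_bool_def Int_def
        card_l_edges_at[symmetric])
  finally show ?thesis by simp
qed

text \<open>A unit is sent from \<open>A\<close> along \<open>s\<close> to an end \<open>b\<close>
  on the boundary: at vertices in between inflow and outflow cancel, and \<open>b\<close> is not an
  interior vertex.\<close>

lemma unit_flow_to_boundary:
  assumes A: "A \<in> Vi" and s: "s \<in> l_edges D E" "A \<in> s" "s \<notin> truncated_l_edges D E"
  shows "\<exists>\<phi>. (\<forall>e\<in>Ei. \<phi> e \<noteq> 0 \<longrightarrow> e \<subseteq> s) \<and> (\<forall>v\<in>Vi. (\<Sum>e\<in>Ei. end_sign e v * \<phi> e) = (of_bool (v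
      = A) :: real))"
proof -
  obtain a0 b0 where ab0: "a0 \<noteq> b0" "s = closed_segment a0 b0" "a0 \<in> V" "b0 \<in> V" "s \<subseteq> \<Union>Ei"
    by (rule chainD[OF l_edge_chain[OF s(1)]])
  then obtain b where b: "b \<in> frontier D" "b \<in> V" "b \<in> s"
    using s(1,3) unfolding truncated_l_edges_def by blast
  have AV: "A \<in> V" "A \<in> D" using A by (auto simp: Vi_eq)
  have Ab: "A \<noteq> b" using AV(2) b(1) D_frontier by blast
  let ?S = "{e\<in>Ei. e \<subseteq> closed_segment A b}"
  have sub: "closed_segment A b \<subseteq> s" using s(2) b(3) unfolding ab0(2)
      by (simp add: subset_closed_segment)
  have seg: "closed_segment A b \<subseteq> \<Union>Ei" using sub ab0(5) by blast
  have bij1: "bij_betw (first_end A b) ?S (V \<inter> closed_segment A b - {b})"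
      by (rule first_end_bij[OF AV(1) b(2) Ab seg])
  have bij2: "bij_betw (first_end b A) ?S (V \<inter> closed_segment A b - {A})"
    using first_end_bij[OF b(2) AV(1) Ab[symmetric]] seg by (simp add: closed_segment_commute)
  have count: "(\<Sum>e\<in>?S. of_bool (f e = v)) = (of_bool (v \<in> T) :: real)" if "bij_betw f ?S T"
      for f T v
  proof -
    have "finite T" using that fin_Ei bij_betw_finite[OF that] by simp
    then show ?thesis using sum.reindex_bij_betw[OF that, of "\<lambda>x. of_bool (x = v)"]
      by (simp add: of_bool_def if_distrib cong: if_cong)
  qed
  \<comment> \<open>The sign compares the orientation of the edge with the direction from
    \<open>A\<close> to \<open>b\<close>.\<close>
  define \<phi> :: "plane set \<Rightarrow> real" where
    "\<phi> e = (if e \<subseteq> closed_segment A b then if first_end A b e = src e then 1 else -1 else 0)" for e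
  have "(\<Sum>e\<in>Ei. end_sign e v * \<phi> e) = of_bool (v = A)" if v: "v \<in> Vi" for v
  proof -
    have vb: "v \<noteq> b" using v b(1) D_frontier by (auto simp: Vi_eq)
    have "(\<Sum>e\<in>Ei. end_sign e v * \<phi> e) = (\<Sum>e\<in>?S. end_sign e v * \<phi> e)"
      using fin_Ei by (intro sum.mono_neutral_right) (auto simp: \<phi>_def)
    \<comment> \<open>\<open>first_end b A e\<close> is the end at which the walk from
      \<open>A\<close> to \<open>b\<close> leaves the edge, so every edge counts positively where it
      is entered and negatively where it is left.\<close>
    also have "\<dots> = (\<Sum>e\<in>?S. of_bool (first_end A b e = v) - of_bool (first_end b A e = v))"
    proof (rule sum.cong[OF refl])
      fix e assume e: "e \<in> ?S"
      note eE = EiD[of e]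
      have ne: "src e \<noteq> dst e" using edge(1) e eE by blast
      have "(b - A) \<bullet> src e \<noteq> (b - A) \<bullet> dst e"
      proof
        assume eq: "(b - A) \<bullet> src e = (b - A) \<bullet> dst e"
        have "src e \<in> closed_segment A b" "dst e \<in> closed_segment A b" using edge_ends[of e] e eE
            by blast+
        then obtain p q where p: "src e = A + p *\<^sub>R (b - A)" and q: "dst e = A + q *\<^sub>R (b - A)"
          by (auto simp: in_segment algebra_simps)
        have "(p - q) * ((b - A) \<bullet> (b - A)) = 0" using eq unfolding p q
            by (simp add: inner_add_right algebra_simps)
        then have "p = q" using Ab by simp
        then show False using p q ne by simp
      qed
      moreover have "(A - b) \<bullet> x = - ((b - A) \<bullet> x)" for x by (metis inner_minus_left minus_diff_eq)
      ultimately show "end_sign e v * \<phi> e = of_bool (first_end A b e = v) - of_bool (first_end b A e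
          = v)"
        using e ne by (auto simp: \<phi>_def end_sign_def first_end_def)
    qed
    also have "\<dots> = of_bool (v \<in> V \<inter> closed_segment A b - {b}) - of_bool (v
        \<in> V \<inter> closed_segment A b - {A})"
      by (simp only: sum_subtractf count[OF bij1] count[OF bij2])
    also have "\<dots> = of_bool (v = A)" using vb AV by auto
    finally show ?thesis .
  qed
  moreover have "\<forall>e\<in>Ei. \<phi> e \<noteq> 0 \<longrightarrow> e \<subseteq> s" using sub by (auto simp: \<phi>_def)
  ultimately show ?thesis by blast
qed

text \<open>Disjointness leaves at most one truncated l-edge at \<open>A\<close>, which explains the
  surplus 1 in the hypothesis. Different l-edges through the interior point \<open>A\<close> are not
  parallel, and all edges of one l-edge have proportional linear forms.\<close>

lemma flows_in_distinct_directions: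
  assumes A: "A \<in> Vi" and N: "num_directions E A \<ge> n + 1" and disj: "disjoint_truncated_l_edges D E"
  obtains I :: "plane set set" and u \<phi> where "finite I" "card I = n"
    "\<forall>s\<in>I. \<forall>s'\<in>I. s \<noteq> s' \<longrightarrow> det2 (u s) (u s') \<noteq> 0"
    "\<forall>s\<in>I. \<forall>v\<in>Vi. (\<Sum>e\<in>Ei. end_sign e v * \<phi> s e) = (of_bool (v = A) :: real)"
    "\<forall>s\<in>I. \<forall>e\<in>Ei. \<phi> s e \<noteq> 0 \<longrightarrow> (\<exists>c. \<forall>x. det2 (u s) (x - A) = c * edge_form e x)"
proof -
  have AD: "A \<in> D" using A by (simp add: Vi_eq)
  let ?L = "{s\<in>l_edges D E. A \<in> s}"
  let ?T = "{s\<in>truncated_l_edges D E. A \<in> s}"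
  have TL: "?T \<subseteq> ?L" by (auto simp: truncated_l_edges_def)
  have finL: "finite ?L" using finite_l_edges by simp
  then have finT: "finite ?T" using TL finite_subset by blast
  have "s = s'" if "s \<in> ?T" "s' \<in> ?T" for s s'
    using that disj unfolding disjoint_truncated_l_edges_def pairwise_def disjnt_def by blast
  then have "card ?T \<le> 1" using card_le_Suc0_iff_eq[OF finT] by auto
  then have "n \<le> card (?L - ?T)"
    using card_l_edges_at[OF A] N card_Diff_subset[OF finT TL] by simp
  then obtain I where I: "I \<subseteq> ?L - ?T" "card I = n" "finite I" by (rule obtain_subset_with_card_n)
  have "\<forall>s\<in>?L. \<exists>u. \<exists>a b. a \<noteq> b \<and> s = closed_segment a b \<and> u = b - a"
  proof
    fix s assume "s \<in> ?L"
    then have "edge_chain D E s" using l_edge_chain by blast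
    then obtain a b where "a \<noteq> b" "s = closed_segment a b" by (rule chainD)
    then show "\<exists>u. \<exists>a b. a \<noteq> b \<and> s = closed_segment a b \<and> u = b - a" by blast
  qed
  from bchoice[OF this] obtain u where u: "\<forall>s\<in>?L. \<exists>a b. a \<noteq> b \<and> s = closed_segment a b \<and> u s
      = b - a" by (rule exE)
  have hull: "affine hull s = range (\<lambda>t. A + t *\<^sub>R u s)" "u s \<noteq> 0" if s: "s \<in> ?L" for s
  proof -
    obtain a b where ab: "a \<noteq> b" "s = closed_segment a b" "u s = b - a" using u s by blast
    have "A \<in> closed_segment a b" using s ab(2) by blast
    then have "A \<in> affine hull closed_segment a b" by (rule hull_inc)
    from affine_hull_segment_range[OF this] show "affine hull s = range (\<lambda>t. A + t *\<^sub>R u s)"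
        using ab by simp
    show "u s \<noteq> 0" using ab by simp
  qed
  have "\<forall>s\<in>I. \<exists>\<phi>. (\<forall>e\<in>Ei. \<phi> e \<noteq> 0 \<longrightarrow> e \<subseteq> s) \<and> (\<forall>v\<in>Vi. (\<Sum>e\<in>Ei. end_sign e v * \<phi> e) = (of_bool (v
      = A) :: real))"
    using unit_flow_to_boundary[OF A] I(1) by blast
  from bchoice[OF this] obtain \<phi> where
    \<phi>: "\<forall>s\<in>I. (\<forall>e\<in>Ei. \<phi> s e \<noteq> 0 \<longrightarrow> e \<subseteq> s) \<and> (\<forall>v\<in>Vi. (\<Sum>e\<in>Ei. end_sign e v * \<phi> s e) = (of_bool (v
        = A) :: real))"
    by (rule exE)
  show thesis
  proof (rule that[of I u \<phi>]; (intro ballI impI)?)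
    fix s s' assume s: "s \<in> I" "s' \<in> I" "s \<noteq> s'"
    then have sL: "s \<in> ?L" "s' \<in> ?L" using I(1) by blast+
    show "det2 (u s) (u s') \<noteq> 0"
    proof
      assume "det2 (u s) (u s') = 0"
      then obtain c where c: "u s' = c *\<^sub>R u s" using det2_eq_0D hull(2)[OF sL(1)] by blast
      then have c0: "c \<noteq> 0" using hull(2)[OF sL(2)] by auto
      have "range (\<lambda>t. A + t *\<^sub>R u s) = range (\<lambda>t. A + t *\<^sub>R u s')"
      proof (intro subset_antisym subsetI)
        fix y assume "y \<in> range (\<lambda>t. A + t *\<^sub>R u s)"
        then obtain t where "y = A + t *\<^sub>R u s" by blast
        then have "y = A + (t / c) *\<^sub>R u s'" using c c0 by simp
        then show "y \<in> range (\<lambda>t. A + t *\<^sub>R u s')" by blast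
      next
        fix y assume "y \<in> range (\<lambda>t. A + t *\<^sub>R u s')"
        then obtain t where "y = A + (t * c) *\<^sub>R u s" by (auto simp: c)
        then show "y \<in> range (\<lambda>t. A + t *\<^sub>R u s)" by blast
      qed
      then have "affine hull s = affine hull s'" using hull(1) sL by simp
      then show False using l_edge_unique[of s s' A] sL AD s(3) by blast
    qed
  next
    fix s e assume s: "s \<in> I" and e: "e \<in> Ei" "\<phi> s e \<noteq> 0"
    have sL: "s \<in> ?L" using s I(1) by blast
    have es: "e \<subseteq> s" using \<phi> s e by blast
    have eE: "e \<in> E" using e(1) by (rule EiD)
    have "src e \<in> affine hull s" "dst e \<in> affine hull s" using es edge_ends[OF eE]
        by (auto intro: hull_inc)
    then obtain p q where p: "src e = A + p *\<^sub>R u s" and q: "dst e = A + q *\<^sub>R u s"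
        using hull(1)[OF sL] by blast
    have pq: "q - p \<noteq> 0" using edge(1)[OF eE] p q by auto
    have "edge_form e A = 0"
      by (simp add: line_form_def p q det2_diff det2_add algebra_simps flip: scaleR_diff_left) (simp
          add: det2_uminus)
    then have "edge_form e x = (q - p) * det2 (u s) (x - A)" for x
      unfolding line_form_shift[OF \<open>edge_form e A = 0\<close>] by (simp add: p q flip: scaleR_diff_left)
    then have "det2 (u s) (x - A) = (1 / (q - p)) * edge_form e x" for x using pq by simp
    then show "\<exists>c. \<forall>x. det2 (u s) (x - A) = c * edge_form e x" by blast
  qed (use I \<phi> in blast)+
qed

end

section \<open>Potentials of flows along edges\<close>

text \<open>The complex plane provides the logarithm and the characterization of simply connected
  open sets by their boundary.\<close>

definition to_complex :: "plane \<Rightarrow> complex" where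
  "to_complex x = Complex (x$1) (x$2)"

lemma to_complex_linear: "linear to_complex"
  by (rule linearI) (simp_all add: to_complex_def complex_eq_iff)

lemma to_complex_bij: "bij to_complex"
proof (rule bijI)
  show "inj to_complex" by (rule injI) (simp add: to_complex_def vec_eq_iff forall_2)
  have "to_complex (vector [Re z, Im z]) = z" for z by (simp add: to_complex_def)
  then show "surj to_complex" by (rule surjI)
qed

lemma to_complex_eq_iff [simp]: "to_complex x = to_complex y \<longleftrightarrow> x = y"
  using to_complex_bij by (meson bij_betw_imp_inj_on inj_eq)

lemma to_complex_diff: "to_complex x - to_complex y = to_complex (x - y)"
  using linear_diff[OF to_complex_linear] by metis

lemma open_to_complex: "open S \<Longrightarrow> open (to_complex ` S)"
  using to_complex_bij to_complex_linear by (simp add: bij_is_surj open_surjective_linear_image)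

lemma continuous_to_complex: "continuous_on S to_complex"
  by (rule linear_continuous_on_compose[OF continuous_on_id to_complex_linear])

lemma connected_to_complex: "connected S \<Longrightarrow> connected (to_complex ` S)"
  by (rule connected_continuous_image[OF continuous_to_complex])

lemma frontier_connected:
  fixes D :: "plane set"
  assumes "simply_connected D" "open D" "bounded D"
  shows "connected (frontier D)"
proof -
  have inj: "inj to_complex" using to_complex_bij by (rule bij_is_inj)
  have "D homeomorphic to_complex ` D"
    by (rule linear_homeomorphic_image[OF to_complex_linear inj])
  then have "simply_connected (to_complex ` D)" using assms(1) homeomorphic_simply_connected
      by blast
  moreover have "bounded (to_complex ` D)" using assms(3) to_complex_linear
    by (simp add: bounded_linear_image linear_conv_bounded_linear)
  ultimately have "connected (frontier (to_complex ` D))"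
    using simply_connected_eq_frontier_properties[OF open_to_complex[OF assms(2)]] by simp
  moreover have "frontier (to_complex ` D) = to_complex ` frontier D"
    using interior_open[OF assms(2)] interior_open[OF open_to_complex[OF assms(2)]]
      closure_injective_linear_image[OF to_complex_linear inj, of D]
    by (simp add: frontier_def image_set_diff[OF inj])
  ultimately have "connected (to_complex ` frontier D)" by simp
  moreover obtain g where g: "linear g" "g \<circ> to_complex = id"
    using linear_injective_left_inverse[OF to_complex_linear inj] by blast
  ultimately have "connected (g ` to_complex ` frontier D)"
    using connected_continuous_image[OF linear_continuous_on_compose[OF continuous_on_id g(1)]]
        by blast
  then show ?thesis using g(2) by (simp add: image_comp)
qed

text \<open>The sign of the imaginary part tells from which side of the edge the point
  \<open>x\<close> looks at it.\<close>

lemma Im_div_line_form: "to_complex a \<noteq> to_complex x \<Longrightarrow>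
  Im ((to_complex b - to_complex x) / (to_complex a - to_complex x))
      = line_form a b x / (cmod (to_complex a - to_complex x))\<^sup>2"
  by (simp add: Im_divide cmod_power2 line_form_def det2_def to_complex_def algebra_simps flip:
      power2_eq_square)

text \<open>For x = a + t (b - a) the ratio is (1 - t) / (-t), which is nonpositive exactly between
  the end points.\<close>

lemma ratio_pos_or_neg:
  assumes ab: "a \<noteq> b" and x: "x \<noteq> a" and l: "line_form a b x = 0"
  shows "\<exists>s. (to_complex b - to_complex x) / (to_complex a - to_complex x) = complex_of_real s \<and>
     (s \<le> 0 \<longleftrightarrow> x \<in> closed_segment a b) \<and> (x \<in> open_segment a b \<longrightarrow> s < 0)"
proof -
  obtain t where t: "x = a + t *\<^sub>R (b - a)" using line_form_0D[OF l ab] by blast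
  have t0: "t \<noteq> 0" using x t by auto
  have "to_complex b - to_complex x = of_real (1 - t) * to_complex (b - a)" "to_complex a -
      to_complex x = of_real (- t) * to_complex (b - a)"
    by (simp_all add: t to_complex_def complex_eq_iff algebra_simps)
  moreover have "to_complex (b - a) \<noteq> 0" using ab to_complex_diff[of b a]
      by (metis to_complex_eq_iff eq_iff_diff_eq_0)
  ultimately have "(to_complex b - to_complex x) / (to_complex a - to_complex x)
      = complex_of_real ((1 - t) / (- t))"
    by (simp only: of_real_divide) simp
  moreover have "(1 - t) / (- t) \<le> 0 \<longleftrightarrow> 0 \<le> t \<and> t \<le> 1"
    using t0 by (auto simp: divide_simps)
  moreover have "0 < t \<and> t < 1 \<Longrightarrow> (1 - t) / (- t) < 0" by (simp add: divide_simps)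
  ultimately show ?thesis
    unfolding t closed_segment_param[OF ab] open_segment_param[OF ab] by blast
qed

lemma not_nonpos_ratio:
  assumes "a \<noteq> b" "x \<notin> closed_segment a b"
  shows "(to_complex b - to_complex x) / (to_complex a - to_complex x) \<notin> \<real>\<^sub>\<le>\<^sub>0"
proof
  assume *: "(to_complex b - to_complex x) / (to_complex a - to_complex x) \<in> \<real>\<^sub>\<le>\<^sub>0"
  have xa: "x \<noteq> a" using assms by auto
  then have ne: "to_complex a \<noteq> to_complex x" by auto
  have "line_form a b x / (cmod (to_complex a - to_complex x))\<^sup>2 = 0"
    using * Im_div_line_form[OF ne, of b] by (simp add: complex_nonpos_Reals_iff)
  then have "line_form a b x = 0" using ne by simp
  from ratio_pos_or_neg[OF assms(1) xa this] show False
    using * assms(2) by auto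
qed

text \<open>For \<sigma> = 1 the imaginary part is the signed angle under which the segment from
  \<open>a\<close> to \<open>b\<close> is seen from \<open>z\<close>, with the branch cut along the
  segment. For \<sigma> = -1 the cut moves to the rest of the line, and the function continues
  across the segment.\<close>

definition log_ratio :: "complex \<Rightarrow> complex \<Rightarrow> complex \<Rightarrow> complex \<Rightarrow> complex" where
  "log_ratio \<sigma> a b z = Ln (\<sigma> * ((b - z) / (a - z)))"

lemma log_ratio_deriv:
  assumes "\<sigma> * ((b - z) / (a - z)) \<notin> \<real>\<^sub>\<le>\<^sub>0" "a - z \<noteq> 0" "b - z \<noteq> 0" "\<sigma> \<noteq> 0"
  shows "(log_ratio \<sigma> a b has_field_derivative (1 / (a - z) - 1 / (b - z))) (at z)"
proof -
  have "((\<lambda>z. \<sigma> * ((b - z) / (a - z))) has_field_derivative \<sigma> * (((0 - 1) * (a - z) - (b - z) * (0 -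
      1)) / ((a - z) * (a - z)))) (at z)"
    using assms(2) by (intro DERIV_cmult DERIV_divide derivative_intros) auto
  from DERIV_chain2[OF has_field_derivative_Ln[OF assms(1)] this]
  have "(log_ratio \<sigma> a b has_field_derivative inverse (\<sigma> * ((b - z) / (a - z))) * (\<sigma> * (((0 - 1) *
      (a - z) - (b - z) * (0 - 1)) / ((a - z) * (a - z))))) (at z)"
    unfolding log_ratio_def[abs_def] .
  moreover have "inverse (\<sigma> * ((b - z) / (a - z))) * (\<sigma> * (((0 - 1) * (a - z) - (b - z) * (0 - 1)) /
      ((a - z) * (a - z))))
     = 1 / (a - z) - 1 / (b - z)"
  proof -
    have "inverse (\<sigma> * (p / q)) * (\<sigma> * (((0 - 1) * q - p * (0 - 1)) / (q * q))) = 1 / q - 1 / p"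
      if "p \<noteq> 0" "q \<noteq> 0" for p q :: complex
      using that assms(4) by (simp add: field_simps)
    then show ?thesis using assms(2,3) by blast
  qed
  ultimately show ?thesis by simp
qed

section \<open>From balanced flows to potentials on the cells\<close>

context partition
begin

abbreviation Eb where "Eb \<equiv> {e\<in>E. e \<subseteq> frontier D}"

lemma E_split: "E = Ei \<union> Eb" "Ei \<inter> Eb = {}"
  by (auto simp: interior_edges_def)

lemma sum_end_sign:
  assumes "e \<in> E" "finite W" "V \<subseteq> W"
  shows "(\<Sum>v\<in>W. end_sign e v * h v) = h (src e) - h (dst e)"
proof -
  have "(\<Sum>v\<in>W. end_sign e v * h v) = (\<Sum>v\<in>W. (if src e = v then h v else 0) - (if dst e
      = v then h v else 0))"
    using edge(1)[OF assms(1)] by (intro sum.cong) (auto simp: end_sign_def)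
  then show ?thesis using assms edge_ends[OF assms(1)] by (simp add: sum_subtractf subset_eq)
qed

text \<open>The derivative of the sum, regrouped by vertices, has the net flow out of v as the
  coefficient of 1 / (v - z), so it vanishes. The branches enter only through the requirement that
  no cut meets \<open>U\<close>.\<close>

lemma locally_constant_potential:
  fixes w :: "plane set \<Rightarrow> real" and \<sigma> :: "plane set \<Rightarrow> complex"
  assumes flow: "\<And>v. v \<in> V \<Longrightarrow> (\<Sum>e\<in>E. end_sign e v * w e) = 0"
    and U: "open U" "connected U"
    and \<sigma>: "\<And>e. e \<in> E \<Longrightarrow> \<sigma> e \<noteq> 0"
      "\<And>e x. e \<in> E \<Longrightarrow> x \<in> U \<Longrightarrow> \<sigma> e * ((to_complex (dst e) - to_complex x) / (to_complex (src e) -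
          to_complex x)) \<notin> \<real>\<^sub>\<le>\<^sub>0"
    and UV: "U \<inter> V = {}"
  shows "\<exists>c. \<forall>x\<in>U. (\<Sum>e\<in>E. of_real (w e) * log_ratio (\<sigma> e) (to_complex (src e)) (to_complex (dst e))
      (to_complex x)) = c"
proof -
  let ?F = "\<lambda>z. \<Sum>e\<in>E. of_real (w e) * log_ratio (\<sigma> e) (to_complex (src e)) (to_complex (dst e)) z"
  have der: "(?F has_field_derivative 0) (at (to_complex x))" if x: "x \<in> U" for x
  proof -
    have "(log_ratio (\<sigma> e) (to_complex (src e)) (to_complex (dst e)) has_field_derivative
        (1 / (to_complex (src e) - to_complex x) - 1 / (to_complex (dst e) - to_complex x))) (at
            (to_complex x))" if e: "e \<in> E" for e
    proof (rule log_ratio_deriv[OF \<sigma>(2)[OF e x] _ _ \<sigma>(1)[OF e]])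
      have "src e \<noteq> x" "dst e \<noteq> x" using UV x edge_ends[OF e] by auto
      then show "to_complex (src e) - to_complex x \<noteq> 0" "to_complex (dst e) - to_complex x \<noteq> 0"
          by auto
    qed
    then have "(?F has_field_derivative (\<Sum>e\<in>E. of_real (w e) * (1 / (to_complex (src e) - to_complex
        x) - 1 / (to_complex (dst e) - to_complex x)))) (at (to_complex x))"
      by (intro DERIV_sum DERIV_cmult)
    also have "(\<Sum>e\<in>E. of_real (w e) * (1 / (to_complex (src e) - to_complex x) - 1 / (to_complex
        (dst e) - to_complex x)))
        = (\<Sum>e\<in>E. \<Sum>v\<in>V. of_real (end_sign e v * w e) * (1 / (to_complex v - to_complex x)))"
    proof (rule sum.cong[OF refl])
      fix e assume e: "e \<in> E"
      have "1 / (to_complex (src e) - to_complex x) - 1 / (to_complex (dst e) - to_complex x)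
          = (\<Sum>v\<in>V. of_real (end_sign e v) * (1 / (to_complex v - to_complex x)))"
      proof -
        have "(\<Sum>v\<in>V. of_real (end_sign e v) * (1 / (to_complex v - to_complex x)))
            = (\<Sum>v\<in>V. (if src e = v then 1 / (to_complex v - to_complex x) else 0) - (if dst e
            = v then 1 / (to_complex v - to_complex x) else 0))"
          using edge(1)[OF e] by (intro sum.cong) (auto simp: end_sign_def)
        then show ?thesis using fin_V edge_ends[OF e] by (simp add: sum_subtractf)
      qed
      then show "of_real (w e) * (1 / (to_complex (src e) - to_complex x) - 1 / (to_complex (dst e)
          - to_complex x)) = (\<Sum>v\<in>V. of_real (end_sign e v * w e) * (1 / (to_complex v - to_complex
          x)))"
        by (simp only: sum_distrib_left of_real_mult ac_simps)
    qed
    also have "\<dots> = (\<Sum>v\<in>V. of_real (\<Sum>e\<in>E. end_sign e v * w e) * (1 / (to_complex v - to_complex x)))"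
      by (subst sum.swap) (simp only: sum_distrib_right of_real_sum)
    also have "\<dots> = 0" using flow by simp
    finally show ?thesis .
  qed
  have "continuous_on (to_complex ` U) ?F"
    using der DERIV_isCont by (intro continuous_at_imp_continuous_on) blast
  then obtain c where "\<And>z. z \<in> to_complex ` U \<Longrightarrow> ?F z = c"
    using DERIV_zero_connected_constant[OF connected_to_complex[OF U(2)] open_to_complex[OF U(1)],
        of "{}" ?F] der by auto
  then show ?thesis by blast
qed

text \<open>The potential is the sum over all edges of the weighted angle under which the edge is seen.\<close>

lemma flow_potential_full:
  fixes w :: "plane set \<Rightarrow> real"
  assumes flow: "\<And>v. v \<in> V \<Longrightarrow> (\<Sum>e\<in>E. end_sign e v * w e) = 0"
  shows "\<exists>g. \<forall>e\<in>Ei. g (left e) - g (right e) = w e"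
proof -
  let ?F = "\<lambda>x. \<Sum>e\<in>E. of_real (w e) * log_ratio 1 (to_complex (src e)) (to_complex (dst e))
      (to_complex x)"
  have "\<exists>c. \<forall>x\<in>P. ?F x = c" if P: "P \<in> cells D E" for P
  proof (rule locally_constant_potential[where \<sigma> = "\<lambda>_. 1"])
    show "1 * ((to_complex (dst e) - to_complex x) / (to_complex (src e) - to_complex x)) \<notin> \<real>\<^sub>\<le>\<^sub>0"
        if "e \<in> E" "x \<in> P" for e x
    proof -
      have "x \<notin> closed_segment (src e) (dst e)" using cells_sub[OF P] that edge(2)[OF that(1)]
          by blast
      from not_nonpos_ratio[OF edge(1)[OF that(1)] this] show ?thesis by simp
    qed
    show "P \<inter> V = {}" using cells_sub[OF P] V_sub by blast
    show "open P" "connected P" using cells_open[OF P] cells_connected[OF P] .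
  qed (rule flow | simp)+
  then have "\<forall>P\<in>cells D E. \<exists>c. \<forall>x\<in>P. ?F x = c" by (rule ballI)
  from bchoice[OF this] obtain c where "\<forall>P\<in>cells D E. \<forall>x\<in>P. ?F x = c P" by (rule exE)
  then have c: "\<And>P x. P \<in> cells D E \<Longrightarrow> x \<in> P \<Longrightarrow> ?F x = c P" by blast
  have "Im (c (left e0)) / (2 * pi) - Im (c (right e0)) / (2 * pi) = w e0" if e0: "e0 \<in> Ei" for e0
  proof -
    have eE: "e0 \<in> E" using e0 by (rule EiD)
    have "open_segment (src e0) (dst e0) \<noteq> {}" using edge(1)[OF eE] by simp
    then obtain x0 where x0: "x0 \<in> e0 - V" using open_edge[OF eE] by blast
    obtain r1 where r1: "r1 > 0" "ball x0 r1 \<subseteq> D - V" "\<And>y. y \<in> ball x0 r1 \<Longrightarrow> y \<in> \<Union>E \<Longrightarrow> edge_form e0 y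
        = 0"
      "\<And>y. y \<in> ball x0 r1 \<Longrightarrow> edge_form e0 y = 0 \<Longrightarrow> y \<in> e0 - V"
      using edge_nbhd[OF e0 x0] by blast
    obtain r2 where r2: "r2 > 0" "\<And>y. y \<in> ball x0 r2 \<Longrightarrow> 0 < edge_form e0 y \<Longrightarrow> y \<in> left e0"
      "\<And>y. y \<in> ball x0 r2 \<Longrightarrow> edge_form e0 y < 0 \<Longrightarrow> y \<in> right e0"
      using left_right[OF e0 x0] by blast
    define U where "U = ball x0 (min r1 r2)"
    have U1: "y \<in> ball x0 r1" and U2: "y \<in> ball x0 r2" if "y \<in> U" for y using that
        by (auto simp: U_def)
    \<comment> \<open>Only the branch of \<open>e0\<close> is changed: the sum then has no cut in a
      ball around a point of \<open>e0\<close> and is constant on the whole ball.\<close>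
    define \<sigma> :: "plane set \<Rightarrow> complex" where "\<sigma> = (\<lambda>e. if e = e0 then -1 else 1)"
    let ?A = "to_complex (src e0)" and ?B = "to_complex (dst e0)"
    let ?q = "\<lambda>x. (?B - to_complex x) / (?A - to_complex x)"
    have UA: "?A \<noteq> to_complex x" "?B \<noteq> to_complex x" if "x \<in> U" for x
      using U1[OF that] r1(2) edge_ends[OF eE] by auto
    have "\<exists>c. \<forall>x\<in>U. (\<Sum>e\<in>E. of_real (w e) * log_ratio (\<sigma> e) (to_complex (src e)) (to_complex (dst e))
        (to_complex x)) = c"
    proof (rule locally_constant_potential[OF flow])
      fix e x assume e: "e \<in> E" and x: "x \<in> U"
      show "\<sigma> e * ((to_complex (dst e) - to_complex x) / (to_complex (src e) - to_complex x)) \<notin>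
          \<real>\<^sub>\<le>\<^sub>0"
      proof (cases "e = e0")
        case False
        have "x \<notin> e"
        proof
          assume xe: "x \<in> e"
          then have "x \<in> e0 - V" using r1(3,4)[OF U1[OF x]] e by blast
          then show False using edges_meet[OF e eE False] xe by blast
        qed
        then have "x \<notin> closed_segment (src e) (dst e)" using edge(2)[OF e] by blast
        from not_nonpos_ratio[OF edge(1)[OF e] this] show ?thesis using False by (simp add: \<sigma>_def)
      next
        case True
        show ?thesis
        proof
          assume "\<sigma> e * ((to_complex (dst e) - to_complex x) / (to_complex (src e) - to_complex x))
              \<in> \<real>\<^sub>\<le>\<^sub>0"
          moreover have "\<sigma> e * ((to_complex (dst e) - to_complex x) / (to_complex (src e) -
              to_complex x)) = - ?q x"
            unfolding True \<sigma>_def by (simp only: refl if_True mult_minus1)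
          ultimately have *: "- ?q x \<in> \<real>\<^sub>\<le>\<^sub>0" by (simp only:)
          then have "Im (?q x) = 0" by (simp only: complex_nonpos_Reals_iff uminus_complex.sel
              neg_equal_0_iff_equal)
          then have l0: "edge_form e0 x = 0" using Im_div_line_form[OF UA(1)[OF x], of "dst e0"]
              UA(1)[OF x] by simp
          then have "x \<in> open_segment (src e0) (dst e0)" using r1(4)[OF U1[OF x]] open_edge[OF eE]
              by blast
          moreover have "x \<noteq> src e0" using UA(1)[OF x] by auto
          ultimately obtain s where "?q x = of_real s" "s < 0"
            using ratio_pos_or_neg[OF edge(1)[OF eE] _ l0] by blast
          then show False using * by (simp flip: of_real_minus)
        qed
      qed
    qed (use U1 r1(2) in \<open>auto simp: U_def \<sigma>_def\<close>)
    then obtain C where C: "\<And>x. x \<in> U \<Longrightarrow> (\<Sum>e\<in>E. of_real (w e) * log_ratio (\<sigma> e) (to_complex (src e))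
        (to_complex (dst e)) (to_complex x)) = C" by blast
    \<comment> \<open>Compared with this constant, the true potential differs only by the two
      branches for \<open>e0\<close>. They differ by i pi on the left of \<open>e0\<close> and by -
      i pi on the right, which makes the jump 2 pi times \<open>w e0\<close>.\<close>
    have F: "?F x = C + of_real (w e0) * (log_ratio 1 ?A ?B (to_complex x) - log_ratio (-1) ?A ?B
        (to_complex x))" if x: "x \<in> U" for x
    proof -
      have "(\<Sum>e\<in>E - {e0}. of_real (w e) * log_ratio (\<sigma> e) (to_complex (src e)) (to_complex (dst e))
          (to_complex x))
          = (\<Sum>e\<in>E - {e0}. of_real (w e) * log_ratio 1 (to_complex (src e)) (to_complex (dst e))
              (to_complex x))"
        by (intro sum.cong) (auto simp: \<sigma>_def)
      then show ?thesis
        using C[OF x] sum.remove[OF fin_E eE, of "\<lambda>e. of_real (w e) * log_ratio (\<sigma> e) (to_complex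
            (src e)) (to_complex (dst e)) (to_complex x)"]
          sum.remove[OF fin_E eE, of "\<lambda>e. of_real (w e) * log_ratio 1 (to_complex (src e))
              (to_complex (dst e)) (to_complex x)"]
        by (simp add: \<sigma>_def algebra_simps)
    qed
    have q0: "?q x \<noteq> 0" if "x \<in> U" for x using UA[OF that] by simp
    have Imq: "Im (?q x) = edge_form e0 x / (cmod (?A - to_complex x))\<^sup>2"
        and pos: "0 < (cmod (?A - to_complex x))\<^sup>2" if "x \<in> U" for x
      using Im_div_line_form[OF UA(1)[OF that]] UA(1)[OF that] by auto
    have r: "min r1 r2 > 0" using r1(1) r2(1) by simp
    obtain x where x: "x \<in> U" "0 < edge_form e0 x"
      using half_ball_meets[OF edge_form_edge[OF eE, of x0] edge(1)[OF eE] r, of 1] x0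
          by (auto simp: U_def)
    obtain y where y: "y \<in> U" "edge_form e0 y < 0"
      using half_ball_meets[OF edge_form_edge[OF eE, of x0] edge(1)[OF eE] r, of "-1"] x0
          by (auto simp: U_def)
    have log_ratio: "log_ratio 1 ?A ?B (to_complex x) = Ln (?q x)" "log_ratio (-1) ?A ?B (to_complex
        x) = Ln (- ?q x)" for x
      by (simp_all only: log_ratio_def mult_minus1 mult_1_left)
    have "0 < Im (?q x)" using Imq[OF x(1)] pos[OF x(1)] x(2) by simp
    then have Lx: "log_ratio 1 ?A ?B (to_complex x) - log_ratio (-1) ?A ?B (to_complex x) = \<i> * pi"
      unfolding log_ratio Ln_minus[OF q0[OF x(1)]] by simp
    have "Im (?q y) < 0" using Imq[OF y(1)] pos[OF y(1)] y(2) by (simp add: divide_neg_pos)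
    then have Ly: "log_ratio 1 ?A ?B (to_complex y) - log_ratio (-1) ?A ?B (to_complex y)
        = - \<i> * pi"
      unfolding log_ratio Ln_minus[OF q0[OF y(1)]] by simp
    have "c (left e0) = C + of_real (w e0) * (\<i> * pi)"
      using c[OF side_cell(1)[OF e0] r2(2)[OF U2[OF x(1)] x(2)]] F[OF x(1)] Lx by simp
    then have L: "Im (c (left e0)) = Im C + w e0 * pi" by simp
    have "c (right e0) = C + of_real (w e0) * (- \<i> * pi)"
      using c[OF side_cell(1)[OF e0] r2(3)[OF U2[OF y(1)] y(2)]] F[OF y(1)] Ly by simp
    then have "Im (c (right e0)) = Im C - w e0 * pi" by simp
    then have "Im (c (left e0)) - Im (c (right e0)) = w e0 * (2 * pi)" using L by simp
    then show ?thesis by (simp flip: diff_divide_distrib)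
  qed
  then show ?thesis by (intro exI[of _ "\<lambda>P. Im (c P) / (2 * pi)"]) auto
qed

text \<open>A unit flow from a vertex to \<open>base\<close> extends to a neighbouring vertex by
  adding \<plusminus>1 on the boundary edge between them. So the edges with such a flow and those
  without form two disjoint closed sets that cover the connected boundary.\<close>

lemma boundary_unit_flows:
  assumes "connected (frontier D)" and base: "base \<in> V" "base \<in> frontier D" and v: "v \<in> V" "v
      \<in> frontier D"
  shows "\<exists>\<phi>. \<forall>x\<in>V. (\<Sum>e\<in>Eb. end_sign e x * \<phi> e) = of_bool (x = v) - (of_bool (x = base) :: real)"
proof -
  define Q where "Q v \<longleftrightarrow> (\<exists>\<phi>. \<forall>x\<in>V. (\<Sum>e\<in>Eb. end_sign e x * \<phi> e) = of_bool (x = v) - (of_bool (x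
      = base) :: real))" for v
  have finEb: "finite Eb" using fin_E by simp
  have Qroot: "Q base" unfolding Q_def by (rule exI[of _ "\<lambda>_. 0"]) simp
  have step: "Q (src e) \<longleftrightarrow> Q (dst e)" if e: "e \<in> Eb" for e
  proof -
    have unit: "(\<Sum>e'\<in>Eb. end_sign e' x * (if e' = e then k else 0)) = end_sign e x * k" for x k
      using finEb e by (simp add: if_distrib[of "\<lambda>r. _ * r"] cong: if_cong)
    have end_sign: "end_sign e x = of_bool (x = src e) - of_bool (x = dst e)" for x
      using edge(1)[of e] e by (auto simp: end_sign_def)
    have *: "Q v'" if "Q v" "\<And>x. end_sign e x * k = of_bool (x = v') - of_bool (x = v)" for v v' k
    proof -
      obtain \<phi> where \<phi>: "\<And>x. x \<in> V \<Longrightarrow> (\<Sum>e\<in>Eb. end_sign e x * \<phi> e) = of_bool (x = v) - (of_bool (x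
          = base) :: real)"
        using \<open>Q v\<close> unfolding Q_def by blast
      have "(\<Sum>e'\<in>Eb. end_sign e' x * (\<phi> e' + (if e' = e then k else 0))) = of_bool (x
          = v') - (of_bool (x = base) :: real)" if "x \<in> V" for x
        unfolding distrib_left sum.distrib unit \<phi>[OF that] using \<open>\<And>x. end_sign e x * k = of_bool (x
            = v') - of_bool (x = v)\<close>[of x] by simp
      then show "Q v'" unfolding Q_def
        by (intro exI[of _ "\<lambda>e'. \<phi> e' + (if e' = e then k else 0)"] ballI)
    qed
    show ?thesis using *[of "src e" "-1" "dst e"] *[of "dst e" 1 "src e"] end_sign by auto
  qed
  have ends: "\<exists>e\<in>Eb. x = src e \<or> x = dst e" if "x \<in> V" "x \<in> frontier D" for x
  proof -
    obtain e where e: "e \<in> Eb" "x \<in> e" using frontier_D \<open>x \<in> frontier D\<close> by blast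
    then have "x \<in> e \<inter> V" "e \<in> E" using that by auto
    then show ?thesis using e edge(3)[of e] by auto
  qed
  let ?S = "\<Union>{e\<in>Eb. Q (src e)}" and ?T = "\<Union>{e\<in>Eb. \<not> Q (src e)}"
  have cl: "closed ?S" "closed ?T" using fin_E closed_edge by (auto intro!: closed_Union)
  have un: "frontier D = ?S \<union> ?T" using frontier_D by blast
  have "?S \<inter> ?T = {}"
  proof (rule ccontr)
    assume "?S \<inter> ?T \<noteq> {}"
    then obtain x e e' where x: "e \<in> Eb" "e' \<in> Eb" "Q (src e)" "\<not> Q (src e')" "x \<in> e" "x \<in> e'"
        by blast
    have "e \<noteq> e'" using x by auto
    then have "x \<in> V" using edges_meet[of e e'] x by blast
    then have "x \<in> e \<inter> V" "x \<in> e' \<inter> V" using x by auto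
    then have "x = src e \<or> x = dst e" "x = src e' \<or> x = dst e'" using x edge(3)[of e] edge(3)[of e']
        by auto
    then show False using step[OF x(1)] step[OF x(2)] x(3,4) by auto
  qed
  then have "?S = {} \<or> ?T = {}"
    using connected_closedD[OF assms(1), of ?S ?T] cl un by blast
  moreover have "?S \<noteq> {}"
  proof -
    obtain e where "e \<in> Eb" "base = src e \<or> base = dst e" using ends[OF base] by blast
    then have "e \<in> {e\<in>Eb. Q (src e)}" using step Qroot by auto
    moreover have "e \<noteq> {}" using edge_ends[of e] \<open>e \<in> Eb\<close> by auto
    ultimately show ?thesis by blast
  qed
  ultimately have T: "?T = {}" by blast
  obtain e where e: "e \<in> Eb" "v = src e \<or> v = dst e" using ends[OF v] by blast
  have "Q (src e)"
  proof (rule ccontr)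
    assume "\<not> Q (src e)"
    then have "src e \<in> ?T" using e(1) edge_ends[of e] by blast
    then show False using T by blast
  qed
  then have "Q v" using e step by blast
  then show ?thesis unfolding Q_def .
qed

text \<open>The excess at every boundary vertex is led along the boundary to \<open>base\<close>,
  where the contributions cancel since the total excess is zero. The result is balanced at all
  vertices.\<close>

lemma flow_potential:
  assumes sc: "simply_connected D"
    and flow: "\<And>v. v \<in> Vi \<Longrightarrow> (\<Sum>e\<in>Ei. end_sign e v * w e) = (0::real)"
  shows "\<exists>g. \<forall>e\<in>Ei. g (left e) - g (right e) = w e"
proof -
  have con: "connected (frontier D)" by (rule frontier_connected[OF sc open_D bounded_D])
  define Vf where "Vf = V \<inter> frontier D"
  have finVf: "finite Vf" using fin_V by (simp add: Vf_def)
  have V_split: "x \<in> Vi \<or> x \<in> Vf" if "x \<in> V" for x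
    using that V_sub E_sub closure_D_cases by (auto simp: Vi_eq Vf_def)
  have Vf_Vi: "x \<notin> Vi" if "x \<in> Vf" for x using that D_frontier by (auto simp: Vi_eq Vf_def)
  have "frontier D \<noteq> {}"
    using bounded_D open_D D_ne frontier_eq_empty[of D] not_bounded_UNIV by metis
  then obtain e1 where e1: "e1 \<in> Eb" using frontier_D by blast
  define base where "base = src e1"
  have base: "base \<in> V" "base \<in> frontier D" using e1 edge_ends[of e1] by (auto simp: base_def)
  have "\<exists>\<phi>. \<forall>x\<in>V. (\<Sum>e\<in>Eb. end_sign e x * \<phi> e) = of_bool (x = v) - (of_bool (x = base) :: real)"
      if "v \<in> Vf" for v
    by (rule boundary_unit_flows[OF con base]) (use that in \<open>auto simp: Vf_def\<close>)
  then have "\<forall>v\<in>Vf. \<exists>\<phi>. \<forall>x\<in>V. (\<Sum>e\<in>Eb. end_sign e x * \<phi> e) = of_bool (x = v) - (of_bool (x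
      = base) :: real)"
    by (rule ballI)
  from bchoice[OF this] obtain \<phi> where
    "\<forall>v\<in>Vf. \<forall>x\<in>V. (\<Sum>e\<in>Eb. end_sign e x * \<phi> v e) = of_bool (x = v) - (of_bool (x = base) :: real)"
    by (rule exE)
  then have \<phi>: "\<And>v x. v \<in> Vf \<Longrightarrow> x \<in> V \<Longrightarrow>
      (\<Sum>e\<in>Eb. end_sign e x * \<phi> v e) = of_bool (x = v) - (of_bool (x = base) :: real)"
    by blast
  define \<delta> where "\<delta> v = (\<Sum>e\<in>Ei. end_sign e v * w e)" for v
  have \<delta>sum: "(\<Sum>v\<in>Vf. \<delta> v) = 0"
  proof -
    have "(\<Sum>v\<in>Vf. \<delta> v) = (\<Sum>v\<in>V. \<delta> v)"
      using V_split flow fin_V by (intro sum.mono_neutral_left) (auto simp: Vf_def \<delta>_def)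
    also have "\<dots> = (\<Sum>e\<in>Ei. \<Sum>v\<in>V. end_sign e v * w e)" unfolding \<delta>_def by (rule sum.swap)
    also have "\<dots> = 0"
      using sum_end_sign[OF EiD fin_V subset_refl, of _ "\<lambda>_. w _"] by (intro sum.neutral) auto
    finally show ?thesis .
  qed
  \<comment> \<open>The minus sign makes the boundary flow return what the interior edges carry away
    from the boundary vertices.\<close>
  define W where "W e = (if e \<in> Ei then w e else - (\<Sum>v\<in>Vf. \<delta> v * \<phi> v e))" for e
  have "(\<Sum>e\<in>E. end_sign e x * W e) = 0" if x: "x \<in> V" for x
  proof -
    have "(\<Sum>e\<in>E. end_sign e x * W e) = (\<Sum>e\<in>Ei. end_sign e x * W e) + (\<Sum>e\<in>Eb. end_sign e x * W e)"
      using sum.union_disjoint[OF fin_Ei _ E_split(2)] fin_E E_split(1)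
          by (metis (no_types, lifting) finite_Un)
    also have "(\<Sum>e\<in>Ei. end_sign e x * W e) = \<delta> x" by (simp add: W_def \<delta>_def)
    also have "(\<Sum>e\<in>Eb. end_sign e x * W e) = (\<Sum>e\<in>Eb. - (\<Sum>v\<in>Vf. end_sign e x * (\<delta> v * \<phi> v e)))"
      using E_split(2) by (intro sum.cong) (auto simp: W_def sum_distrib_left)
    also have "\<dots> = - (\<Sum>v\<in>Vf. \<delta> v * (\<Sum>e\<in>Eb. end_sign e x * \<phi> v e))"
      by (simp only: sum_negf, subst sum.swap) (simp only: sum_distrib_left ac_simps)
    also have "\<dots> = - (\<Sum>v\<in>Vf. \<delta> v * (of_bool (x = v) - of_bool (x = base)))"
      using \<phi> x by simp
    also have "\<dots> = - (\<Sum>v\<in>Vf. if x = v then \<delta> v else 0) + of_bool (x = base) * (\<Sum>v\<in>Vf. \<delta> v)"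
      by (simp only: right_diff_distrib sum_subtractf sum_distrib_left)
         (simp add: of_bool_def if_distrib[of "\<lambda>r. _ * r"] cong: if_cong)
    also have "\<dots> = - (if x \<in> Vf then \<delta> x else 0)" using \<delta>sum finVf by simp
    finally show ?thesis using V_split[OF x] flow by (auto simp: \<delta>_def)
  qed
  from flow_potential_full[OF this] show ?thesis by (simp add: W_def)
qed

end

section \<open>The dimension of the spline space\<close>

lemma card_exponents: "card (exponents k d) = (\<Sum>m\<in>{k..d}. Suc m)"
proof -
  have "exponents k d = (\<lambda>(m, i). (i, m - i)) ` (SIGMA m:{k..d}. {..m})"
  proof (intro subset_antisym subsetI)
    fix ij assume "ij \<in> exponents k d"
    then have "ij = (\<lambda>(m, i). (i, m - i)) (fst ij + snd ij, fst ij)"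
      "(fst ij + snd ij, fst ij) \<in> (SIGMA m:{k..d}. {..m})" by (auto simp: exponents_def)
    then show "ij \<in> (\<lambda>(m, i). (i, m - i)) ` (SIGMA m:{k..d}. {..m})" by (rule image_eqI)
  qed (auto simp: exponents_def)
  moreover have "inj_on (\<lambda>(m, i). (i, m - i)) (SIGMA m:{k..d}. {..m})"
    by (auto simp: inj_on_def)
  ultimately have "card (exponents k d) = card (SIGMA m:{k..d}. {..m})" by (simp add: card_image)
  then show ?thesis by simp
qed

lemma card_exponents_0: "card (exponents 0 d) = (d + 2) choose 2"
proof -
  have "(\<Sum>m\<le>d. Suc m) = (d + 2) choose 2"
    by (induction d) (auto simp: numeral_2_eq_2)
  then show ?thesis by (simp add: card_exponents atLeast0AtMost)
qed

text \<open>With m = d - j + 1 the term compares the N (m - \<mu>) coefficients of degree m in the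
  cofactor terms on N lines with the m + 1 monomials of that degree. It is nonnegative for N \<ge>
  \<mu> + 2, because (\<mu> + 2)(m - \<mu>) - (m + 1) = (\<mu> + 1)(m - \<mu> - 1).\<close>

lemma k_num_eq:
  assumes "\<mu> < d" "\<mu> + 2 \<le> N"
  shows "k_num d \<mu> N = int N * int ((d - \<mu> + 1) choose 2) - int (card (exponents (Suc \<mu>) d))"
proof -
  have pos: "int (Suc m) \<le> int N * (int m - int \<mu>)" if m: "m \<in> {Suc \<mu>..d}" for m
  proof -
    have "int (Suc m) \<le> (int \<mu> + 2) * (int m - int \<mu>)"
    proof -
      have "(int \<mu> + 2) * (int m - int \<mu>) - int (Suc m) = (int \<mu> + 1) * (int m - int \<mu> - 1)"
        by (simp add: algebra_simps)
      moreover have "0 \<le> (int \<mu> + 1) * (int m - int \<mu> - 1)" using m by simp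
      ultimately show ?thesis by linarith
    qed
    also have "\<dots> \<le> int N * (int m - int \<mu>)" using assms m by (intro mult_right_mono) auto
    finally show ?thesis .
  qed
  have "k_num d \<mu> N = (\<Sum>m\<in>{Suc \<mu>..d}. max 0 (int N * (int m - int \<mu>) - int (Suc m)))"
    unfolding k_num_def using assms(1)
    by (intro sum.reindex_bij_witness[of _ "\<lambda>m. Suc d - m" "\<lambda>j. Suc d - j"]) (auto simp: of_nat_diff
        algebra_simps)
  also have "\<dots> = (\<Sum>m\<in>{Suc \<mu>..d}. int N * (int m - int \<mu>) - int (Suc m))"
    using pos by (intro sum.cong) (auto simp: max_def)
  also have "\<dots> = int N * (\<Sum>m\<in>{Suc \<mu>..d}. int m - int \<mu>) - int (card (exponents (Suc \<mu>) d))"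
    by (simp only: sum_subtractf[of "\<lambda>m. int N * (int m - int \<mu>)"] sum_distrib_left card_exponents
        of_nat_sum)
  also have "(\<Sum>m\<in>{Suc \<mu>..d}. int m - int \<mu>) = (\<Sum>m\<in>{0..d - Suc \<mu>}. int (Suc m))"
    using assms(1)
    by (intro sum.reindex_bij_witness[of _ "\<lambda>m. m + Suc \<mu>" "\<lambda>m. m - Suc \<mu>"]) (auto simp:
        of_nat_diff)
  also have "\<dots> = int (card (exponents 0 (d - Suc \<mu>)))" by (simp add: card_exponents)
  also have "d - Suc \<mu> + 2 = d - \<mu> + 1" using assms(1) by simp
  then have "card (exponents 0 (d - Suc \<mu>)) = (d - \<mu> + 1) choose 2"
      using card_exponents_0[of "d - Suc \<mu>"] by simp
  finally show ?thesis .
qed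

text \<open>A direct sum over \<open>I\<close> of spaces with bases indexed by \<open>K\<close>,
  encoded as functions on pairs that vanish outside \<open>I\<close>.\<close>

lemma has_dim_family:
  fixes \<phi> :: "'i \<Rightarrow> 'k \<Rightarrow> 'x \<Rightarrow> real"
  assumes fin: "finite I" "finite K"
    and indep: "\<And>i c j. i \<in> I \<Longrightarrow> (\<And>x. (\<Sum>j\<in>K. c j * \<phi> i j x) = 0) \<Longrightarrow> j \<in> K \<Longrightarrow> c j = 0"
  shows "has_dim {w. (\<forall>i\<in>I. \<exists>c. \<forall>x. w (i, x) = (\<Sum>j\<in>K. c j * \<phi> i j x)) \<and> (\<forall>i. i \<notin> I \<longrightarrow> (\<forall>x. w (i, x)
      = 0))}
    (card I * card K)" (is "has_dim ?W _")
proof -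
  let ?S = "{f :: 'i \<times> 'k \<Rightarrow> real. \<forall>i. i \<notin> I \<times> K \<longrightarrow> f i = 0}"
  define F :: "('i \<times> 'k \<Rightarrow> real) \<Rightarrow> 'i \<times> 'x \<Rightarrow> real" where
    "F = (\<lambda>f (i, x). if i \<in> I then \<Sum>j\<in>K. f (i, j) * \<phi> i j x else 0)"
  have lin: "Vector_Spaces.linear fscale fscale F"
    by (rule linear_fscaleI) (auto simp: F_def fun_eq_iff sum.distrib distrib_right sum_distrib_left
        mult.assoc)
  have "has_dim (F ` ?S) (card (I \<times> K))"
  proof (rule has_dim_inj_image[OF lin has_dim_finite_support])
    show "finite (I \<times> K)" using fin by simp
    fix f assume f: "f \<in> ?S" "F f = 0"
    show "f = 0"
    proof (rule ext)
      fix ij :: "'i \<times> 'k"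
      obtain i j where ij: "ij = (i, j)" by (cases ij)
      show "f ij = 0 ij"
      proof (cases "ij \<in> I \<times> K")
        case True
        then have i: "i \<in> I" "j \<in> K" by (auto simp: ij)
        have "(\<Sum>j\<in>K. f (i, j) * \<phi> i j x) = 0" for x
          using fun_cong[OF f(2), of "(i, x)"] i(1) by (simp add: F_def)
        from indep[OF i(1) this i(2)] show ?thesis by (simp add: ij)
      next
        case False
        then have "f ij = 0" using f(1) by blast
        then show ?thesis by simp
      qed
    qed
  qed
  moreover have "F ` ?S = ?W"
  proof (intro subset_antisym subsetI)
    fix w assume "w \<in> F ` ?S"
    then show "w \<in> ?W" by (auto simp: F_def)
  next
    fix w assume w: "w \<in> ?W"
    then have "\<forall>i\<in>I. \<exists>c. \<forall>x. w (i, x) = (\<Sum>j\<in>K. c j * \<phi> i j x)" by blast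
    from bchoice[OF this] obtain c where c: "\<forall>i\<in>I. \<forall>x. w (i, x) = (\<Sum>j\<in>K. c i j * \<phi> i j x)"
        by (rule exE)
    let ?f = "\<lambda>(i, j). if i \<in> I \<and> j \<in> K then c i j else 0"
    have "w = F ?f" using w c by (auto simp: F_def fun_eq_iff)
    moreover have "?f \<in> ?S" by auto
    ultimately show "w \<in> F ` ?S" by (rule image_eqI)
  qed
  ultimately show ?thesis by (simp add: card_cartesian_product)
qed

text \<open>The polynomials of a spline as a family indexed by the cells. Each is kept on the whole
  plane, so that jumps are differences of polynomials and not of functions on disjoint sets.\<close>

definition pieces :: "plane set \<Rightarrow> plane set \<Rightarrow> plane set set \<Rightarrow> nat \<Rightarrow> nat \<Rightarrow> (plane set \<times> plane \<Rightarrow> real)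
    set" where
  "pieces D V E k d = {p. (\<forall>P\<in>cells D E. (\<lambda>x. p (P, x)) \<in> polys_at 0 0 d) \<and> (\<forall>P. P \<notin> cells D E
      \<longrightarrow> (\<forall>x. p (P, x) = 0))
     \<and> (\<forall>e\<in>interior_edges D E. (\<lambda>x. p (side_cell D E V 1 e, x) - p (side_cell D E V (-1) e, x))
         \<in> line_multiples (src e) (dst e) k d)}"

definition cofactors :: "plane set \<Rightarrow> plane set set \<Rightarrow> nat \<Rightarrow> nat \<Rightarrow> (plane set \<times> plane \<Rightarrow> real) set"
    where
  "cofactors D E k d = {w. (\<forall>e\<in>interior_edges D E. (\<lambda>x. w (e, x))
      \<in> line_multiples (src e) (dst e) k d)
     \<and> (\<forall>e. e \<notin> interior_edges D E \<longrightarrow> (\<forall>x. w (e, x) = 0))}"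

definition conditions :: "plane set \<Rightarrow> plane set \<Rightarrow> nat \<Rightarrow> nat \<Rightarrow> (plane \<times> plane \<Rightarrow> real) set" where
  "conditions D V k d = {b. (\<forall>A\<in>interior_vertices D V. (\<lambda>x. b (A, x)) \<in> polys_at A k d)
     \<and> (\<forall>A. A \<notin> interior_vertices D V \<longrightarrow> (\<forall>x. b (A, x) = 0))}"

definition jump :: "plane set \<Rightarrow> plane set \<Rightarrow> plane set set \<Rightarrow> (plane set \<times> plane \<Rightarrow> real) \<Rightarrow> plane set \<times>
    plane \<Rightarrow> real" where
  "jump D V E = (\<lambda>p (e, x). if e \<in> interior_edges D E then p (side_cell D E V 1 e, x) - p (side_cell
      D E V (-1) e, x) else 0)"

definition vertex_sum :: "plane set \<Rightarrow> plane set \<Rightarrow> plane set set \<Rightarrow> (plane set \<times> plane \<Rightarrow> real) \<Rightarrow> plane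
    \<times> plane \<Rightarrow> real" where
  "vertex_sum D V E = (\<lambda>w (A, x). if A \<in> interior_vertices D V then \<Sum>e\<in>interior_edges D E. end_sign
      e A * w (e, x) else 0)"

text \<open>On an edge the choice of a cell is immaterial once the pieces have matching values
  (\<open>glue_on_closure\<close>).\<close>

definition glue :: "plane set \<Rightarrow> plane set set \<Rightarrow> (plane set \<times> plane \<Rightarrow> real) \<Rightarrow> plane \<Rightarrow> real" where
  "glue D E = (\<lambda>p x. if x \<in> D then p (SOME P. P \<in> cells D E \<and> x \<in> closure P, x) else 0)"

lemma linear_jump: "Vector_Spaces.linear fscale fscale (jump D V E)"
  by (rule linear_fscaleI) (auto simp: jump_def fun_eq_iff algebra_simps)

lemma linear_vertex_sum: "Vector_Spaces.linear fscale fscale (vertex_sum D V E)"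
  by (rule linear_fscaleI) (auto simp: vertex_sum_def fun_eq_iff sum.distrib distrib_left
      sum_distrib_left mult.left_commute)

lemma linear_glue: "Vector_Spaces.linear fscale fscale (glue D E)"
  by (rule linear_fscaleI) (auto simp: glue_def fun_eq_iff)

lemma pieces_subspace: "fv.subspace (pieces D V E k d)"
  unfolding fv.subspace_def
proof (intro conjI ballI allI)
  show "0 \<in> pieces D V E k d" by (auto simp: pieces_def polys_at_zero line_multiples_zero)
next
  fix p q assume pq: "p \<in> pieces D V E k d" "q \<in> pieces D V E k d"
  have "(\<lambda>x. (p + q) (side_cell D E V 1 e, x) - (p + q) (side_cell D E V (-1) e, x))
      \<in> line_multiples (src e) (dst e) k d"
    if e: "e \<in> interior_edges D E" for e
  proof -
    have "(\<lambda>x. (p (side_cell D E V 1 e, x) - p (side_cell D E V (-1) e, x))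
        + (q (side_cell D E V 1 e, x) - q (side_cell D E V (-1) e, x)))
        \<in> line_multiples (src e) (dst e) k d"
      by (rule line_multiples_add) (use pq e in \<open>auto simp: pieces_def\<close>)
    then show ?thesis by (simp add: algebra_simps)
  qed
  then show "p + q \<in> pieces D V E k d" using pq by (auto simp: pieces_def intro: polys_at_add)
next
  fix c p assume p: "p \<in> pieces D V E k d"
  have "(\<lambda>x. fscale c p (side_cell D E V 1 e, x) - fscale c p (side_cell D E V (-1) e, x))
      \<in> line_multiples (src e) (dst e) k d"
    if e: "e \<in> interior_edges D E" for e
  proof -
    have "(\<lambda>x. c * (p (side_cell D E V 1 e, x) - p (side_cell D E V (-1) e, x)))
        \<in> line_multiples (src e) (dst e) k d"
      by (rule line_multiples_cmult) (use p e in \<open>auto simp: pieces_def\<close>)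
    then show ?thesis by (simp add: algebra_simps)
  qed
  then show "fscale c p \<in> pieces D V E k d" using p by (auto simp: pieces_def intro: polys_at_cmult)
qed

section \<open>Kernels and images of \<open>jump\<close>, \<open>vertex_sum\<close> and
  \<open>glue\<close>\<close>

context partition
begin

text \<open>Multiplication by a power of the edge form is injective, since one can divide by it on
  the open half-plane where the form is positive.\<close>

lemma has_dim_cofactors: "has_dim (cofactors D E k d) (card Ei * card (exponents 0 (d - k)))"
proof -
  let ?\<phi> = "\<lambda>e ij x. monomial_at 0 ij x * edge_form e x ^ k"
  have eq: "cofactors D E k d = {w. (\<forall>e\<in>Ei. \<exists>c. \<forall>x. w (e, x)
      = (\<Sum>ij\<in>exponents 0 (d - k). c ij * ?\<phi> e ij x))
      \<and> (\<forall>e. e \<notin> Ei \<longrightarrow> (\<forall>x. w (e, x) = 0))}"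
  proof -
    have "q \<in> line_multiples a b k d \<longleftrightarrow> (\<exists>c. \<forall>x. q x = (\<Sum>ij\<in>exponents 0 (d - k). c ij * (monomial_at
        0 ij x * line_form a b x ^ k)))" for q a b
    proof
      assume "q \<in> line_multiples a b k d"
      then obtain r where r: "r \<in> polys_at 0 0 (d - k)" "\<And>x. q x = r x * line_form a b x ^ k"
          unfolding line_multiples_def by blast
      obtain c where "r = (\<lambda>x. \<Sum>ij\<in>exponents 0 (d - k). c ij * monomial_at 0 ij x)"
          by (rule polys_atE[OF r(1)])
      then show "\<exists>c. \<forall>x. q x = (\<Sum>ij\<in>exponents 0 (d - k). c ij * (monomial_at 0 ij x * line_form a b
          x ^ k))"
        using r(2) by (intro exI[of _ c]) (simp add: sum_distrib_right mult.assoc)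
    next
      assume "\<exists>c. \<forall>x. q x = (\<Sum>ij\<in>exponents 0 (d - k). c ij * (monomial_at 0 ij x * line_form a b x ^
          k))"
      then obtain c where c: "\<And>x. q x = (\<Sum>ij\<in>exponents 0 (d - k). c ij * (monomial_at 0 ij x *
          line_form a b x ^ k))" by blast
      have "(\<lambda>x. \<Sum>ij\<in>exponents 0 (d - k). c ij * monomial_at 0 ij x) \<in> polys_at 0 0 (d - k)"
          by (intro polys_at_sum polys_at_cmult polys_at_monomial_at)
      then show "q \<in> line_multiples a b k d" unfolding line_multiples_def
        by (intro CollectI bexI[of _ "\<lambda>x. \<Sum>ij\<in>exponents 0 (d - k). c ij * monomial_at 0 ij x"] allI)
           (simp add: c sum_distrib_right mult.assoc)
    qed
    then show ?thesis by (simp add: cofactors_def)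
  qed
  show ?thesis unfolding eq
  proof (rule has_dim_family[OF fin_Ei finite_exponents])
    fix e c ij
    assume e: "e \<in> Ei" and 0: "\<And>x. (\<Sum>ij\<in>exponents 0 (d - k). c ij * ?\<phi> e ij x) = 0" and ij: "ij
        \<in> exponents 0 (d - k)"
    have eE: "e \<in> E" using e by (rule EiD)
    let ?U = "{x. 0 < edge_form e x}"
    show "c ij = 0"
    proof (rule monomial_at_coeffs_zero[OF _ _ _ ij])
      have "continuous_on UNIV (edge_form e)"
        using polys_at_continuous[OF line_form_gp0] by (intro continuous_at_imp_continuous_on) blast
      then show "open ?U" by (simp add: open_Collect_less)
      show "?U \<noteq> {}"
        using half_ball_meets[OF line_form_ends(1) edge(1)[OF eE], of 1 1] by auto
      fix x assume x: "x \<in> ?U"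
      have "(\<Sum>ij\<in>exponents 0 (d - k). c ij * monomial_at 0 ij x) * edge_form e x ^ k = 0"
        using 0[of x] by (simp add: sum_distrib_right mult.assoc)
      then show "(\<Sum>ij\<in>exponents 0 (d - k). c ij * monomial_at 0 ij x) = 0" using x by simp
    qed
  qed
qed

lemma has_dim_conditions: "has_dim (conditions D V k d) (card Vi * card (exponents k d))"
proof -
  have "conditions D V k d = {b. (\<forall>A\<in>Vi. \<exists>c. \<forall>x. b (A, x)
      = (\<Sum>ij\<in>exponents k d. c ij * monomial_at A ij x))
      \<and> (\<forall>A. A \<notin> Vi \<longrightarrow> (\<forall>x. b (A, x) = 0))}"
    by (simp add: conditions_def polys_at_def)
  moreover have "finite Vi" using fin_V by (simp add: Vi_eq)
  then have "has_dim {b. (\<forall>A\<in>Vi. \<exists>c. \<forall>x. b (A, x) = (\<Sum>ij\<in>exponents k d. c ij * monomial_at A ij x))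
      \<and> (\<forall>A. A \<notin> Vi \<longrightarrow> (\<forall>x. b (A, x) = 0))} (card Vi * card (exponents k d))"
    by (rule has_dim_family) (auto intro: monomial_at_coeffs_zero[of UNIV])
  ultimately show ?thesis by simp
qed

lemma Vi_edge_line: "e \<in> E \<Longrightarrow> end_sign e A \<noteq> 0 \<Longrightarrow> edge_form e A = 0"
  by (auto simp: end_sign_def split: if_splits)

text \<open>Only edges that end at \<open>A\<close> enter the sum, and their linear forms vanish at
  \<open>A\<close>, so the \<open>k\<close>-th powers vanish there to order
  \<open>k\<close>.\<close>

lemma vertex_sum_into:
  assumes "w \<in> cofactors D E k d" "k \<le> d"
  shows "vertex_sum D V E w \<in> conditions D V k d"
proof -
  have "(\<lambda>x. \<Sum>e\<in>Ei. end_sign e A * w (e, x)) \<in> polys_at A k d" for A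
  proof (rule polys_at_sum)
    fix e assume e: "e \<in> Ei"
    show "(\<lambda>x. end_sign e A * w (e, x)) \<in> polys_at A k d"
    proof (cases "end_sign e A = 0")
      case True
      then show ?thesis by (simp add: polys_at_zero)
    next
      case False
      have "(\<lambda>x. w (e, x)) \<in> line_multiples (src e) (dst e) k d" using assms(1) e
          by (simp add: cofactors_def)
      then show ?thesis by (intro polys_at_cmult line_multiples_polys_at[OF _ Vi_edge_line[OF EiD[OF
          e] False] assms(2)])
    qed
  qed
  then show ?thesis by (auto simp: conditions_def vertex_sum_def)
qed

text \<open>Each summand of \<open>p\<close> is a multiple of the power of one l-edge's form. It may
  therefore be transported along all edges of this l-edge to the boundary, so that no other interior
  vertex receives anything.\<close>

lemma solve_condition_at_vertex:
  assumes A: "A \<in> Vi" and N: "num_directions E A \<ge> k + 2" and disj: "disjoint_truncated_l_edges D E"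
    and kd: "k \<le> d" and p: "p \<in> polys_at A k d"
  shows "\<exists>w. (\<forall>e\<in>Ei. w e \<in> line_multiples (src e) (dst e) k d) \<and>
    (\<forall>v\<in>Vi. \<forall>x. (\<Sum>e\<in>Ei. end_sign e v * w e x) = of_bool (v = A) * p x)"
proof -
  have N': "num_directions E A \<ge> Suc k + 1" using N by simp
  obtain I :: "plane set set" and u \<phi> where I: "finite I" "card I = Suc k"
    "\<forall>s\<in>I. \<forall>s'\<in>I. s \<noteq> s' \<longrightarrow> det2 (u s) (u s') \<noteq> 0"
    "\<forall>s\<in>I. \<forall>v\<in>Vi. (\<Sum>e\<in>Ei. end_sign e v * \<phi> s e) = (of_bool (v = A) :: real)"
    "\<forall>s\<in>I. \<forall>e\<in>Ei. \<phi> s e \<noteq> 0 \<longrightarrow> (\<exists>c. \<forall>x. det2 (u s) (x - A) = c * edge_form e x)"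
    by (rule flows_in_distinct_directions[OF A N' disj])
  from polys_at_generated_by_powers[OF I(1,2) bspec[OF bspec[OF I(3)], THEN mp] p kd]
  obtain q where q': "(\<forall>s\<in>I. q s \<in> polys_at 0 0 (d - k)) \<and> (\<forall>x. p x
      = (\<Sum>s\<in>I. q s x * det2 (u s) (x - A) ^ k))"
    by (rule exE)
  have q: "\<And>s. s \<in> I \<Longrightarrow> q s \<in> polys_at 0 0 (d - k)" "\<And>x. p x
      = (\<Sum>s\<in>I. q s x * det2 (u s) (x - A) ^ k)"
    by (rule bspec[OF conjunct1[OF q']], assumption) (rule spec[OF conjunct2[OF q']])
  define w where "w e x = (\<Sum>s\<in>I. \<phi> s e * (q s x * det2 (u s) (x - A) ^ k))" for e x
  have "w e \<in> line_multiples (src e) (dst e) k d" if e: "e \<in> Ei" for e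
  proof -
    have "(\<lambda>x. \<phi> s e * (q s x * det2 (u s) (x - A) ^ k)) \<in> line_multiples (src e) (dst e) k d"
        if s: "s \<in> I" for s
    proof (cases "\<phi> s e = 0")
      case True
      then show ?thesis by (simp add: line_multiples_zero)
    next
      case False
      then obtain c where c: "\<And>x. det2 (u s) (x - A) = c * edge_form e x" using I(5) s e by blast
      have "(\<lambda>x. q s x * det2 (u s) (x - A) ^ k) \<in> line_multiples (src e) (dst e) k d"
        unfolding line_multiples_def
        by (rule CollectI, rule bexI[OF _ polys_at_cmult[OF q(1)[OF s], of "c ^ k"]])
           (simp add: c power_mult_distrib)
      then show ?thesis by (rule line_multiples_cmult)
    qed
    then show ?thesis unfolding w_def[abs_def] by (rule line_multiples_sum)
  qed
  moreover have "(\<Sum>e\<in>Ei. end_sign e v * w e x) = of_bool (v = A) * p x" if v: "v \<in> Vi" for v x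
  proof -
    have "(\<Sum>e\<in>Ei. end_sign e v * w e x) = (\<Sum>e\<in>Ei. \<Sum>s\<in>I. (end_sign e v * \<phi> s e) * (q s x * det2 (u s)
        (x - A) ^ k))"
      by (simp only: w_def sum_distrib_left mult.assoc)
    also have "\<dots> = (\<Sum>s\<in>I. (\<Sum>e\<in>Ei. end_sign e v * \<phi> s e) * (q s x * det2 (u s) (x - A) ^ k))"
      by (subst sum.swap) (simp only: sum_distrib_right)
    also have "\<dots> = (\<Sum>s\<in>I. of_bool (v = A) * (q s x * det2 (u s) (x - A) ^ k))"
      using I(4) v by (intro sum.cong) auto
    finally show ?thesis by (simp only: q(2) sum_distrib_left)
  qed
  ultimately show ?thesis by blast
qed

text \<open>The solutions for single vertices do not disturb each other and can be added.\<close>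

lemma vertex_sum_image:
  assumes N: "\<And>A. A \<in> Vi \<Longrightarrow> num_directions E A \<ge> k + 2" and disj: "disjoint_truncated_l_edges D E"
      and kd: "k \<le> d"
  shows "vertex_sum D V E ` cofactors D E k d = conditions D V k d"
proof (intro subset_antisym subsetI)
  fix b assume "b \<in> vertex_sum D V E ` cofactors D E k d"
  then show "b \<in> conditions D V k d" using vertex_sum_into[OF _ kd] by blast
next
  fix b assume b: "b \<in> conditions D V k d"
  have finVi: "finite Vi" using fin_V by (simp add: Vi_eq)
  have "\<forall>A\<in>Vi. \<exists>w. (\<forall>e\<in>Ei. w e \<in> line_multiples (src e) (dst e) k d) \<and>
    (\<forall>v\<in>Vi. \<forall>x. (\<Sum>e\<in>Ei. end_sign e v * w e x) = of_bool (v = A) * b (A, x))"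
    using b by (intro ballI solve_condition_at_vertex N disj kd) (auto simp: conditions_def)
  from bchoice[OF this] obtain w where w: "\<forall>A\<in>Vi. (\<forall>e\<in>Ei. w A e
      \<in> line_multiples (src e) (dst e) k d) \<and>
    (\<forall>v\<in>Vi. \<forall>x. (\<Sum>e\<in>Ei. end_sign e v * w A e x) = of_bool (v = A) * b (A, x))" by (rule exE)
  define W where "W = (\<lambda>(e, x). if e \<in> Ei then \<Sum>A\<in>Vi. w A e x else 0)"
  have "W \<in> cofactors D E k d" using w by (auto simp: cofactors_def W_def intro!:
      line_multiples_sum)
  moreover have "b = vertex_sum D V E W"
  proof (rule ext)
    fix vx :: "plane \<times> plane"
    obtain v x where vx: "vx = (v, x)" by (cases vx)
    show "b vx = vertex_sum D V E W vx"
    proof (cases "v \<in> Vi")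
      case False
      then show ?thesis using b by (simp add: vx vertex_sum_def conditions_def)
    next
      case True
      have "(\<Sum>e\<in>Ei. end_sign e v * W (e, x)) = (\<Sum>e\<in>Ei. \<Sum>A\<in>Vi. end_sign e v * w A e x)"
        by (simp add: W_def sum_distrib_left)
      also have "\<dots> = (\<Sum>A\<in>Vi. \<Sum>e\<in>Ei. end_sign e v * w A e x)" by (rule sum.swap)
      also have "\<dots> = (\<Sum>A\<in>Vi. if v = A then b (A, x) else 0)" using w True by (intro sum.cong) auto
      also have "\<dots> = b (v, x)" using finVi True by simp
      finally show ?thesis using True by (simp add: vx vertex_sum_def)
    qed
  qed
  ultimately show "b \<in> vertex_sum D V E ` cofactors D E k d" by blast
qed

lemma cells_connected_by_jumps:
  assumes "\<And>P. P \<in> cells D E \<Longrightarrow> R P P"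
    and "\<And>P Q. P \<in> cells D E \<Longrightarrow> Q \<in> cells D E \<Longrightarrow> R P Q \<Longrightarrow> R Q P"
    and "\<And>P Q S. P \<in> cells D E \<Longrightarrow> Q \<in> cells D E \<Longrightarrow> S \<in> cells D E \<Longrightarrow> R P Q \<Longrightarrow> R Q S \<Longrightarrow> R P S"
    and "\<And>e. e \<in> Ei \<Longrightarrow> R (left e) (right e)"
    and P: "P \<in> cells D E" and Q: "Q \<in> cells D E"
  shows "R P Q"
proof (rule cells_related[OF open_minus_V[OF open_D] connected_D_minus_V subset_refl assms(1-4)])
  have "S \<inter> (D - V) \<noteq> {}" if "S \<in> cells D E" for S
    using cells_ne[OF that] cells_sub[OF that] V_sub by blast
  then show "P \<inter> (D - V) \<noteq> {}" "Q \<inter> (D - V) \<noteq> {}" using P Q by auto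
qed (use P Q in auto)

lemma left_right_cells: "e \<in> Ei \<Longrightarrow> left e \<in> cells D E" "e \<in> Ei \<Longrightarrow> right e \<in> cells D E"
  using side_cell(1)[of e 1] side_cell(1)[of e "-1"] by auto

lemma jump_image:
  assumes sc: "simply_connected D" and kd: "k \<le> d"
  shows "jump D V E ` pieces D V E k d = {w \<in> cofactors D E k d. vertex_sum D V E w = 0}"
proof (intro subset_antisym subsetI)
  fix w assume "w \<in> jump D V E ` pieces D V E k d"
  then obtain p where p: "p \<in> pieces D V E k d" "w = jump D V E p" by blast
  have "w \<in> cofactors D E k d" using p by (auto simp: pieces_def cofactors_def jump_def)
  moreover have "vertex_sum D V E w = 0"
  proof (rule ext)
    fix vx :: "plane \<times> plane"
    obtain v x where vx: "vx = (v, x)" by (cases vx)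
    show "vertex_sum D V E w vx = 0 vx"
      using jumps_around_vertex[of v "\<lambda>P. p (P, x)"] by (simp add: vx vertex_sum_def p(2) jump_def)
  qed
  ultimately show "w \<in> {w \<in> cofactors D E k d. vertex_sum D V E w = 0}" by blast
next
  fix w assume "w \<in> {w \<in> cofactors D E k d. vertex_sum D V E w = 0}"
  then have w: "w \<in> cofactors D E k d" "vertex_sum D V E w = 0" by auto
  \<comment> \<open>Evaluation at a point turns the polynomial flow into a real one.\<close>
  have "\<exists>g. \<forall>e\<in>Ei. g (left e) - g (right e) = w (e, x)" for x
  proof (rule flow_potential[OF sc])
    fix v assume "v \<in> Vi"
    then show "(\<Sum>e\<in>Ei. end_sign e v * w (e, x)) = 0" using fun_cong[OF w(2), of "(v, x)"]
        by (simp add: vertex_sum_def)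
  qed
  then have "\<forall>x. \<exists>g. \<forall>e\<in>Ei. g (left e) - g (right e) = w (e, x)" by (rule allI)
  from choice[OF this] obtain g where g: "\<forall>x. \<forall>e\<in>Ei. g x (left e) - g x (right e) = w (e, x)"
      by (rule exE)
  obtain P0 where P0: "P0 \<in> cells D E" using cells_ex by blast
  \<comment> \<open>A potential is determined up to a constant, which may depend on \<open>x\<close>
    in an arbitrary way; subtracting the value on \<open>P0\<close> removes it.\<close>
  define p where "p = (\<lambda>(P, x). if P \<in> cells D E then g x P - g x P0 else 0)"
  have jump: "p (left e, x) - p (right e, x) = w (e, x)" if "e \<in> Ei" for e x
    using g left_right_cells[OF that] that by (simp add: p_def)
  have wJ: "(\<lambda>x. w (e, x)) \<in> line_multiples (src e) (dst e) k d" if "e \<in> Ei" for e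
    using w(1) that by (simp add: cofactors_def)
  \<comment> \<open>A chain of cells from \<open>P\<close> to \<open>P0\<close> writes the
    difference as a sum of jumps, and these are polynomials in \<open>x\<close>.\<close>
  have "(\<lambda>x. p (P, x) - p (P0, x)) \<in> polys_at 0 0 d" if P: "P \<in> cells D E" for P
  proof (rule cells_connected_by_jumps[where R = "\<lambda>P Q. (\<lambda>x. p (P, x) - p (Q, x))
      \<in> polys_at 0 0 d"])
    show "(\<lambda>x. p (P, x) - p (P, x)) \<in> polys_at 0 0 d" for P by (simp add: polys_at_zero)
    show "(\<lambda>x. p (Q, x) - p (P, x)) \<in> polys_at 0 0 d" if "(\<lambda>x. p (P, x) - p (Q, x))
        \<in> polys_at 0 0 d" for P Q
      using polys_at_cmult[OF that, of "-1"] by simp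
    show "(\<lambda>x. p (P, x) - p (S, x)) \<in> polys_at 0 0 d"
      if "(\<lambda>x. p (P, x) - p (Q, x)) \<in> polys_at 0 0 d" "(\<lambda>x. p (Q, x) - p (S, x)) \<in> polys_at 0 0 d"
          for P Q S
      using polys_at_add[OF that] by simp
    show "(\<lambda>x. p (left e, x) - p (right e, x)) \<in> polys_at 0 0 d" if "e \<in> Ei" for e
      using line_multiples_gp0[OF wJ[OF that] kd] jump[OF that] by simp
  qed (use P P0 in auto)
  then have "(\<lambda>x. p (P, x)) \<in> polys_at 0 0 d" if "P \<in> cells D E" for P
    using that P0 by (simp add: p_def)
  then have "p \<in> pieces D V E k d" using jump wJ by (auto simp: pieces_def p_def)
  moreover have "w = jump D V E p"
    using w(1) jump by (auto simp: jump_def cofactors_def fun_eq_iff)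
  ultimately show "w \<in> jump D V E ` pieces D V E k d" by blast
qed

text \<open>Without jumps all cells carry one and the same polynomial.\<close>

lemma has_dim_jump_kernel:
  "has_dim {p \<in> pieces D V E k d. jump D V E p = 0} (card (exponents 0 d))"
proof -
  let ?S = "{f :: nat \<times> nat \<Rightarrow> real. \<forall>i. i \<notin> exponents 0 d \<longrightarrow> f i = 0}"
  define F :: "(nat \<times> nat \<Rightarrow> real) \<Rightarrow> plane set \<times> plane \<Rightarrow> real" where
    "F = (\<lambda>f (P, x). if P \<in> cells D E then \<Sum>ij\<in>exponents 0 d. f ij * monomial_at 0 ij x else 0)"
  have lin: "Vector_Spaces.linear fscale fscale F"
    by (rule linear_fscaleI) (auto simp: F_def fun_eq_iff sum.distrib distrib_right sum_distrib_left
        mult.assoc)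
  obtain P0 where P0: "P0 \<in> cells D E" using cells_ex by blast
  have "has_dim (F ` ?S) (card (exponents 0 d))"
  proof (rule has_dim_inj_image[OF lin has_dim_finite_support[OF finite_exponents]])
    fix f assume f: "f \<in> ?S" "F f = 0"
    have z: "(\<Sum>ij\<in>exponents 0 d. f ij * monomial_at 0 ij x) = 0" for x
      using fun_cong[OF f(2), of "(P0, x)"] P0 by (simp add: F_def)
    have "f ij = 0" if "ij \<in> exponents 0 d" for ij
      by (rule monomial_at_coeffs_zero[OF open_UNIV UNIV_not_empty z that])
    then show "f = 0" using f(1) by (auto simp: fun_eq_iff)
  qed
  moreover have "F ` ?S = {p \<in> pieces D V E k d. jump D V E p = 0}"
  proof (intro subset_antisym subsetI)
    fix p assume "p \<in> F ` ?S"
    then obtain f where p: "p = F f" by blast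
    have "(\<lambda>x. \<Sum>ij\<in>exponents 0 d. f ij * monomial_at 0 ij x) \<in> polys_at 0 0 d"
        by (intro polys_at_sum polys_at_cmult polys_at_monomial_at)
    then show "p \<in> {p \<in> pieces D V E k d. jump D V E p = 0}"
      unfolding p pieces_def jump_def F_def using left_right_cells
          by (auto simp: fun_eq_iff line_multiples_zero)
  next
    fix p assume "p \<in> {p \<in> pieces D V E k d. jump D V E p = 0}"
    then have p: "p \<in> pieces D V E k d" "jump D V E p = 0" by auto
    have same: "\<forall>x. p (P, x) = p (P0, x)" if P: "P \<in> cells D E" for P
    proof (rule cells_connected_by_jumps[where R = "\<lambda>P Q. \<forall>x. p (P, x) = p (Q, x)"])
      show "\<forall>x. p (left e, x) = p (right e, x)" if "e \<in> Ei" for e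
      proof
        fix x show "p (left e, x) = p (right e, x)"
          using fun_cong[OF p(2), of "(e, x)"] that by (simp add: jump_def)
      qed
    qed (use P P0 in auto)
    have "(\<lambda>x. p (P0, x)) \<in> polys_at 0 0 d" using p(1) P0 by (simp add: pieces_def)
    then obtain c where c: "(\<lambda>x. p (P0, x)) = (\<lambda>x. \<Sum>ij\<in>exponents 0 d. c ij * monomial_at 0 ij x)"
        by (rule polys_atE)
    let ?f = "\<lambda>ij. if ij \<in> exponents 0 d then c ij else 0"
    have "p (P, x) = F ?f (P, x)" for P x
      using same[of P] fun_cong[OF c, of x] p(1) by (simp add: F_def pieces_def)
    then have "p = F ?f" by (auto simp: fun_eq_iff)
    moreover have "?f \<in> ?S" by simp
    ultimately show "p \<in> F ` ?S" by (rule image_eqI)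
  qed
  ultimately show ?thesis by simp
qed

text \<open>The cells at \<open>x\<close> are linked across edges through \<open>x\<close>, and each
  jump vanishes to order \<open>k\<close> on its edge, in particular at \<open>x\<close>. This
  covers vertices as well.\<close>

lemma pieces_compatible:
  assumes p: "p \<in> pieces D V E k d" and x: "x \<in> D"
    and P: "P \<in> cells D E" "x \<in> closure P" and Q: "Q \<in> cells D E" "x \<in> closure Q"
  shows "vanishes k (\<lambda>y. p (P, y) - p (Q, y)) x"
proof -
  have polys_at: "(\<lambda>y. p (S, y)) \<in> polys_at 0 0 d" if "S \<in> cells D E" for S using p that
      by (simp add: pieces_def)
  have neg: "vanishes k (\<lambda>y. p (T, y) - p (S, y)) x"
    if S: "S \<in> cells D E" "T \<in> cells D E" "vanishes k (\<lambda>y. p (S, y) - p (T, y)) x" for S T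
    using vanishes_diff[OF polys_at_zero polys_at_diff[OF polys_at polys_at] vanishes_zero S(3)]
        S(1,2) by simp
  show ?thesis
  proof (rule cells_related_at[OF x, where R = "\<lambda>P Q. vanishes k (\<lambda>y. p (P, y) - p (Q, y)) x"])
    show "vanishes k (\<lambda>y. p (S, y) - p (S, y)) x" for S by (simp add: vanishes_zero)
    show "vanishes k (\<lambda>y. p (S, y) - p (U, y)) x"
      if S: "S \<in> cells D E" "T \<in> cells D E" "U \<in> cells D E" "vanishes k (\<lambda>y. p (S, y) - p (T, y)) x"
        "vanishes k (\<lambda>y. p (T, y) - p (U, y)) x" for S T U
      using vanishes_diff[OF polys_at_diff[OF polys_at[OF S(1)] polys_at[OF S(2)]] polys_at_diff[OF
          polys_at[OF S(3)] polys_at[OF S(2)]] S(4) neg[OF S(2,3,5)]]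
      by simp
    show "vanishes k (\<lambda>y. p (left e, y) - p (right e, y)) x" if e: "e \<in> Ei" "x \<in> e" for e
      using p e edge_form_edge[OF EiD] by (intro line_multiples_vanishes[of _ "src e" "dst e" k d])
          (auto simp: pieces_def)
  qed (use neg P Q in auto)
qed

lemma some_cell:
  assumes "x \<in> D"
  shows "(SOME P. P \<in> cells D E \<and> x \<in> closure P) \<in> cells D E" "x \<in> closure (SOME P. P \<in> cells D E
      \<and> x \<in> closure P)"
proof -
  have "\<exists>P. P \<in> cells D E \<and> x \<in> closure P" using D_covered assms by blast
  from someI_ex[OF this] show "(SOME P. P \<in> cells D E \<and> x \<in> closure P) \<in> cells D E"
    "x \<in> closure (SOME P. P \<in> cells D E \<and> x \<in> closure P)" by auto
qed

lemma glue_on_closure: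
  assumes p: "p \<in> pieces D V E (Suc \<mu>) d" and x: "x \<in> D" and P: "P \<in> cells D E" "x \<in> closure P"
  shows "glue D E p x = p (P, x)"
  using pieces_compatible[OF p x some_cell[OF x] P] x by (simp add: glue_def)

lemma edge_in_closure:
  assumes e: "e \<in> Ei" and x: "x \<in> e - V"
  shows "x \<in> closure (left e)" "x \<in> closure (right e)"
proof -
  have eE: "e \<in> E" using e by (rule EiD)
  have *: "x \<in> closure (side_cell D E V \<sigma> e)" if \<sigma>: "\<sigma> \<noteq> 0" for \<sigma>
    unfolding closure_approachable
  proof (intro allI impI)
    fix \<epsilon> :: real assume \<epsilon>: "\<epsilon> > 0"
    obtain r where r: "r > 0" "\<forall>y\<in>ball x r. 0 < \<sigma> * edge_form e y \<longrightarrow> y \<in> side_cell D E V \<sigma> e"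
        using side_cell(2)[OF e \<sigma> x] by blast
    have "\<exists>y\<in>ball x (min r \<epsilon>). 0 < \<sigma> * edge_form e y"
      by (rule half_ball_meets[OF edge_form_edge[OF eE] edge(1)[OF eE] _ \<sigma>]) (use x r(1) \<epsilon> in auto)
    then obtain y where y: "y \<in> ball x (min r \<epsilon>)" "0 < \<sigma> * edge_form e y" by blast
    then have "y \<in> side_cell D E V \<sigma> e" "dist y x < \<epsilon>" using r(2) by (auto simp: dist_commute)
    then show "\<exists>y\<in>side_cell D E V \<sigma> e. dist y x < \<epsilon>" by blast
  qed
  show "x \<in> closure (left e)" "x \<in> closure (right e)" by (rule *, simp)+
qed

text \<open>Smoothness of order \<mu> corresponds to divisibility by the power \<mu> + 1.
  Divisibility is derived from the infinitely many points of the open edge; smoothness needs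
  compatible pieces at all points of \<open>D\<close>, including the vertices.\<close>

lemma glue_image: 
  assumes "\<mu> < d"
  shows "glue D E ` pieces D V E (Suc \<mu>) d = spline_space d \<mu> D E"
proof (intro subset_antisym subsetI)
  fix f assume "f \<in> glue D E ` pieces D V E (Suc \<mu>) d"
  then obtain p where p: "p \<in> pieces D V E (Suc \<mu>) d" "f = glue D E p" by blast
  have polys_at: "(\<lambda>y. p (S, y)) \<in> polys_at 0 0 d" if "S \<in> cells D E" for S using p that
      by (simp add: pieces_def)
  have "Ck_on \<mu> f D"
  proof (rule Ck_on_pieces[OF open_D finite_cells D_covered polys_at])
    show "f x = p (P, x)" if "P \<in> cells D E" "x \<in> D" "x \<in> closure P" for P x
      unfolding p(2) using glue_on_closure[OF p(1)] that by blast
    show "vanishes (Suc \<mu>) (\<lambda>y. p (P, y) - p (Q, y)) x"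
      if "P \<in> cells D E" "Q \<in> cells D E" "x \<in> D" "x \<in> closure P" "x \<in> closure Q" for P Q x
      using pieces_compatible[OF p(1)] that by blast
  qed
  moreover have "\<exists>q\<in>bivariate_polys d. \<forall>x\<in>P. f x = q x" if P: "P \<in> cells D E" for P
  proof (rule bexI[of _ "\<lambda>x. p (P, x)"])
    show "\<forall>x\<in>P. f x = p (P, x)"
      unfolding p(2) using glue_on_closure[OF p(1) _ P] cells_sub[OF P] closure_subset by blast
  qed (use polys_at[OF P] in \<open>simp add: bivariate_polys_eq\<close>)
  moreover have "f x = 0" if "x \<notin> D" for x using that by (simp add: p(2) glue_def)
  ultimately show "f \<in> spline_space d \<mu> D E" unfolding spline_space_def by blast
next
  fix f assume f: "f \<in> spline_space d \<mu> D E"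
  have Ck: "Ck_on \<mu> f D" and f0: "\<And>x. x \<notin> D \<Longrightarrow> f x = 0" using f by (auto simp: spline_space_def)
  have "\<forall>P\<in>cells D E. \<exists>q. q \<in> polys_at 0 0 d \<and> (\<forall>x\<in>P. f x = q x)"
    using f by (auto simp: spline_space_def bivariate_polys_eq)
  from bchoice[OF this] obtain q where q': "\<forall>P\<in>cells D E. q P \<in> polys_at 0 0 d \<and> (\<forall>x\<in>P. f x
      = q P x)" by (rule exE)
  then have q: "\<And>P. P \<in> cells D E \<Longrightarrow> q P \<in> polys_at 0 0 d" "\<And>P x. P \<in> cells D E \<Longrightarrow> x \<in> P \<Longrightarrow> f x
      = q P x" by auto
  define p where "p = (\<lambda>(P, x). if P \<in> cells D E then q P x else 0)"
  have pq: "p (P, x) = q P x" if "P \<in> cells D E" for P x using that by (simp add: p_def)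
  have "(\<lambda>x. q (left e) x - q (right e) x) \<in> line_multiples (src e) (dst e) (Suc \<mu>) d" if e: "e
      \<in> Ei" for e
  proof (rule vanishes_line_multiplesI)
    have eE: "e \<in> E" using e by (rule EiD)
    note c = left_right_cells[OF e]
    show "(\<lambda>x. q (left e) x - q (right e) x) \<in> polys_at 0 0 d" using q(1) c by (intro polys_at_diff)
    show "src e \<noteq> dst e" by (rule edge(1)[OF eE])
    show "Suc \<mu> \<le> d" using assms by simp
    show "infinite (e - V)" unfolding open_edge[OF eE] using edge(1)[OF eE] by simp
    fix x assume x: "x \<in> e - V"
    show "edge_form e x = 0" using x edge_form_edge[OF eE] by blast
    have xD: "x \<in> D" using open_edge_sub_D[OF e] x by blast
    have sub: "P \<subseteq> D" if "P \<in> cells D E" for P using cells_sub[OF that] by blast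
    show "vanishes (Suc \<mu>) (\<lambda>x. q (left e) x - q (right e) x) x"
      by (rule Ck_on_vanishes[OF Ck open_D xD q(1)[OF c(1)] q(1)[OF c(2)]
            cells_open[OF c(1)] sub[OF c(1)] edge_in_closure(1)[OF e x] q(2)[OF c(1)]
            cells_open[OF c(2)] sub[OF c(2)] edge_in_closure(2)[OF e x] q(2)[OF c(2)]])
  qed
  then have p: "p \<in> pieces D V E (Suc \<mu>) d"
    using q(1) left_right_cells by (auto simp: pieces_def p_def)
  have "f x = glue D E p x" for x
  proof (cases "x \<in> D")
    case True
    let ?P = "SOME P. P \<in> cells D E \<and> x \<in> closure P"
    note P = some_cell[OF True]
    have "f x = q ?P x"
      by (rule eq_on_closure[OF Ck_on_continuous[OF Ck open_D True] polys_at_continuous[OF q(1)[OF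
          P(1)]] P(2) q(2)[OF P(1)]])
    then show ?thesis using True pq[OF P(1)] by (simp add: glue_def)
  next
    case False
    then show ?thesis using f0 by (simp add: glue_def)
  qed
  then have "f = glue D E p" by blast
  then show "f \<in> glue D E ` pieces D V E (Suc \<mu>) d" using p by blast
qed

lemma glue_inj:
  assumes p: "p \<in> pieces D V E (Suc \<mu>) d" and 0: "glue D E p = 0"
  shows "p = 0"
proof (rule ext)
  fix Px :: "plane set \<times> plane"
  obtain P x where Px: "Px = (P, x)" by (cases Px)
  show "p Px = 0 Px"
  proof (cases "P \<in> cells D E")
    case True
    have "p (P, y) = 0" if y: "y \<in> P" for y
    proof -
      have "y \<in> D" "y \<in> closure P" using y cells_sub[OF True] closure_subset by blast+
      then show ?thesis using glue_on_closure[OF p _ True] fun_cong[OF 0, of y] by simp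
    qed
    moreover have "(\<lambda>x. p (P, x)) \<in> polys_at 0 0 d" using p True by (simp add: pieces_def)
    ultimately have "p (P, x) = 0"
      using polys_at_eq_0[OF cells_open[OF True] cells_ne[OF True], of "\<lambda>x. p (P, x)" 0 0 d x]
          by blast
    then show ?thesis by (simp add: Px)
  next
    case False
    then show ?thesis using p by (simp add: Px pieces_def)
  qed
qed

text \<open>The first claim makes the subtraction in the second one exact.\<close>

lemma has_dim_spline_space:
  assumes \<mu>: "\<mu> < d" and sc: "simply_connected D" and disj: "disjoint_truncated_l_edges D E"
    and N: "\<And>A. A \<in> Vi \<Longrightarrow> num_directions E A \<ge> \<mu> + 3"
  shows "card Vi * card (exponents (Suc \<mu>) d) \<le> card Ei * card (exponents 0 (d - Suc \<mu>))"
    "has_dim (spline_space d \<mu> D E)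
      (card (exponents 0 d) + (card Ei * card (exponents 0 (d - Suc \<mu>)) - card Vi * card (exponents
          (Suc \<mu>) d)))"
proof -
  have kd: "Suc \<mu> \<le> d" using \<mu> by simp
  have N': "num_directions E A \<ge> Suc \<mu> + 2" if "A \<in> Vi" for A using N[OF that] by simp
  have im: "vertex_sum D V E ` cofactors D E (Suc \<mu>) d = conditions D V (Suc \<mu>) d"
    by (rule vertex_sum_image[OF N' disj kd])
  note ker = has_dim_kernel[OF linear_vertex_sum has_dim_cofactors, of D V E "Suc \<mu>" d, unfolded im,
      OF has_dim_conditions]
  show "card Vi * card (exponents (Suc \<mu>) d) \<le> card Ei * card (exponents 0 (d - Suc \<mu>))"
      by (rule ker(1))
  have "has_dim (pieces D V E (Suc \<mu>) d)
      (card (exponents 0 d) + (card Ei * card (exponents 0 (d - Suc \<mu>)) - card Vi * card (exponents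
          (Suc \<mu>) d)))"
    by (rule has_dim_kernel_image[OF linear_jump pieces_subspace has_dim_jump_kernel])
       (simp only: jump_image[OF sc kd] ker(2))
  then have "has_dim (glue D E ` pieces D V E (Suc \<mu>) d)
      (card (exponents 0 d) + (card Ei * card (exponents 0 (d - Suc \<mu>)) - card Vi * card (exponents
          (Suc \<mu>) d)))"
    by (rule has_dim_inj_image[OF linear_glue]) (rule glue_inj)
  then show "has_dim (spline_space d \<mu> D E)
      (card (exponents 0 d) + (card Ei * card (exponents 0 (d - Suc \<mu>)) - card Vi * card (exponents
          (Suc \<mu>) d)))"
    by (simp only: glue_image[OF \<mu>])
qed

end

theorem theorem4p1:
  fixes \<mu> d :: nat and \<Psi> V :: "(real^2) set" and E :: "(real^2) set set"
  assumes "\<mu> < d"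
    and "rectilinear_partition \<Psi> V E"
    and "simply_connected \<Psi>"
    and "disjoint_truncated_l_edges \<Psi> E"
    and "\<And>A. A \<in> interior_vertices \<Psi> V \<Longrightarrow> num_directions E A \<ge> \<mu> + 3"
  shows "int (fun_dim (spline_space d \<mu> \<Psi> E)) =
           int ((d + 2) choose 2)
           + (int (card (cross_cuts \<Psi> E)) - int (card (truncated_l_edges \<Psi> E)))
             * int ((d - \<mu> + 1) choose 2)
           + (\<Sum>A\<in>interior_vertices \<Psi> V. k_num d \<mu> (num_directions E A))"
proof -
  interpret partition \<Psi> V E by unfold_locales (rule assms(2))
  let ?c1 = "(d - \<mu> + 1) choose 2" and ?c2 = "card (exponents (Suc \<mu>) d)"
  have c1: "card (exponents 0 (d - Suc \<mu>)) = ?c1"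
    using card_exponents_0[of "d - Suc \<mu>"] assms(1) by (simp add: Suc_diff_Suc)
  note dim = has_dim_spline_space[OF assms(1,3,4,5), unfolded c1, unfolded card_exponents_0]
  have "(\<Sum>A\<in>Vi. k_num d \<mu> (num_directions E A)) = (\<Sum>A\<in>Vi. int (num_directions E A) * int ?c1 - int
      ?c2)"
  proof (rule sum.cong[OF refl])
    fix A assume "A \<in> Vi"
    then have "\<mu> + 2 \<le> num_directions E A" using assms(5)[of A] by simp
    then show "k_num d \<mu> (num_directions E A) = int (num_directions E A) * int ?c1 - int ?c2"
      by (rule k_num_eq[OF assms(1)])
  qed
  also have "\<dots> = (\<Sum>A\<in>Vi. int (num_directions E A)) * int ?c1 - int (card Vi) * int ?c2"
    by (simp add: sum_subtractf sum_distrib_right)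
  finally have k: "(\<Sum>A\<in>Vi. k_num d \<mu> (num_directions E A))
      = (\<Sum>A\<in>Vi. int (num_directions E A)) * int ?c1 - int (card Vi) * int ?c2" .
  have "int (fun_dim (spline_space d \<mu> \<Psi> E)) = int ((d + 2) choose 2)
      + (int (card Ei) * int ?c1 - int (card Vi) * int ?c2)"
    using fun_dim_eqI[OF dim(2)] dim(1) by (simp add: of_nat_diff)
  then show ?thesis unfolding k card_interior_edges by (simp add: algebra_simps)
qed

end
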